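(* Let $G$ be an algebraic supergroup with Lie superalgebra $\mathfrak{g}$. Then $$\bigcap_{M\in\mathrm{Rep}(G),\,M\neq 0}\mathrm{supp}(M)=\mathfrak{g}_{neat}.$$
   Context: Base field: $\mathbf{k}$, algebraically closed of characteristic $0$. The superdimension of a vector superspace $V$ is $\dim V_{\bar 0}-\dim V_{\bar 1}$. "Algebraic supergroup" means affine algebraic group superscheme over $\mathbf{k}$. $\mathrm{Rep}(G)$ is the category of finite-dimensional representations of $G$ in vector superspaces, with even equivariant maps; it is rigid symmetric monoidal (SM) with the super braiding. Let $\mathfrak{m}$ be the $(1|1)$-dimensional Lie superalgebra with basis $\bar x,[\bar x,\bar x]$, $\bar x$ odd; an object of $\mathrm{Rep}(\mathfrak{m})$ is a finite-dimensional superspace with an arbitrary odd operator. (The category $\mathrm{Rep}(\mathfrak{m})$ is $\mathrm{Rep}(\mathbb{M})$ for the "minuscule" pro-supergroup $\mathbb{M}$.) For $x\in\mathfrak{g}_{\bar 1}$ let $R_x:\mathrm{Rep}(G)\to\mathrm{Rep}(\mathfrak{m})$ be the restriction functor along $\bar x\mapsto x$. Let $S:\mathrm{Rep}(\mathfrak{m})\to\overline{\mathrm{Rep}(\mathfrak{m})}\simeq\mathrm{Rep}(OSp(1|2))$ be the semisimplification functor, i.e. the quotient by the tensor ideal of negligible morphisms ($f:C_1\to C_2$ is negligible if $\mathrm{tr}(g\circ f)=0$ for all $g:C_2\to C_1$); in particular $S$ kills exactly the indecomposables of superdimension $0$. Here $OSp(1|2)$ is the connected group of automorphisms of $\mathbf{k}^{1|2}$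 preserving a non-degenerate (super)symmetric form and of Berezinian $1$. Define $\Phi_x=S\circ R_x:\mathrm{Rep}(G)\to\mathrm{Rep}(OSp(1|2))$ and, for $M\in\mathrm{Rep}(G)$, $$\mathrm{supp}(M)=\{x\in\mathfrak{g}_{\bar 1}\mid\Phi_x(M)\neq 0\}.$$ An odd nilpotent operator on a finite-dimensional superspace $V$ makes $V$ a representation of the supergroup $\mathbb{G}_a^{(1|1)}$ (the $(1|1)$-dimensional supergroup with even part $\mathbb{G}_a$ and Lie superalgebra with basis $x,[x,x]$, $x$ odd, $[x,[x,x]]=0$); it acts neatly if all indecomposable direct summands of this module have non-zero superdimension. An element $x\in\mathfrak{g}_{\bar 1}$ is nilpotent if it acts nilpotently on every finite-dimensional representation of $G$; $\mathfrak{g}_{neat}$ is the set of nilpotent $x\in\mathfrak{g}_{\bar 1}$ acting neatly on every finite-dimensional representation of $G$. *)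

theory Defs
  imports
    "HOL-Computational_Algebra.Polynomial"
    "HOL-Library.Poly_Mapping"
    "HOL-Library.Z2"
    "Jordan_Normal_Form.Matrix"
begin

section \<open>Tensor powers of a vector space\<close>

text \<open>
  Tensor products are quotients of free abelian groups: an element of \<open>A \<otimes> A\<close> is given by a formal
  integer combination of pairs, and two of these are identified when their difference lies in the
  subgroup generated by the additivity and balancing relations. Here \<open>s\<close> denotes the scalar
  multiplication on \<open>A\<close>; likewise for \<open>A \<otimes> A \<otimes> A\<close>.
\<close>

inductive_set tensor2_null ::
    "('k \<Rightarrow> 'a \<Rightarrow> 'a) \<Rightarrow> ('a::ab_group_add \<times> 'a \<Rightarrow>\<^sub>0 int) set"
  for s where
  "0 \<in> tensor2_null s"
| "u \<in> tensor2_null s \<Longrightarrow> v \<in> tensor2_null s \<Longrightarrow> u - v \<in> tensor2_null s"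
| "frag_of (a + a', b) - frag_of (a, b) - frag_of (a', b) \<in> tensor2_null s"
| "frag_of (a, b + b') - frag_of (a, b) - frag_of (a, b') \<in> tensor2_null s"
| "frag_of (s c a, b) - frag_of (a, s c b) \<in> tensor2_null s"

inductive_set tensor3_null ::
    "('k \<Rightarrow> 'a \<Rightarrow> 'a) \<Rightarrow> ('a::ab_group_add \<times> 'a \<times> 'a \<Rightarrow>\<^sub>0 int) set"
  for s where
  "0 \<in> tensor3_null s"
| "u \<in> tensor3_null s \<Longrightarrow> v \<in> tensor3_null s \<Longrightarrow> u - v \<in> tensor3_null s"
| "frag_of (a + a', b, d) - frag_of (a, b, d) - frag_of (a', b, d) \<in> tensor3_null s"
| "frag_of (a, b + b', d) - frag_of (a, b, d) - frag_of (a, b', d) \<in> tensor3_null s"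
| "frag_of (a, b, d + d') - frag_of (a, b, d) - frag_of (a, b, d') \<in> tensor3_null s"
| "frag_of (s c a, b, d) - frag_of (a, s c b, d) \<in> tensor3_null s"
| "frag_of (a, s c b, d) - frag_of (a, b, s c d) \<in> tensor3_null s"

definition tensor2_eq where
  "tensor2_eq s t u \<longleftrightarrow> t - u \<in> tensor2_null s"

definition tensor3_eq where
  "tensor3_eq s t u \<longleftrightarrow> t - u \<in> tensor3_null s"

text \<open>The additive extension of a map on simple tensors with values in a ring.\<close>

definition tensor_eval :: "('i \<Rightarrow> 'b::ring_1) \<Rightarrow> ('i \<Rightarrow>\<^sub>0 int) \<Rightarrow> 'b" where
  "tensor_eval f t = (\<Sum>i\<in>Poly_Mapping.keys t. of_int (Poly_Mapping.lookup t i) * f i)"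


section \<open>Algebraic supergroups\<close>

definition koszul :: "bit \<Rightarrow> bit \<Rightarrow> 'r::ring_1" where
  "koszul p q = (if p = 1 \<and> q = 1 then - 1 else 1)"

text \<open>
  An affine supergroup \<open>G\<close> is given by its coordinate Hopf superalgebra, whose underlying ring is the
  type \<open>'a\<close>; \<open>homog G p\<close> is the space of elements of parity \<open>p\<close>. The comultiplication picks a
  representative of an element of the tensor square.
\<close>

record ('k, 'a) supergroup =
  scal :: "'k \<Rightarrow> 'a \<Rightarrow> 'a"
  homog :: "bit \<Rightarrow> 'a set"
  comult :: "'a \<Rightarrow> ('a \<times> 'a \<Rightarrow>\<^sub>0 int)"
  counit :: "'a \<Rightarrow> 'k"
  antipode :: "'a \<Rightarrow> 'a"

definition component :: "('k, 'a::ring_1) supergroup \<Rightarrow> bit \<Rightarrow> 'a \<Rightarrow> 'a" where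
  "component G p a = (THE b. b \<in> homog G p \<and> a - b \<in> homog G (p + 1))"

text \<open>\<open>(a \<otimes> b)(c \<otimes> d) = (-1)\<^bsup>|b||c|\<^esup> ac \<otimes> bd\<close> for homogeneous \<open>b\<close>, \<open>c\<close>.\<close>

definition tensor_mult ::
    "('k, 'a::ring_1) supergroup \<Rightarrow> ('a \<times> 'a \<Rightarrow>\<^sub>0 int) \<Rightarrow> ('a \<times> 'a \<Rightarrow>\<^sub>0 int) \<Rightarrow> ('a \<times> 'a \<Rightarrow>\<^sub>0 int)" where
  "tensor_mult G t u =
     frag_extend (\<lambda>(a, b). frag_extend (\<lambda>(c, d).
       \<Sum>q\<in>{0, 1}. \<Sum>r\<in>{0, 1}.
         frag_cmul (koszul q r) (frag_of (a * component G r c, component G q b * d))) u) t"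

definition subalgebra :: "('k::field, 'a::ring_1) supergroup \<Rightarrow> 'a set \<Rightarrow> bool" where
  "subalgebra G B \<longleftrightarrow>
     Modules.module.subspace (scal G) B \<and> 1 \<in> B \<and> (\<forall>a\<in>B. \<forall>b\<in>B. a * b \<in> B)"

locale algebraic_supergroup =
  fixes G :: "('k::field, 'a::ring_1) supergroup" (structure)
  assumes
    \<comment> \<open>supercommutative superalgebra\<close>
    vector_space: "vector_space (scal G)" and
    scal_mult_left: "scal G c (a * b) = scal G c a * b" and
    scal_mult_right: "scal G c (a * b) = a * scal G c b" and
    homog_subspace: "Modules.module.subspace (scal G) (homog G p)" and
    homog_decomp: "\<exists>!b. b \<in> homog G 0 \<and> a - b \<in> homog G 1" and
    homog_one: "1 \<in> homog G 0" and
    homog_mult: "a \<in> homog G p \<Longrightarrow> b \<in> homog G q \<Longrightarrow> a * b \<in> homog G (p + q)" and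
    supercommute: "a \<in> homog G p \<Longrightarrow> b \<in> homog G q \<Longrightarrow> a * b = koszul p q * (b * a)" and
    \<comment> \<open>finite type\<close>
    finitely_generated: "\<exists>S. finite S \<and> (\<forall>B. S \<subseteq> B \<longrightarrow> subalgebra G B \<longrightarrow> B = UNIV)" and
    \<comment> \<open>comultiplication: an even algebra homomorphism\<close>
    comult_add: "tensor2_eq (scal G) (comult G (a + b)) (comult G a + comult G b)" and
    comult_scal: "tensor2_eq (scal G) (comult G (scal G c a))
      (frag_extend (\<lambda>(a1, a2). frag_of (scal G c a1, a2)) (comult G a))" and
    comult_even: "a \<in> homog G p \<Longrightarrow>
      \<exists>t. tensor2_eq (scal G) (comult G a) t \<and>
          Poly_Mapping.keys t \<subseteq> (\<Union>q. homog G q \<times> homog G (p + q))" and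
    comult_one: "tensor2_eq (scal G) (comult G 1) (frag_of (1, 1))" and
    comult_mult: "tensor2_eq (scal G) (comult G (a * b)) (tensor_mult G (comult G a) (comult G b))" and
    \<comment> \<open>counit: an even algebra homomorphism\<close>
    counit_linear: "Vector_Spaces.linear (scal G) (*) (counit G)" and
    counit_even: "a \<in> homog G 1 \<Longrightarrow> counit G a = 0" and
    counit_one: "counit G 1 = 1" and
    counit_mult: "counit G (a * b) = counit G a * counit G b" and
    \<comment> \<open>antipode: an even linear map\<close>
    antipode_linear: "Vector_Spaces.linear (scal G) (scal G) (antipode G)" and
    antipode_even: "a \<in> homog G p \<Longrightarrow> antipode G a \<in> homog G p" and
    \<comment> \<open>Hopf algebra axioms\<close>
    coassoc: "tensor3_eq (scal G)
      (frag_extend (\<lambda>(a1, a2). frag_extend (\<lambda>(b, c). frag_of (b, c, a2)) (comult G a1)) (comult G a))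
      (frag_extend (\<lambda>(a1, a2). frag_extend (\<lambda>(b, c). frag_of (a1, b, c)) (comult G a2)) (comult G a))" and
    counit_left: "tensor_eval (\<lambda>(a1, a2). scal G (counit G a1) a2) (comult G a) = a" and
    counit_right: "tensor_eval (\<lambda>(a1, a2). scal G (counit G a2) a1) (comult G a) = a" and
    antipode_left: "tensor_eval (\<lambda>(a1, a2). antipode G a1 * a2) (comult G a) = scal G (counit G a) 1" and
    antipode_right: "tensor_eval (\<lambda>(a1, a2). a1 * antipode G a2) (comult G a) = scal G (counit G a) 1"

text \<open>
  The part of parity \<open>p\<close> of the Lie superalgebra, i.e. of the tangent superspace at the identity: point
  superderivations at the counit. The Koszul sign \<open>(-1)\<^bsup>p|a|\<^esup>\<close> in front of the second summand is omitted
  because the counit vanishes on odd \<open>a\<close>.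
\<close>

definition lie_part :: "('k::field, 'a::ring_1) supergroup \<Rightarrow> bit \<Rightarrow> ('a \<Rightarrow> 'k) set" where
  "lie_part G p = {x. Vector_Spaces.linear (scal G) (*) x \<and>
     (\<forall>a\<in>homog G (p + 1). x a = 0) \<and>
     (\<forall>a b. x (a * b) = x a * counit G b + counit G a * x b)}"

text \<open>
  Finite-dimensional superspaces are taken with a homogeneous basis \<open>e\<^sub>0, \<dots>, e\<^sub>n\<^sub>-\<^sub>1\<close>; they are given by
  the list of parities of the basis vectors. A representation of \<open>G\<close>, i.e. a right supercomodule with
  even coaction \<open>e\<^sub>j \<mapsto> \<Sum>\<^sub>i e\<^sub>i \<otimes> c\<^sub>i\<^sub>j\<close>, is given by the parities and the matrix \<open>(c\<^sub>i\<^sub>j)\<close>.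
\<close>

definition Rep :: "('k::field, 'a::ring_1) supergroup \<Rightarrow> (bit list \<times> 'a mat) set" where
  "Rep G = {(ps, C). C \<in> carrier_mat (length ps) (length ps) \<and>
     (\<forall>i<length ps. \<forall>j<length ps.
        C $$ (i, j) \<in> homog G (ps ! i + ps ! j) \<and>
        tensor2_eq (scal G) (comult G (C $$ (i, j)))
          (\<Sum>l<length ps. frag_of (C $$ (i, l), C $$ (l, j))) \<and>
        counit G (C $$ (i, j)) = (if i = j then 1 else 0))}"


section \<open>Representations of \<open>\<mm>\<close>\<close>

text \<open>An object is a superspace (a list of parities) with the matrix of an odd operator.\<close>

type_synonym 'k m_module = "bit list \<times> 'k mat"

definition Rep_m :: "'k::field m_module set" where
  "Rep_m = {(ps, X). X \<in> carrier_mat (length ps) (length ps) \<and>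
     (\<forall>i<length ps. \<forall>j<length ps. ps ! i = ps ! j \<longrightarrow> X $$ (i, j) = 0)}"

definition m_hom :: "'k::field m_module \<Rightarrow> 'k m_module \<Rightarrow> 'k mat set" where
  "m_hom V W = {f \<in> carrier_mat (length (fst W)) (length (fst V)).
     (\<forall>i<length (fst W). \<forall>j<length (fst V). fst W ! i \<noteq> fst V ! j \<longrightarrow> f $$ (i, j) = 0) \<and>
     f * snd V = snd W * f}"

definition m_iso :: "'k::field m_module \<Rightarrow> 'k m_module \<Rightarrow> bool" where
  "m_iso V W \<longleftrightarrow> (\<exists>f\<in>m_hom V W. \<exists>g\<in>m_hom W V.
     g * f = 1\<^sub>m (length (fst V)) \<and> f * g = 1\<^sub>m (length (fst W)))"

definition m_sum :: "'k::field m_module \<Rightarrow> 'k m_module \<Rightarrow> 'k m_module" where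
  "m_sum V W = (fst V @ fst W,
     four_block_mat (snd V) (0\<^sub>m (length (fst V)) (length (fst W)))
                    (0\<^sub>m (length (fst W)) (length (fst V))) (snd W))"

definition direct_summand :: "'k::field m_module \<Rightarrow> 'k m_module \<Rightarrow> bool" where
  "direct_summand N V \<longleftrightarrow> N \<in> Rep_m \<and> (\<exists>W\<in>Rep_m. m_iso V (m_sum N W))"

definition m_indecomposable :: "'k::field m_module \<Rightarrow> bool" where
  "m_indecomposable N \<longleftrightarrow> fst N \<noteq> [] \<and>
     (\<forall>A\<in>Rep_m. \<forall>B\<in>Rep_m. m_iso N (m_sum A B) \<longrightarrow> fst A = [] \<or> fst B = [])"

definition sdim :: "bit list \<Rightarrow> int" where
  "sdim ps = int (count_list ps 0) - int (count_list ps 1)"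

definition supertrace :: "bit list \<Rightarrow> 'k::field mat \<Rightarrow> 'k" where
  "supertrace ps f = (\<Sum>i<length ps. koszul (ps ! i) (ps ! i) * f $$ (i, i))"


section \<open>Semisimplification of \<open>Rep(\<mm>)\<close>\<close>

definition negligible :: "'k::field m_module \<Rightarrow> 'k m_module \<Rightarrow> 'k mat \<Rightarrow> bool" where
  "negligible V W f \<longleftrightarrow> f \<in> m_hom V W \<and> (\<forall>g\<in>m_hom W V. supertrace (fst V) (g * f) = 0)"

text \<open>
  The quotient category has the same objects, and as morphisms the cosets modulo negligible
  morphisms. It is equivalent to the category of representations of \<open>OSp(1|2)\<close>; an equivalence
  preserves and reflects zero objects.
\<close>

definition ss_class :: "'k::field m_module \<Rightarrow> 'k m_module \<Rightarrow> 'k mat \<Rightarrow> 'k mat set" where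
  "ss_class V W f = {g \<in> m_hom V W. negligible V W (g - f)}"

definition ss_hom :: "'k::field m_module \<Rightarrow> 'k m_module \<Rightarrow> 'k mat set set" where
  "ss_hom V W = ss_class V W ` m_hom V W"

definition ss_zero_object :: "'k::field m_module \<Rightarrow> bool" where
  "ss_zero_object Z \<longleftrightarrow>
     (\<forall>V\<in>Rep_m. (\<exists>!\<phi>. \<phi> \<in> ss_hom Z V) \<and> (\<exists>!\<phi>. \<phi> \<in> ss_hom V Z))"


section \<open>Support and neat elements\<close>

text \<open>
  The odd element \<open>x\<close> acts by \<open>(id \<otimes> x) \<circ> \<rho>\<close> for the coaction \<open>\<rho>\<close>, so with the Koszul sign
  \<open>e\<^sub>j \<mapsto> \<Sum>\<^sub>i (-1)\<^bsup>|e\<^sub>i|\<^esup> x(c\<^sub>i\<^sub>j) e\<^sub>i\<close>.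
\<close>

definition restrict_m :: "('a \<Rightarrow> 'k::field) \<Rightarrow> bit list \<times> 'a mat \<Rightarrow> 'k m_module" where
  "restrict_m x M = (fst M,
     mat (length (fst M)) (length (fst M))
       (\<lambda>(i, j). koszul 1 (fst M ! i) * x (snd M $$ (i, j))))"

text \<open>The semisimplification functor is the identity on objects, so on objects \<open>\<Phi>\<^sub>x\<close> is \<open>restrict_m x\<close>.\<close>

definition supp :: "('k::field, 'a::ring_1) supergroup \<Rightarrow> bit list \<times> 'a mat \<Rightarrow> ('a \<Rightarrow> 'k) set" where
  "supp G M = {x \<in> lie_part G 1. \<not> ss_zero_object (restrict_m x M)}"

definition acts_nilpotently :: "'k::field m_module \<Rightarrow> bool" where
  "acts_nilpotently V \<longleftrightarrow> (\<exists>n. snd V ^\<^sub>m n = 0\<^sub>m (length (fst V)) (length (fst V)))"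

text \<open>
  Representations of \<open>\<bbbG>\<^sub>a\<^bsup>(1|1)\<^esup>\<close> are the objects of \<open>Rep(\<mm>)\<close> whose operator is nilpotent. They form a
  full subcategory closed under direct summands, so summands and indecomposability may be taken in
  \<open>Rep(\<mm>)\<close>.
\<close>

definition acts_neatly :: "'k::field m_module \<Rightarrow> bool" where
  "acts_neatly V \<longleftrightarrow> acts_nilpotently V \<and>
     (\<forall>N. direct_summand N V \<longrightarrow> m_indecomposable N \<longrightarrow> sdim (fst N) \<noteq> 0)"

definition lie_nilpotent :: "('k::field, 'a::ring_1) supergroup \<Rightarrow> ('a \<Rightarrow> 'k) set" where
  "lie_nilpotent G = {x \<in> lie_part G 1. \<forall>M\<in>Rep G. acts_nilpotently (restrict_m x M)}"

definition lie_neat :: "('k::field, 'a::ring_1) supergroup \<Rightarrow> ('a \<Rightarrow> 'k) set" where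
  "lie_neat G = {x \<in> lie_nilpotent G. \<forall>M\<in>Rep G. acts_neatly (restrict_m x M)}"

end

theory Submission
  imports Defs "Jordan_Normal_Form.Char_Poly"
begin

text \<open>
  Write \<open>V\<close> for the restriction of a representation \<open>M\<close> of \<open>G\<close> along an odd element \<open>x\<close>: a superspace with
  an odd operator. It becomes zero in the semisimplification exactly when all endomorphisms of \<open>V\<close>
  have supertrace \<open>0\<close>. If \<open>x\<close> is neat and \<open>V\<close> is not zero, the projection onto an indecomposable
  summand has as supertrace its superdimension, which is not zero; so \<open>x\<close> lies in the support of \<open>M\<close>.

  Conversely let \<open>x\<close> lie in the support of every non-zero representation. The heart of the matter is
  that \<open>V\<close> then has no non-zero negligible idempotent endomorphism \<open>\<nu>\<close>
  (\<open>negligible_projection_zero\<close>). This gives both halves of neatness. The projection onto the part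
  where the operator is invertible is negligible, because moving the operator around a supertrace
  changes the sign (\<open>invertible_part_negligible\<close>); so the operator is nilpotent. The projection onto an
  indecomposable summand of superdimension \<open>0\<close> is negligible, because the endomorphisms of that summand
  are sums of a scalar and a nilpotent (\<open>indecomposable_str\<close>); so there is no such summand.

  Suppose that \<open>\<nu> \<noteq> 0\<close> is negligible and put \<open>\<pi> = 1 - \<nu>\<close>. Negligible endomorphisms form a tensor ideal,
  so \<open>1 - \<pi>\<^sup>\<otimes>\<^sup>n\<close> is negligible (\<open>negl_one_minus_tpow\<close>). An idempotent \<open>e\<close> of the \<open>G\<close>-module \<open>M\<^sup>\<otimes>\<^sup>n\<close> with
  \<open>e \<pi>\<^sup>\<otimes>\<^sup>n = 0\<close> has, by \<open>e = e (1 - \<pi>\<^sup>\<otimes>\<^sup>n)\<close>, an image that restricts to a zero object. It remains to find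
  \<open>e \<noteq> 0\<close> for some \<open>n\<close>. One could take a Schur functor of rectangular shape that vanishes on the image of
  \<open>\<pi>\<close> but not on \<open>V\<close>; a dimension count avoids Young symmetrizers (\<open>central_projection_exists\<close>). Let
  \<open>D = dim V\<close> and let \<open>B\<close> be the algebra of matrices on \<open>V\<^sup>\<otimes>\<^sup>n\<close> commuting with the signed permutations of the
  tensor factors; its dimension is at most \<open>(n + 1)\<^bsup>D\<^sup>2\<^esup>\<close>. Since \<open>\<pi>\<close> has a kernel, it factors as \<open>\<pi> = A h\<close>
  where the image of \<open>h\<close> avoids some basis vector. Only \<open>(D - 1)\<^sup>n\<close> basis tensors avoid it, so for large
  \<open>n\<close> the \<open>B\<close>-submodule that they generate is not all of \<open>V\<^sup>\<otimes>\<^sup>n\<close>. As \<open>B\<close> is spanned by integral matrices and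
  closed under transposition, the orthogonal projection \<open>e\<close> onto the complement of this submodule exists
  over the rational numbers and commutes with \<open>B\<close>. It kills \<open>h\<^sup>\<otimes>\<^sup>n\<close> and commutes with \<open>A\<^sup>\<otimes>\<^sup>n\<close>, which lies in
  \<open>B\<close>, and so it kills \<open>\<pi>\<^sup>\<otimes>\<^sup>n\<close> (\<open>idempotent_killing_tensor_power\<close>). The coaction on
  \<open>M\<^sup>\<otimes>\<^sup>n\<close> has its coefficients in \<open>B\<close>, by supercommutativity of the coordinate ring, so \<open>e\<close> is a morphism
  of \<open>G\<close>-modules.
\<close>

section \<open>Matrices indexed by graded finite sets\<close>

definition mul :: "'j set \<Rightarrow> ('i \<Rightarrow> 'j \<Rightarrow> 'k::semiring_0) \<Rightarrow> ('j \<Rightarrow> 'l \<Rightarrow> 'k) \<Rightarrow> 'i \<Rightarrow> 'l \<Rightarrow> 'k" where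
  "mul T f g = (\<lambda>i k. \<Sum>j\<in>T. f i j * g j k)"

definition one_on :: "'i set \<Rightarrow> 'i \<Rightarrow> 'i \<Rightarrow> 'k::zero_neq_one" where
  "one_on S = (\<lambda>i j. if i = j \<and> i \<in> S then 1 else 0)"

text \<open>
  Matrices vanish outside their index sets, so that identities between them are equalities of
  functions.
\<close>

definition even_maps ::
  "'i set \<Rightarrow> ('i \<Rightarrow> bit) \<Rightarrow> 'j set \<Rightarrow> ('j \<Rightarrow> bit) \<Rightarrow> ('i \<Rightarrow> 'j \<Rightarrow> 'k::zero) set" where
  "even_maps S p T q = {f. \<forall>i j. f i j \<noteq> 0 \<longrightarrow> i \<in> S \<and> j \<in> T \<and> p i = q j}"

definition sg :: "bit \<Rightarrow> 'k::ring_1" where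
  "sg a = (if a = 1 then - 1 else 1)"

definition str :: "'i set \<Rightarrow> ('i \<Rightarrow> bit) \<Rightarrow> ('i \<Rightarrow> 'i \<Rightarrow> 'k::ring_1) \<Rightarrow> 'k" where
  "str S p f = (\<Sum>i\<in>S. sg (p i) * f i i)"

lemma koszul_sg: "koszul a a = sg a" "koszul 1 a = sg a" "koszul a 1 = sg a"
  by (auto simp: koszul_def sg_def)

lemma sg_simps [simp]: "sg 0 = 1" "sg 1 = - 1" "sg a * sg a = 1" "sg a * (sg a * t) = t"
  by (auto simp: sg_def)

lemma sg_add: "sg (a + b) = sg a * sg b"
  by (cases a; cases b) (auto simp: sg_def)

lemma sg_neq: "a \<noteq> b \<Longrightarrow> sg a = - sg b"
  by (cases a; cases b) (auto simp: sg_def)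

lemma mul_assoc: "mul T (mul S f g) h = mul S f (mul T g h)"
proof (intro ext)
  fix i l
  have "mul T (mul S f g) h i l = (\<Sum>k\<in>T. \<Sum>j\<in>S. f i j * g j k * h k l)"
    by (simp add: mul_def sum_distrib_right)
  also have "\<dots> = (\<Sum>j\<in>S. \<Sum>k\<in>T. f i j * g j k * h k l)"
    by (rule sum.swap)
  also have "\<dots> = mul S f (mul T g h) i l"
    by (simp add: mul_def sum_distrib_left mult.assoc)
  finally show "mul T (mul S f g) h i l = mul S f (mul T g h) i l" .
qed

lemma mul_diff_left: "mul S (\<lambda>i j. f i j - g i j) h = (\<lambda>i j. mul S f h i j - mul S g h i j)"
  for f :: "_ \<Rightarrow> _ \<Rightarrow> 'k::ring"
  by (simp add: mul_def fun_eq_iff left_diff_distrib sum_subtractf)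

lemma mul_diff_right: "mul S h (\<lambda>i j. f i j - g i j) = (\<lambda>i j. mul S h f i j - mul S h g i j)"
  for f :: "_ \<Rightarrow> _ \<Rightarrow> 'k::ring"
  by (simp add: mul_def fun_eq_iff right_diff_distrib sum_subtractf)

lemma mul_zero [simp]: "mul S (\<lambda>i j. 0) h = (\<lambda>i j. 0)" "mul S h (\<lambda>i j. 0) = (\<lambda>i j. 0)"
  by (auto simp: mul_def)

lemma even_mapsD: "f \<in> even_maps S p T q \<Longrightarrow> f i j \<noteq> 0 \<Longrightarrow> i \<in> S \<and> j \<in> T \<and> p i = q j"
  by (auto simp: even_maps_def)

lemma even_maps_zero: "f \<in> even_maps S p T q \<Longrightarrow> \<not> (i \<in> S \<and> j \<in> T \<and> p i = q j) \<Longrightarrow> f i j = 0"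
  by (auto simp: even_maps_def)

lemma even_maps_mul:
  assumes "f \<in> even_maps S p T q" "g \<in> even_maps T q R r"
  shows "mul T f g \<in> even_maps S p R r"
  unfolding even_maps_def
proof (intro CollectI allI impI)
  fix i k assume "mul T f g i k \<noteq> 0"
  then obtain j where "f i j * g j k \<noteq> 0"
    unfolding mul_def by (meson sum.neutral)
  then have "f i j \<noteq> 0" "g j k \<noteq> 0" by auto
  then show "i \<in> S \<and> k \<in> R \<and> p i = r k"
    using even_mapsD[OF assms(1)] even_mapsD[OF assms(2)] by metis
qed

lemma even_maps_one: "one_on S \<in> even_maps S p S p"
  by (auto simp: even_maps_def one_on_def)

lemma even_maps_diff:
  "f \<in> even_maps S p T q \<Longrightarrow> g \<in> even_maps S p T q \<Longrightarrow> (\<lambda>i j. f i j - g i j) \<in> even_maps S p T q"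
  for f :: "_ \<Rightarrow> _ \<Rightarrow> 'k::ab_group_add"
  unfolding even_maps_def by (clarsimp, metis diff_self)

lemma mul_diag_left:
  fixes f :: "'i \<Rightarrow> 'j \<Rightarrow> 'k::semiring_1"
  assumes "finite S"
  shows "mul S (\<lambda>i j. c i * one_on S i j) f i k = (if i \<in> S then c i * f i k else 0)"
proof -
  have "mul S (\<lambda>i j. c i * one_on S i j) f i k = (\<Sum>j\<in>S. if j = i then c i * f i k else 0)"
    unfolding mul_def one_on_def by (intro sum.cong) auto
  then show ?thesis using assms by simp
qed

lemma mul_diag_right:
  fixes f :: "'i \<Rightarrow> 'j \<Rightarrow> 'k::semiring_1"
  assumes "finite S"
  shows "mul S f (\<lambda>i j. c i * one_on S i j) i k = (if k \<in> S then f i k * c k else 0)"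
proof -
  have "mul S f (\<lambda>i j. c i * one_on S i j) i k = (\<Sum>j\<in>S. if j = k then f i k * c k else 0)"
    unfolding mul_def one_on_def by (intro sum.cong) auto
  then show ?thesis using assms by simp
qed

lemmas mul_one_apply = mul_diag_left[where c = "\<lambda>_. 1", simplified mult_1] mul_diag_right[where c = "\<lambda>_. 1", simplified mult_1 mult_1_right]

lemma even_maps_mul_one:
  fixes f :: "'i \<Rightarrow> 'j \<Rightarrow> 'k::semiring_1"
  assumes "f \<in> even_maps S p T q"
  shows "finite S \<Longrightarrow> mul S (one_on S) f = f" "finite T \<Longrightarrow> mul T f (one_on T) = f"
  using even_maps_zero[OF assms] by (auto simp: mul_one_apply fun_eq_iff)

lemma str_mul_commute:
  fixes f :: "'i \<Rightarrow> 'j \<Rightarrow> 'k::comm_ring_1"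
  assumes "f \<in> even_maps S p T q" "g \<in> even_maps T q S p"
  shows "str S p (mul T f g) = str T q (mul S g f)"
proof -
  have "str S p (mul T f g) = (\<Sum>i\<in>S. \<Sum>j\<in>T. sg (p i) * (f i j * g j i))"
    by (simp add: str_def mul_def sum_distrib_left)
  also have "\<dots> = (\<Sum>i\<in>S. \<Sum>j\<in>T. sg (q j) * (g j i * f i j))"
  proof (intro sum.cong refl)
    fix i j
    show "sg (p i) * (f i j * g j i) = sg (q j) * (g j i * f i j)"
      using even_mapsD[OF assms(1), of i j] by (cases "f i j = 0") (auto simp: mult.commute)
  qed
  also have "\<dots> = str T q (mul S g f)"
    unfolding str_def mul_def sum_distrib_left by (rule sum.swap)
  finally show ?thesis .
qed

text \<open>
  A matrix with a kernel vector \<open>v\<close>, \<open>v\<^sub>m \<noteq> 0\<close>, has its \<open>m\<close>-th column in the span of the other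
  columns, hence factors through a space of smaller dimension; if \<open>v\<close> is homogeneous, so are both
  factors. Inductions on the dimension below all rest on this step.
\<close>

lemma factor_through_smaller:
  fixes y :: "'i \<Rightarrow> 'i \<Rightarrow> 'k::field"
  assumes fin: "finite S" and y: "y \<in> even_maps S p S p"
    and v: "\<And>j. v j \<noteq> 0 \<Longrightarrow> j \<in> S \<and> p j = a" "v m \<noteq> 0"
    and ker: "\<And>i. (\<Sum>j\<in>S. y i j * v j) = 0"
  shows "\<exists>A\<in>even_maps S p (S - {m}) p. \<exists>h\<in>even_maps (S - {m}) p S p. mul (S - {m}) A h = y"
proof -
  define A where "A = (\<lambda>i j. if j = m then 0 else y i j)"
  define h where "h = (\<lambda>l j. if l \<in> S - {m} \<and> j \<in> S
    then (if l = j then 1 else 0) - (if j = m then v l / v m else 0) else 0)"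
  have m: "m \<in> S" using v by blast
  have A: "A \<in> even_maps S p (S - {m}) p"
    using y unfolding A_def even_maps_def by auto
  have h: "h \<in> even_maps (S - {m}) p S p"
    using v unfolding h_def even_maps_def by (auto split: if_splits)
  have "mul (S - {m}) A h i j = y i j" for i j
  proof (cases "j \<in> S")
    case False
    then show ?thesis
      using y by (auto simp: mul_def h_def even_maps_def)
  next
    case True
    show ?thesis
    proof (cases "j = m")
      case False
      have "mul (S - {m}) A h i j = (\<Sum>l\<in>S - {m}. if l = j then y i j else 0)"
        unfolding mul_def using False True by (intro sum.cong) (auto simp: A_def h_def)
      also have "\<dots> = y i j"
        using False True fin by (subst sum.delta) auto
      finally show ?thesis .
    next
      case j: True
      have "mul (S - {m}) A h i m = (\<Sum>l\<in>S - {m}. - (y i l * v l) / v m)"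
        unfolding mul_def using m by (intro sum.cong) (auto simp: A_def h_def)
      also have "\<dots> = - (\<Sum>l\<in>S - {m}. y i l * v l) / v m"
        by (simp add: sum_divide_distrib sum_negf)
      also have "(\<Sum>l\<in>S - {m}. y i l * v l) = - (y i m * v m)"
        using ker[of i] fin m by (simp add: sum.remove eq_neg_iff_add_eq_0 add.commute)
      finally show ?thesis using v j by simp
    qed
  qed
  then show ?thesis
    using A h by blast
qed

text \<open>
  If \<open>e \<noteq> 1\<close>, a column of \<open>1 - e\<close> is a homogeneous kernel vector of \<open>e\<close>; then \<open>e = A h\<close> through a smaller
  space, on which \<open>h e A\<close> is an idempotent with isomorphic image.
\<close>

lemma even_idempotent_splits:
  fixes e :: "'i \<Rightarrow> 'i \<Rightarrow> 'k::field"
  assumes "finite S" "e \<in> even_maps S p S p" "mul S e e = e"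
  shows "\<exists>ps U P. U \<in> even_maps S p {..<length ps} ((!) ps) \<and> P \<in> even_maps {..<length ps} ((!) ps) S p \<and>
    mul {..<length ps} U P = e \<and> mul S P U = one_on {..<length ps}"
  using assms
proof (induction "card S" arbitrary: S e rule: less_induct)
  case less
  show ?case
  proof (cases "e = one_on S")
    case True
    obtain xs where xs: "set xs = S" "distinct xs"
      using finite_distinct_list[OF less.prems(1)] by blast
    define ps where "ps = map p xs"
    define U :: "'i \<Rightarrow> nat \<Rightarrow> 'k" where "U = (\<lambda>i a. if a < length xs \<and> xs ! a = i then 1 else 0)"
    define P :: "nat \<Rightarrow> 'i \<Rightarrow> 'k" where "P = (\<lambda>a i. if a < length xs \<and> xs ! a = i then 1 else 0)"
    have U: "U \<in> even_maps S p {..<length ps} ((!) ps)" "P \<in> even_maps {..<length ps} ((!) ps) S p"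
      using xs by (auto simp: even_maps_def U_def P_def ps_def)
    have "mul {..<length ps} U P i j = e i j" for i j
    proof (cases "i \<in> S")
      case False
      then show ?thesis
        using xs by (auto simp: mul_def U_def P_def True one_on_def ps_def intro!: sum.neutral)
    next
      case iS: True
      then obtain a where a: "a < length xs" "xs ! a = i"
        using xs by (metis in_set_conv_nth)
      have "mul {..<length ps} U P i j = (\<Sum>b\<in>{..<length ps}. if b = a then (if i = j then 1 else 0) else 0)"
        unfolding mul_def
        using xs a by (intro sum.cong) (auto simp: U_def P_def ps_def nth_eq_iff_index_eq)
      also have "\<dots> = e i j"
        using a iS by (simp add: ps_def True one_on_def sum.delta)
      finally show ?thesis .
    qed
    moreover have "mul S P U a b = one_on {..<length ps} a b" for a b
    proof (cases "a < length xs")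
      case False
      then show ?thesis by (simp add: mul_def P_def one_on_def ps_def)
    next
      case aS: True
      have "mul S P U a b = (\<Sum>i\<in>S. if i = xs ! a then (if a = b then 1 else 0) else 0)"
        unfolding mul_def using xs aS
        by (intro sum.cong) (auto simp: U_def P_def nth_eq_iff_index_eq)
      also have "\<dots> = one_on {..<length ps} a b"
        using aS less.prems(1) xs by (subst sum.delta) (auto simp: ps_def one_on_def)
      finally show ?thesis .
    qed
    ultimately show ?thesis
      using U by blast
  next
    case False
    define d where "d = (\<lambda>i j. one_on S i j - e i j)"
    have d: "d \<in> even_maps S p S p"
      unfolding d_def by (intro even_maps_diff even_maps_one less.prems)
    have ed: "mul S e d = (\<lambda>i j. 0)"
      unfolding d_def mul_diff_right
      using less.prems by (simp add: even_maps_mul_one)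
    obtain m j0 where m: "d m j0 \<noteq> 0"
      using False unfolding d_def by (metis (no_types, lifting) diff_eq_diff_eq diff_self ext)
    then have mS: "m \<in> S" using d by (auto dest: even_mapsD)
    have v: "\<And>j. d j j0 \<noteq> 0 \<Longrightarrow> j \<in> S \<and> p j = p j0"
      using d by (auto simp: even_maps_def)
    have ker: "(\<Sum>j\<in>S. e i j * d j j0) = 0" for i
      using ed by (auto simp: mul_def fun_eq_iff)
    let ?S = "S - {m}"
    obtain A h where A: "A \<in> even_maps S p ?S p" and h: "h \<in> even_maps ?S p S p"
      and Ah: "mul ?S A h = e"
      using factor_through_smaller[OF less.prems(1,2) v m ker] by blast
    define A' where "A' = mul S e A"
    have A': "A' \<in> even_maps S p ?S p"
      unfolding A'_def using less.prems A by (intro even_maps_mul)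
    have A'h: "mul ?S A' h = e"
      using less.prems Ah by (simp add: A'_def mul_assoc)
    have eA': "mul S e A' = A'"
      unfolding A'_def using less.prems by (simp flip: mul_assoc)
    define e' where "e' = mul S h A'"
    have e': "e' \<in> even_maps ?S p ?S p"
      unfolding e'_def using h A' by (intro even_maps_mul)
    have e'e': "mul ?S e' e' = e'"
      unfolding e'_def mul_assoc mul_assoc[of ?S S A' h, symmetric] by (simp add: mul_assoc[symmetric] eA')
        (simp add: mul_assoc A'h eA')
    have "card ?S < card S"
      using mS less.prems(1) by (meson card_Diff1_less)
    from less.hyps[OF this _ e' e'e'] less.prems(1)
    obtain ps U P where UP: "U \<in> even_maps ?S p {..<length ps} ((!) ps)"
      "P \<in> even_maps {..<length ps} ((!) ps) ?S p"
      "mul {..<length ps} U P = e'" "mul ?S P U = one_on {..<length ps}"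
      by auto
    let ?n = "{..<length ps}"
    have 1: "mul ?n (mul ?S A' U) (mul ?S P h) = e"
    proof -
      have "mul ?n (mul ?S A' U) (mul ?S P h) = mul ?S A' (mul ?S (mul ?n U P) h)"
        by (simp add: mul_assoc)
      also have "\<dots> = mul S (mul ?S A' h) (mul ?S A' h)"
        unfolding UP e'_def by (simp add: mul_assoc)
      finally show ?thesis using A'h less.prems by simp
    qed
    have 2: "mul S (mul ?S P h) (mul ?S A' U) = one_on ?n"
    proof -
      have "mul S (mul ?S P h) (mul ?S A' U) = mul ?S P (mul ?S e' U)"
        unfolding e'_def by (simp add: mul_assoc)
      also have "\<dots> = mul ?n (mul ?S P U) (mul ?S P U)"
        unfolding UP(3)[symmetric] by (simp add: mul_assoc)
      finally show ?thesis
        using UP(4) by (simp add: even_maps_mul_one[OF even_maps_one])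
    qed
    show ?thesis
      using 1 2 even_maps_mul[OF A' UP(1)] even_maps_mul[OF UP(2) h] by blast
  qed
qed

fun fpow :: "'i set \<Rightarrow> ('i \<Rightarrow> 'i \<Rightarrow> 'k::semiring_1) \<Rightarrow> nat \<Rightarrow> 'i \<Rightarrow> 'i \<Rightarrow> 'k" where
  "fpow S f 0 = one_on S"
| "fpow S f (Suc n) = mul S f (fpow S f n)"

abbreviation square_maps :: "'i set \<Rightarrow> ('i \<Rightarrow> 'i \<Rightarrow> 'k::zero) set" where
  "square_maps S \<equiv> even_maps S (\<lambda>_. 0) S (\<lambda>_. 0)"

lemma even_maps_square: "f \<in> even_maps S p S p \<Longrightarrow> f \<in> square_maps S"
  by (auto simp: even_maps_def)

lemma even_maps_fpow: "f \<in> even_maps S p S p \<Longrightarrow> fpow S f n \<in> even_maps S p S p"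
  by (induction n) (auto intro: even_maps_one even_maps_mul)

lemma fpow_commute:
  assumes "finite S" "g \<in> square_maps S" "mul S f g = mul S g f"
  shows "mul S (fpow S f n) g = mul S g (fpow S f n)"
proof (induction n)
  case 0
  show ?case
    using assms(1,2) by (simp add: even_maps_mul_one)
next
  case (Suc n)
  then show ?case
    by (simp add: mul_assoc) (simp add: assms(3) flip: mul_assoc)
qed

lemma fpow_add:
  assumes "finite S" "f \<in> square_maps S"
  shows "mul S (fpow S f a) (fpow S f b) = fpow S f (a + b)"
  by (induction a) (simp_all add: even_maps_mul_one[OF even_maps_fpow[OF assms(2)] assms(1)]
    assms(1) mul_assoc)

lemma fpow_conjugate:
  assumes "finite S" "finite T" "A \<in> even_maps S p T q"
  shows "fpow T (mul S h A) (Suc n) = mul S h (mul S (fpow S (mul T A h) n) A)"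
proof (induction n)
  case 0
  show ?case
    using assms by (simp add: mul_assoc even_maps_mul_one)
next
  case (Suc n)
  have "fpow T (mul S h A) (Suc (Suc n)) = mul T (mul S h A) (fpow T (mul S h A) (Suc n))"
    by simp
  then show ?case
    by (simp only: Suc.IH) (simp add: mul_assoc)
qed

text \<open>
  A nilpotent even endomorphism \<open>y\<close> has a homogeneous kernel vector, so \<open>y = A h\<close> through a smaller
  space; there \<open>h A\<close> is again nilpotent and has the same supertrace.
\<close>

lemma str_nilpotent:
  fixes y :: "'i \<Rightarrow> 'i \<Rightarrow> 'k::field"
  assumes "finite S" "y \<in> even_maps S p S p" "fpow S y k = (\<lambda>i j. 0)"
  shows "str S p y = 0"
  using assms
proof (induction "card S" arbitrary: S y k rule: less_induct)
  case less
  show ?case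
  proof (cases "S = {}")
    case True
    then show ?thesis by (simp add: str_def)
  next
    case False
    then obtain s where s: "s \<in> S" by blast
    define k' where "k' = (LEAST k. fpow S y k = (\<lambda>i j. 0))"
    have k': "fpow S y k' = (\<lambda>i j. 0)"
      unfolding k'_def using less.prems(3) by (rule LeastI)
    have "k' \<noteq> 0"
    proof
      assume "k' = 0"
      then have "one_on S s s = (0::'k)" using k' by (simp add: fun_eq_iff)
      then show False using s by (simp add: one_on_def)
    qed
    then obtain l where l: "k' = Suc l" by (cases k') auto
    then have "fpow S y l \<noteq> (\<lambda>i j. 0)"
      using not_less_Least[of l "\<lambda>k. fpow S y k = (\<lambda>i j. 0)"] unfolding k'_def by auto
    then obtain m j0 where m: "fpow S y l m j0 \<noteq> 0" by (auto simp: fun_eq_iff)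
    have v: "\<And>j. fpow S y l j j0 \<noteq> 0 \<Longrightarrow> j \<in> S \<and> p j = p j0"
      using even_maps_fpow[OF less.prems(2)] by (auto dest: even_mapsD)
    have ker: "(\<Sum>j\<in>S. y i j * fpow S y l j j0) = 0" for i
      using k' by (auto simp: l mul_def fun_eq_iff)
    let ?S = "S - {m}"
    obtain A h where A: "A \<in> even_maps S p ?S p" and h: "h \<in> even_maps ?S p S p"
      and Ah: "mul ?S A h = y"
      using factor_through_smaller[OF less.prems(1,2) v m ker] by blast
    have "fpow ?S (mul S h A) (Suc k') = (\<lambda>i j. 0)"
      using fpow_conjugate[OF _ _ A, of h k'] less.prems(1) by (simp add: Ah k' del: fpow.simps)
    moreover have "card ?S < card S"
      using m v less.prems(1) by (meson card_Diff1_less)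
    ultimately have "str ?S p (mul S h A) = 0"
      using less.hyps[of ?S "mul S h A" "Suc k'"] less.prems(1) even_maps_mul[OF h A] by auto
    then show ?thesis
      using str_mul_commute[OF A h] Ah by simp
  qed
qed

section \<open>Linear systems and the Fitting decomposition\<close>

lemma underdetermined_system:
  fixes A :: "'s \<Rightarrow> 't \<Rightarrow> 'k::field"
  assumes "finite S" "finite T" "card S < card T"
  shows "\<exists>c. (\<exists>t\<in>T. c t \<noteq> 0) \<and> (\<forall>s\<in>S. (\<Sum>t\<in>T. A s t * c t) = 0)"
  using assms
proof (induction S arbitrary: T A rule: finite_induct)
  case empty
  then obtain t where "t \<in> T" by fastforce
  then show ?case by (intro exI[of _ "\<lambda>_. 1"]) auto
next
  case (insert s S)
  show ?case
  proof (cases "\<forall>t\<in>T. A s t = 0")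
    case True
    have "card S < card T" using insert by simp
    then obtain c where "\<exists>t\<in>T. c t \<noteq> 0" "\<forall>s\<in>S. (\<Sum>t\<in>T. A s t * c t) = 0"
      using insert.IH[of T A] insert.prems by blast
    with True show ?thesis by (intro exI[of _ c]) auto
  next
    case False
    then obtain t0 where t0: "t0 \<in> T" "A s t0 \<noteq> 0" by blast
    define A' where "A' = (\<lambda>s' t. A s' t - A s' t0 * A s t / A s t0)"
    have "card S < card (T - {t0})"
      using insert t0 by simp
    then obtain c where c: "\<exists>t\<in>T - {t0}. c t \<noteq> 0" "\<forall>s\<in>S. (\<Sum>t\<in>T - {t0}. A' s t * c t) = 0"
      using insert.IH[of "T - {t0}" A'] insert.prems by blast
    define c0 where "c0 = - (\<Sum>t\<in>T - {t0}. A s t * c t) / A s t0"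
    define d where "d = c(t0 := c0)"
    have split: "(\<Sum>t\<in>T. A s' t * d t) = A s' t0 * c0 + (\<Sum>t\<in>T - {t0}. A s' t * c t)" for s'
      using insert.prems t0 by (simp add: sum.remove d_def)
    have "(\<Sum>t\<in>T. A s' t * d t) = 0" if "s' \<in> insert s S" for s'
    proof (cases "s' = s")
      case True
      then show ?thesis using t0 by (simp add: split c0_def)
    next
      case False
      then have "0 = (\<Sum>t\<in>T - {t0}. A' s' t * c t)" using c that by simp
      also have "\<dots> = (\<Sum>t\<in>T - {t0}. A s' t * c t - A s' t0 / A s t0 * (A s t * c t))"
        by (intro sum.cong) (auto simp: A'_def left_diff_distrib)
      also have "\<dots> = (\<Sum>t\<in>T. A s' t * d t)"
        unfolding sum_subtractf sum_distrib_left[symmetric] by (simp add: split c0_def)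
      finally show ?thesis by simp
    qed
    moreover have "\<exists>t\<in>T. d t \<noteq> 0" using c by (auto simp: d_def)
    ultimately show ?thesis by blast
  qed
qed

lemma card_le_if_identity_factors:
  fixes f :: "'s \<Rightarrow> 't \<Rightarrow> 'k::field"
  assumes "finite S" "finite T" and id: "\<And>i j. i \<in> S \<Longrightarrow> j \<in> S \<Longrightarrow> mul T f g i j = one_on S i j"
  shows "card S \<le> card T"
proof (rule ccontr)
  assume "\<not> card S \<le> card T"
  then obtain c where c: "\<exists>s\<in>S. c s \<noteq> 0" "\<forall>t\<in>T. (\<Sum>s\<in>S. g t s * c s) = 0"
    using underdetermined_system[of T S g] assms by auto
  have "c s = 0" if s: "s \<in> S" for s
  proof -
    have "c s = (\<Sum>s'\<in>S. if s' = s then c s else 0)" using s assms by simp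
    also have "\<dots> = (\<Sum>s'\<in>S. mul T f g s s' * c s')"
      using s id by (intro sum.cong) (auto simp: one_on_def)
    also have "\<dots> = (\<Sum>t\<in>T. \<Sum>s'\<in>S. f s t * (g t s' * c s'))"
      by (subst sum.swap) (simp add: mul_def sum_distrib_right mult.assoc)
    also have "\<dots> = 0" using c(2) by (simp flip: sum_distrib_left)
    finally show ?thesis .
  qed
  then show False using c(1) by blast
qed

text \<open>
  Fitting decomposition: \<open>\<nu>\<close> is the projection onto the part where \<open>f\<close> is invertible, along the part
  where it is nilpotent. The lowest term of a linear relation between the powers of \<open>f\<close> gives
  \<open>f\<^sup>k = f\<^sup>k\<^sup>+\<^sup>1 g\<close> with \<open>g\<close> a polynomial in \<open>f\<close>, and then \<open>\<nu> = f\<^sup>k g\<^sup>k\<close>.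
\<close>

lemma fitting:
  fixes f :: "'i \<Rightarrow> 'i \<Rightarrow> 'k::field"
  assumes fin: "finite S" and f: "f \<in> square_maps S"
  shows "\<exists>\<nu> w k. \<nu> \<in> square_maps S \<and> w \<in> square_maps S \<and> mul S \<nu> \<nu> = \<nu> \<and> mul S f w = \<nu> \<and>
    mul S w f = \<nu> \<and> mul S (fpow S f k) \<nu> = fpow S f k \<and>
    (\<forall>g\<in>square_maps S. mul S f g = mul S g f \<longrightarrow> mul S \<nu> g = mul S g \<nu> \<and> mul S w g = mul S g w)"
proof -
  note fp = even_maps_fpow[OF f]
  note fadd = fpow_add[OF fin f]
  define N where "N = card (S \<times> S)"
  obtain c where c: "\<exists>t\<in>{..N}. c t \<noteq> 0"
    and rel0: "\<forall>s\<in>S \<times> S. (\<Sum>t\<in>{..N}. (case s of (i, j) \<Rightarrow> fpow S f t i j) * c t) = 0"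
    using underdetermined_system[of "S \<times> S" "{..N}" "\<lambda>(i, j) t. fpow S f t i j"] fin
    by (auto simp: N_def)
  have rel: "(\<Sum>t\<le>N. fpow S f t i j * c t) = 0" for i j
  proof (cases "(i, j) \<in> S \<times> S")
    case True
    then show ?thesis using rel0 by fastforce
  next
    case False
    then have "fpow S f t i j = 0" for t using even_maps_zero[OF fp] by fastforce
    then show ?thesis by simp
  qed
  (* c k is the lowest non-zero coefficient of the relation *)
  define k where "k = (LEAST t. t \<le> N \<and> c t \<noteq> 0)"
  have k: "k \<le> N" "c k \<noteq> 0"
    unfolding k_def using c by (metis (mono_tags, lifting) LeastI atMost_iff)+
  have below: "c t = 0" if "t < k" for t
    using that k not_less_Least[of t "\<lambda>t. t \<le> N \<and> c t \<noteq> 0"] unfolding k_def by auto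
  define g where "g = (\<lambda>i j. \<Sum>t\<in>{Suc k..N}. (- c t / c k) * fpow S f (t - Suc k) i j)"
  have g: "g \<in> square_maps S"
    using fp unfolding g_def even_maps_def by (fastforce intro: sum.neutral)
  have mul_g: "mul S h g i j = (\<Sum>t\<in>{Suc k..N}. (- c t / c k) * mul S h (fpow S f (t - Suc k)) i j)"
    and g_mul: "mul S g h i j = (\<Sum>t\<in>{Suc k..N}. (- c t / c k) * mul S (fpow S f (t - Suc k)) h i j)"
    for h :: "'i \<Rightarrow> 'i \<Rightarrow> 'k" and i j
    unfolding mul_def g_def
    by (simp_all add: sum_distrib_left sum_distrib_right mult_ac, (subst sum.swap, simp add: mult_ac)+)
  have step: "fpow S f k = mul S (fpow S f (Suc k)) g"
  proof (intro ext)
    fix i j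
    have "{..N} = {..<k} \<union> {k} \<union> {Suc k..N}" using k by auto
    then have "0 = (\<Sum>t\<in>{..<k} \<union> {k} \<union> {Suc k..N}. fpow S f t i j * c t)"
      using rel by metis
    also have "\<dots> = fpow S f k i j * c k + (\<Sum>t\<in>{Suc k..N}. fpow S f t i j * c t)"
      by (subst sum.union_disjoint; (subst sum.union_disjoint)?) (auto simp: below)
    finally have "fpow S f k i j = - (\<Sum>t\<in>{Suc k..N}. fpow S f t i j * c t) / c k"
      using k by (simp add: field_simps eq_neg_iff_add_eq_0)
    also have "\<dots> = mul S (fpow S f (Suc k)) g i j"
      unfolding mul_g fadd by (simp add: sum_divide_distrib sum_negf mult.commute)
    finally show "fpow S f k i j = mul S (fpow S f (Suc k)) g i j" .
  qed
  have comm_g: "mul S g h = mul S h g" if "h \<in> square_maps S" "mul S f h = mul S h f" for h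
    using fpow_commute[OF fin that] by (intro ext) (simp add: mul_g g_mul)
  have fg: "mul S f g = mul S g f" using comm_g[OF f] by simp
  let ?F = "fpow S f" and ?G = "fpow S g"
  have G: "?G n \<in> square_maps S" for n by (rule even_maps_fpow[OF g])
  have fG: "mul S (?G n) h = mul S h (?G n)" if "h \<in> square_maps S" "mul S f h = mul S h f" for n h
    using fpow_commute[OF fin that(1) comm_g[OF that]] .
  have FG: "mul S (?F m) (?G n) = mul S (?G n) (?F m)" for m n
    using fG[OF fp fpow_commute[OF fin f refl, symmetric]] by simp
  have iter: "?F (k + m) = mul S (?F (k + m + n)) (?G n)" for m n
  proof (induction n)
    case 0
    then show ?case using even_maps_mul_one[OF fp] fin by simp
  next
    case (Suc n)
    have "?F (k + m + n) = mul S (?F (m + n)) (mul S (?F (Suc k)) g)"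
      by (simp only: flip: step) (simp add: fadd add_ac)
    also have "\<dots> = mul S (?F (k + m + Suc n)) g"
      by (simp only: fadd flip: mul_assoc) (simp add: add_ac)
    finally show ?case
      using Suc by (simp add: mul_assoc del: fpow.simps(2)) simp
  qed
  let ?k = "Suc k"
  define \<nu> where "\<nu> = mul S (?F ?k) (?G ?k)"
  define w where "w = mul S (?F k) (?G ?k)"
  have F\<nu>: "mul S (?F ?k) \<nu> = ?F ?k"
    unfolding \<nu>_def using iter[of 1 ?k] by (simp only: fadd flip: mul_assoc) simp
  have "\<nu> \<in> square_maps S" "w \<in> square_maps S"
    unfolding \<nu>_def w_def using even_maps_mul[OF fp G] by blast+
  moreover have "mul S \<nu> \<nu> = \<nu>"
  proof -
    have "mul S \<nu> \<nu> = mul S (?G ?k) (mul S (?F ?k) \<nu>)"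
      by (simp only: \<nu>_def FG mul_assoc)
    then show ?thesis unfolding F\<nu> by (simp only: \<nu>_def FG)
  qed
  moreover have fw: "mul S f w = \<nu>"
    by (simp add: \<nu>_def w_def mul_assoc)
  moreover have comm: "mul S \<nu> h = mul S h \<nu> \<and> mul S w h = mul S h w"
    if h: "h \<in> square_maps S" "mul S f h = mul S h f" for h
  proof -
    have "mul S (mul S (?F n) (?G m)) h = mul S h (mul S (?F n) (?G m))" for n m
      by (simp only: mul_assoc fG[OF h]) (simp only: fpow_commute[OF fin h] flip: mul_assoc)
    then show ?thesis by (simp only: \<nu>_def w_def)
  qed
  moreover have "mul S w f = \<nu>"
    using comm[OF f refl] fw by simp
  ultimately show ?thesis
    using F\<nu> by blast
qed

text \<open>The grading operator detects evenness, as the characteristic is not \<open>2\<close>.\<close>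

lemma even_if_commutes_with_grading:
  fixes f :: "'i \<Rightarrow> 'i \<Rightarrow> 'k::field_char_0"
  assumes fin: "finite S" and f: "f \<in> square_maps S"
    and comm: "mul S f (\<lambda>i j. sg (p i) * one_on S i j) = mul S (\<lambda>i j. sg (p i) * one_on S i j) f"
  shows "f \<in> even_maps S p S p"
  unfolding even_maps_def
proof (intro CollectI allI impI)
  fix i j assume ij: "f i j \<noteq> 0"
  then have S: "i \<in> S" "j \<in> S" using f by (auto dest: even_mapsD)
  have "f i j * sg (p j) = sg (p i) * f i j"
    using fun_cong[OF fun_cong[OF comm, of i], of j] S by (simp add: mul_diag_left[OF fin] mul_diag_right[OF fin])
  then have "f i j * (sg (p j) - sg (p i)) = 0" by (simp add: right_diff_distrib mult.commute)
  then have "sg (p i) = (sg (p j) :: 'k)" using ij by simp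
  then have "p i = p j"
    by (cases "p i"; cases "p j") (auto simp: eq_neg_iff_add_eq_0)
  then show "i \<in> S \<and> j \<in> S \<and> p i = p j" using S by simp
qed

lemma grading_square: "(\<lambda>i j. sg (p i) * one_on S i j) \<in> square_maps S"
  by (auto simp: even_maps_def one_on_def)

lemma even_commutes_with_grading:
  fixes f :: "'i \<Rightarrow> 'i \<Rightarrow> 'k::comm_ring_1"
  assumes fin: "finite S" and f: "f \<in> even_maps S p S p"
  shows "mul S f (\<lambda>i j. sg (p i) * one_on S i j) = mul S (\<lambda>i j. sg (p i) * one_on S i j) f"
proof (intro ext)
  fix i l
  show "mul S f (\<lambda>i j. sg (p i) * one_on S i j) i l = mul S (\<lambda>i j. sg (p i) * one_on S i j) f i l"
    using even_mapsD[OF f, of i l]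
    by (cases "f i l = 0") (auto simp: mul_diag_left[OF fin] mul_diag_right[OF fin] mult.commute)
qed

text \<open>
  Only the odd part of \<open>g\<close> contributes to the diagonal of \<open>f g\<close>, so this is the vanishing of the
  supertrace on supercommutators.
\<close>

lemma str_odd_commute:
  fixes f :: "'i \<Rightarrow> 'i \<Rightarrow> 'k::comm_ring_1"
  assumes "\<And>i j. f i j \<noteq> 0 \<Longrightarrow> p i \<noteq> p j"
  shows "str S p (mul S f g) = - str S p (mul S g f)"
proof -
  have "str S p (mul S f g) = (\<Sum>i\<in>S. \<Sum>j\<in>S. sg (p i) * (f i j * g j i))"
    by (simp add: str_def mul_def sum_distrib_left)
  also have "\<dots> = (\<Sum>i\<in>S. \<Sum>j\<in>S. - (sg (p j) * (g j i * f i j)))"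
  proof (intro sum.cong refl)
    fix i j
    show "sg (p i) * (f i j * g j i) = - (sg (p j) * (g j i * f i j))"
      using assms[of i j] sg_neq[where 'a = 'k, of "p i" "p j"] by (cases "f i j = 0") (auto simp: mult.commute)
  qed
  also have "\<dots> = - (\<Sum>j\<in>S. \<Sum>i\<in>S. sg (p j) * (g j i * f i j))"
    by (subst sum.swap) (simp add: sum_negf)
  also have "\<dots> = - str S p (mul S g f)"
    by (simp add: str_def mul_def sum_distrib_left)
  finally show ?thesis .
qed

section \<open>Representations of \<open>\<mm>\<close> as graded index sets with an odd operator\<close>

definition maps ::
  "'i set \<Rightarrow> ('i \<Rightarrow> bit) \<Rightarrow> ('i \<Rightarrow> 'i \<Rightarrow> 'k::semiring_0) \<Rightarrow>
   'j set \<Rightarrow> ('j \<Rightarrow> bit) \<Rightarrow> ('j \<Rightarrow> 'j \<Rightarrow> 'k) \<Rightarrow> ('j \<Rightarrow> 'i \<Rightarrow> 'k) set" where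
  "maps S p X T q Y = {f \<in> even_maps T q S p. mul S f X = mul T Y f}"

abbreviation endos :: "'i set \<Rightarrow> ('i \<Rightarrow> bit) \<Rightarrow> ('i \<Rightarrow> 'i \<Rightarrow> 'k::semiring_0) \<Rightarrow> ('i \<Rightarrow> 'i \<Rightarrow> 'k) set" where
  "endos S p X \<equiv> maps S p X S p X"

lemma maps_mul:
  assumes "f \<in> maps S p X T q Y" "g \<in> maps T q Y R r Z"
  shows "mul T g f \<in> maps S p X R r Z"
proof -
  have "mul S (mul T g f) X = mul T g (mul T Y f)"
    using assms by (simp add: maps_def mul_assoc)
  also have "\<dots> = mul R Z (mul T g f)"
    using assms by (simp add: maps_def flip: mul_assoc)
  finally show ?thesis
    using assms even_maps_mul by (auto simp: maps_def)
qed

lemma maps_diff: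
  fixes X :: "'i \<Rightarrow> 'i \<Rightarrow> 'k::ring"
  shows "f \<in> maps S p X T q Y \<Longrightarrow> g \<in> maps S p X T q Y \<Longrightarrow> (\<lambda>i j. f i j - g i j) \<in> maps S p X T q Y"
  by (simp add: maps_def even_maps_diff mul_diff_left mul_diff_right)

lemma maps_mul_one:
  fixes X :: "'i \<Rightarrow> 'i \<Rightarrow> 'k::semiring_1"
  assumes "f \<in> maps S p X T q Y"
  shows "finite T \<Longrightarrow> mul T (one_on T) f = f" "finite S \<Longrightarrow> mul S f (one_on S) = f"
  using assms unfolding maps_def by (auto simp: even_maps_mul_one)

lemma maps_one:
  fixes X :: "'i \<Rightarrow> 'i \<Rightarrow> 'k::semiring_1"
  assumes "finite S" "X \<in> square_maps S"
  shows "one_on S \<in> endos S p X"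
  using assms by (simp add: maps_def even_maps_one even_maps_mul_one)

text \<open>
  For an endomorphism it is enough to pair with endomorphisms of the same object.
\<close>

definition negl :: "'i set \<Rightarrow> ('i \<Rightarrow> bit) \<Rightarrow> ('i \<Rightarrow> 'i \<Rightarrow> 'k::ring_1) \<Rightarrow> ('i \<Rightarrow> 'i \<Rightarrow> 'k) \<Rightarrow> bool" where
  "negl S p X f \<longleftrightarrow> f \<in> endos S p X \<and> (\<forall>h\<in>endos S p X. str S p (mul S f h) = 0)"

definition entries :: "'k::zero mat \<Rightarrow> nat \<Rightarrow> nat \<Rightarrow> 'k" where
  "entries A = (\<lambda>i j. if i < dim_row A \<and> j < dim_col A then A $$ (i, j) else 0)"

abbreviation idx :: "'k m_module \<Rightarrow> nat set" where "idx V \<equiv> {..<length (fst V)}"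
abbreviation par :: "'k m_module \<Rightarrow> nat \<Rightarrow> bit" where "par V \<equiv> (!) (fst V)"
abbreviation op_of :: "'k::zero m_module \<Rightarrow> nat \<Rightarrow> nat \<Rightarrow> 'k" where "op_of V \<equiv> entries (snd V)"

abbreviation homs :: "'k::field m_module \<Rightarrow> 'k m_module \<Rightarrow> (nat \<Rightarrow> nat \<Rightarrow> 'k) set" where
  "homs V W \<equiv> maps (idx V) (par V) (op_of V) (idx W) (par W) (op_of W)"

abbreviation end_str :: "'k::field m_module \<Rightarrow> (nat \<Rightarrow> nat \<Rightarrow> 'k) \<Rightarrow> 'k" where
  "end_str V \<equiv> str (idx V) (par V)"

lemma entries_mult:
  fixes A :: "'k::semiring_0 mat"
  assumes "A \<in> carrier_mat n m" "B \<in> carrier_mat m l"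
  shows "entries (A * B) = mul {..<m} (entries A) (entries B)"
  using assms
  by (intro ext) (auto simp: entries_def mul_def scalar_prod_def atLeast0LessThan intro!: sum.cong sum.neutral)

lemma entries_one: "entries (1\<^sub>m n) = one_on {..<n}"
  by (intro ext) (auto simp: entries_def one_on_def)

lemma entries_zero: "entries (0\<^sub>m n m) = (\<lambda>i j. 0)"
  by (intro ext) (auto simp: entries_def)

lemma entries_mat: "entries (mat n m (\<lambda>(i, j). f i j)) = f"
  if "\<And>i j. f i j \<noteq> 0 \<Longrightarrow> i < n \<and> j < m"
  using that by (intro ext) (fastforce simp: entries_def)

lemma entries_inject:
  assumes "A \<in> carrier_mat n m" "B \<in> carrier_mat n m" "entries A = entries B"
  shows "A = B"
proof (rule eq_matI)
  fix i j assume "i < dim_row B" "j < dim_col B"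
  then show "A $$ (i, j) = B $$ (i, j)"
    using assms(1,2) fun_cong[OF fun_cong[OF assms(3), of i], of j] by (simp add: entries_def)
qed (use assms in auto)

lemma entries_square: "A \<in> carrier_mat n n \<Longrightarrow> entries A \<in> square_maps {..<n}"
  by (auto simp: entries_def even_maps_def split: if_splits)

lemma entries_pow:
  fixes A :: "'k::comm_ring_1 mat"
  assumes "A \<in> carrier_mat n n"
  shows "entries (A ^\<^sub>m k) = fpow {..<n} (entries A) k"
proof (induction k)
  case 0
  then show ?case using assms by (simp add: entries_one)
next
  case (Suc k)
  have "entries (A ^\<^sub>m Suc k) = mul {..<n} (fpow {..<n} (entries A) k) (entries A)"
    using assms Suc by (simp add: entries_mult[where n = n and m = n and l = n])
  then show ?case
    using fpow_commute[OF finite_lessThan entries_square[OF assms] refl, of k] by simp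
qed

lemma Rep_mD:
  assumes "V \<in> Rep_m"
  shows "snd V \<in> carrier_mat (length (fst V)) (length (fst V))"
    "op_of V i j \<noteq> 0 \<Longrightarrow> i \<in> idx V \<and> j \<in> idx V \<and> par V i \<noteq> par V j"
    "op_of V \<in> square_maps (idx V)"
  using assms by (auto simp: Rep_m_def entries_def even_maps_def split: if_splits)

lemma m_hom_iff:
  assumes "V \<in> Rep_m" "W \<in> Rep_m"
  shows "f \<in> m_hom V W \<longleftrightarrow> f \<in> carrier_mat (length (fst W)) (length (fst V)) \<and> entries f \<in> homs V W"
proof (cases "f \<in> carrier_mat (length (fst W)) (length (fst V))")
  case True
  have "f * snd V = snd W * f \<longleftrightarrow> entries (f * snd V) = entries (snd W * f)"
    using entries_inject[OF mult_carrier_mat[OF True Rep_mD(1)[OF assms(1)]]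
        mult_carrier_mat[OF Rep_mD(1)[OF assms(2)] True]] by auto
  moreover have "entries (f * snd V) = mul (idx V) (entries f) (op_of V)"
      "entries (snd W * f) = mul (idx W) (op_of W) (entries f)"
    using entries_mult[OF True Rep_mD(1)[OF assms(1)]] entries_mult[OF Rep_mD(1)[OF assms(2)] True]
    by auto
  moreover have "(\<forall>i<length (fst W). \<forall>j<length (fst V). fst W ! i \<noteq> fst V ! j \<longrightarrow> f $$ (i, j) = 0) \<longleftrightarrow>
      entries f \<in> even_maps (idx W) (par W) (idx V) (par V)"
    using True by (auto simp: entries_def even_maps_def)
  ultimately show ?thesis
    using True by (auto simp: m_hom_def maps_def)
qed (auto simp: m_hom_def)

definition to_mat :: "'k::field m_module \<Rightarrow> 'k m_module \<Rightarrow> (nat \<Rightarrow> nat \<Rightarrow> 'k) \<Rightarrow> 'k mat" where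
  "to_mat V W f = mat (length (fst W)) (length (fst V)) (\<lambda>(i, j). f i j)"

lemma to_mat_hom:
  assumes "V \<in> Rep_m" "W \<in> Rep_m" "f \<in> homs V W"
  shows "entries (to_mat V W f) = f" "to_mat V W f \<in> m_hom V W"
proof -
  have "\<And>i j. f i j \<noteq> 0 \<Longrightarrow> i < length (fst W) \<and> j < length (fst V)"
    using assms(3) by (auto simp: maps_def dest: even_mapsD)
  then show e: "entries (to_mat V W f) = f"
    unfolding to_mat_def by (rule entries_mat)
  show "to_mat V W f \<in> m_hom V W"
    using assms e by (simp add: m_hom_iff) (simp add: to_mat_def)
qed

lemma supertrace_str:
  assumes "f \<in> carrier_mat (length ps) (length ps)"
  shows "supertrace ps f = str {..<length ps} ((!) ps) (entries f)"
  using assms by (simp add: supertrace_def str_def entries_def koszul_sg)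

text \<open>
  An object becomes zero in the quotient category exactly when its identity is negligible; by
  cyclicity of the supertrace every morphism into or out of it is then negligible.
\<close>

lemma ss_zero_object_iff:
  assumes Z: "Z \<in> Rep_m"
  shows "ss_zero_object Z \<longleftrightarrow> (\<forall>h\<in>homs Z Z. end_str Z h = 0)"
proof
  assume zero: "ss_zero_object Z"
  let ?n = "length (fst Z)"
  have 1: "1\<^sub>m ?n \<in> m_hom Z Z"
    using Z by (simp add: m_hom_iff entries_one maps_one Rep_mD)
  have 0: "0\<^sub>m ?n ?n \<in> m_hom Z Z"
    using Z by (simp add: m_hom_iff entries_zero maps_def even_maps_def)
  have "ss_class Z Z (1\<^sub>m ?n) = ss_class Z Z (0\<^sub>m ?n ?n)"
    using zero Z 0 1 unfolding ss_zero_object_def ss_hom_def by blast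
  moreover have "1\<^sub>m ?n \<in> ss_class Z Z (1\<^sub>m ?n)"
  proof -
    have z: "1\<^sub>m ?n - 1\<^sub>m ?n = (0\<^sub>m ?n ?n :: 'a mat)"
      by (intro eq_matI) auto
    have "supertrace (fst Z) (g * 0\<^sub>m ?n ?n) = 0" if "g \<in> m_hom Z Z" for g
      using that by (simp add: m_hom_def supertrace_str entries_zero right_mult_zero_mat[of _ ?n ?n] str_def)
    then show ?thesis
      using 0 1 by (simp add: ss_class_def negligible_def z)
  qed
  ultimately have neg: "negligible Z Z (1\<^sub>m ?n - 0\<^sub>m ?n ?n)"
    by (auto simp: ss_class_def)
  have "1\<^sub>m ?n - 0\<^sub>m ?n ?n = (1\<^sub>m ?n :: 'a mat)"
    by (intro eq_matI) auto
  with neg have neg: "negligible Z Z (1\<^sub>m ?n)" by simp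
  show "\<forall>h\<in>homs Z Z. end_str Z h = 0"
  proof
    fix h assume h: "h \<in> homs Z Z"
    let ?h = "to_mat Z Z h"
    have "?h \<in> m_hom Z Z" and e: "entries ?h = h"
      using to_mat_hom[OF Z Z h] by auto
    then have "supertrace (fst Z) (?h * 1\<^sub>m ?n) = 0" and c: "?h \<in> carrier_mat ?n ?n"
      using neg by (auto simp: negligible_def m_hom_def)
    then show "end_str Z h = 0"
      using e by (simp add: supertrace_str)
  qed
next
  assume triv: "\<forall>h\<in>homs Z Z. end_str Z h = 0"
  have single: "\<exists>!\<phi>. \<phi> \<in> ss_hom V W" if VW: "V \<in> Rep_m" "W \<in> Rep_m" and Zor: "V = Z \<or> W = Z" for V W
  proof -
    let ?m = "length (fst V)" and ?n = "length (fst W)"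
    have cl: "ss_class V W f = m_hom V W" if f: "f \<in> m_hom V W" for f
    proof -
      have "negligible V W (g - f)" if g: "g \<in> m_hom V W" for g
      proof -
        have "entries (g - f) = (\<lambda>i j. entries g i j - entries f i j)"
          using f g by (intro ext) (auto simp: entries_def m_hom_def)
        then have gf: "entries (g - f) \<in> homs V W" "g - f \<in> carrier_mat ?n ?m"
          using f g maps_diff[of "entries g" "idx V"] by (auto simp: m_hom_iff[OF VW])
        have "supertrace (fst V) (h * (g - f)) = 0" if h: "h \<in> m_hom W V" for h
        proof -
          have hc: "h \<in> carrier_mat ?m ?n" and he: "entries h \<in> homs W V"
            using h VW by (auto simp: m_hom_iff)
          have st: "supertrace (fst V) (h * (g - f)) = end_str V (mul (idx W) (entries h) (entries (g - f)))"
            using hc gf by (simp add: supertrace_str[where ps = "fst V"] entries_mult[where n = ?m])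
          show ?thesis
          proof (cases "V = Z")
            case True
            then show ?thesis
              unfolding st using triv maps_mul[OF gf(1) he] by simp
          next
            case False
            then have "W = Z" using Zor by simp
            moreover have "end_str V (mul (idx W) (entries h) (entries (g - f))) =
                end_str W (mul (idx V) (entries (g - f)) (entries h))"
              using he gf by (intro str_mul_commute) (auto simp: maps_def)
            ultimately show ?thesis
              unfolding st using triv maps_mul[OF he gf(1)] by simp
          qed
        qed
        then show ?thesis
          unfolding negligible_def using gf by (simp add: m_hom_iff[OF VW])
      qed
      then show ?thesis by (auto simp: ss_class_def)
    qed
    have "0\<^sub>m ?n ?m \<in> m_hom V W"
      using VW by (simp add: m_hom_iff entries_zero maps_def even_maps_def)
    then have "ss_hom V W = {m_hom V W}"
      unfolding ss_hom_def using cl by auto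
    then show ?thesis by simp
  qed
  show "ss_zero_object Z"
    unfolding ss_zero_object_def using single Z by blast
qed

definition retract :: "'k::field m_module \<Rightarrow> 'k m_module \<Rightarrow> (nat \<Rightarrow> nat \<Rightarrow> 'k) \<Rightarrow> (nat \<Rightarrow> nat \<Rightarrow> 'k) \<Rightarrow> bool" where
  "retract N V u r \<longleftrightarrow> u \<in> homs N V \<and> r \<in> homs V N \<and> mul (idx V) r u = one_on (idx N)"

lemma m_sum_Rep_m:
  assumes "A \<in> Rep_m" "B \<in> Rep_m"
  shows "m_sum A B \<in> Rep_m"
  using assms by (auto simp: Rep_m_def m_sum_def nth_append)

lemma op_of_m_sum:
  assumes "A \<in> Rep_m" "B \<in> Rep_m"
  shows "op_of (m_sum A B) i j =
    (if i < length (fst A) then op_of A i j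
     else if j < length (fst A) then 0 else op_of B (i - length (fst A)) (j - length (fst A)))"
  using assms by (auto simp: Rep_m_def m_sum_def entries_def)

lemma mul_append:
  fixes f :: "'a \<Rightarrow> nat \<Rightarrow> 'b::semiring_0"
  shows "mul {..<a + b} f g i k =
    (\<Sum>j<a. f i j * g j k) + (\<Sum>j<b. f i (a + j) * g (a + j) k)"
proof -
  have "{..<a + b} = {..<a} \<union> (+) a ` {..<b}"
  proof (intro equalityI subsetI)
    fix x assume "x \<in> {..<a + b}"
    then have "x < a \<or> x = a + (x - a) \<and> x - a < b" by auto
    then show "x \<in> {..<a} \<union> (+) a ` {..<b}" by blast
  qed auto
  moreover have "sum h ((+) a ` {..<b}) = (\<Sum>j<b. h (a + j))" for h :: "nat \<Rightarrow> 'b"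
    by (subst sum.reindex) auto
  ultimately show ?thesis
    by (simp add: mul_def) (subst sum.union_disjoint, auto)
qed

text \<open>
  Complementarity forces the cross terms \<open>r u'\<close> and \<open>r' u\<close> to vanish, so the block column \<open>(r, r')\<close>
  and the block row \<open>(u, u')\<close> are mutually inverse.
\<close>

lemma direct_sum_of_retracts:
  assumes V: "V \<in> Rep_m" and A: "A \<in> Rep_m" and B: "B \<in> Rep_m"
    and r1: "retract A V u r" and r2: "retract B V u' r'"
    and compl: "\<And>i j. mul (idx A) u r i j + mul (idx B) u' r' i j = one_on (idx V) i j"
  shows "m_iso V (m_sum A B)"
proof -
  let ?a = "length (fst A)" and ?b = "length (fst B)" and ?S = "m_sum A B"
  have len: "length (fst ?S) = ?a + ?b" by (simp add: m_sum_def)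
  have parS: "par ?S i = (if i < ?a then par A i else par B (i - ?a))" for i
    by (simp add: m_sum_def nth_append)
  have inA: "op_of A s t = 0" if "\<not> (s < ?a \<and> t < ?a)" for s t
    using Rep_mD(2)[OF A, of s t] that by auto
  note h = r1[unfolded retract_def maps_def] r2[unfolded retract_def maps_def]
  have u: "u \<in> even_maps (idx V) (par V) (idx A) (par A)" "u' \<in> even_maps (idx V) (par V) (idx B) (par B)"
    and r: "r \<in> even_maps (idx A) (par A) (idx V) (par V)" "r' \<in> even_maps (idx B) (par B) (idx V) (par V)"
    using h by auto
  have cross: "mul (idx V) r u' = (\<lambda>i j. 0)" "mul (idx V) r' u = (\<lambda>i j. 0)"
  proof -
    have c: "mul (idx B) u' r' = (\<lambda>i j. one_on (idx V) i j - mul (idx A) u r i j)"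
      and c': "mul (idx A) u r = (\<lambda>i j. one_on (idx V) i j - mul (idx B) u' r' i j)"
      using compl by (auto simp: fun_eq_iff eq_diff_eq add.commute)
    have "mul (idx V) r (mul (idx B) u' r') = (\<lambda>i j. 0)"
      unfolding c mul_diff_right using r h
      by (simp add: even_maps_mul_one flip: mul_assoc)
    then have "mul (idx V) (mul (idx V) r (mul (idx B) u' r')) u' = (\<lambda>i j. 0)" by simp
    then show "mul (idx V) r u' = (\<lambda>i j. 0)"
      using h u by (simp add: mul_assoc even_maps_mul_one)
    have "mul (idx V) r' (mul (idx A) u r) = (\<lambda>i j. 0)"
      unfolding c' mul_diff_right using r h
      by (simp add: even_maps_mul_one flip: mul_assoc)
    then have "mul (idx V) (mul (idx V) r' (mul (idx A) u r)) u = (\<lambda>i j. 0)" by simp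
    then show "mul (idx V) r' u = (\<lambda>i j. 0)"
      using h u by (simp add: mul_assoc even_maps_mul_one)
  qed
  define f where "f = (\<lambda>i j. if i < ?a then r i j else r' (i - ?a) j)"
  define g where "g = (\<lambda>i j. if j < ?a then u i j else u' i (j - ?a))"
  have f_ev: "f \<in> even_maps (idx ?S) (par ?S) (idx V) (par V)"
    unfolding even_maps_def
  proof (intro CollectI allI impI)
    fix i j assume "f i j \<noteq> 0"
    then show "i \<in> idx ?S \<and> j \<in> idx V \<and> par ?S i = par V j"
      using even_mapsD[OF r(1), of i j] even_mapsD[OF r(2), of "i - ?a" j]
      by (auto simp: f_def len parS split: if_splits)
  qed
  have g_ev: "g \<in> even_maps (idx V) (par V) (idx ?S) (par ?S)"
    unfolding even_maps_def
  proof (intro CollectI allI impI)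
    fix i j assume "g i j \<noteq> 0"
    then show "i \<in> idx V \<and> j \<in> idx ?S \<and> par V i = par ?S j"
      using even_mapsD[OF u(1), of i j] even_mapsD[OF u(2), of i "j - ?a"]
      by (auto simp: g_def len parS split: if_splits)
  qed
  have "mul (idx V) f (op_of V) i j = mul (idx ?S) (op_of ?S) f i j" for i j
  proof (cases "i < ?a")
    case True
    have "mul (idx V) f (op_of V) i j = mul (idx V) r (op_of V) i j"
      using True by (simp add: f_def mul_def)
    also have "\<dots> = mul (idx A) (op_of A) r i j" using h by simp
    finally show ?thesis
      unfolding len mul_append using True
      by (simp add: op_of_m_sum[OF A B] f_def mul_def inA)
  next
    case False
    have "mul (idx V) f (op_of V) i j = mul (idx V) r' (op_of V) (i - ?a) j"
      using False by (simp add: f_def mul_def)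
    also have "\<dots> = mul (idx B) (op_of B) r' (i - ?a) j" using h by simp
    finally show ?thesis
      unfolding len mul_append using False
      by (simp add: op_of_m_sum[OF A B] f_def mul_def inA)
  qed
  then have f: "f \<in> homs V ?S" using f_ev by (simp add: maps_def fun_eq_iff)
  have "mul (idx ?S) g (op_of ?S) i j = mul (idx V) (op_of V) g i j" for i j
  proof (cases "j < ?a")
    case True
    have "mul (idx V) (op_of V) g i j = mul (idx V) (op_of V) u i j"
      using True by (simp add: g_def mul_def)
    also have "\<dots> = mul (idx A) u (op_of A) i j" using h by simp
    finally show ?thesis
      unfolding len mul_append using True
      by (simp add: op_of_m_sum[OF A B] g_def mul_def inA)
  next
    case False
    have "mul (idx V) (op_of V) g i j = mul (idx V) (op_of V) u' i (j - ?a)"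
      using False by (simp add: g_def mul_def)
    also have "\<dots> = mul (idx B) u' (op_of B) i (j - ?a)" using h by simp
    finally show ?thesis
      unfolding len mul_append using False
      by (simp add: op_of_m_sum[OF A B] g_def mul_def inA)
  qed
  then have g: "g \<in> homs ?S V" using g_ev by (simp add: maps_def fun_eq_iff)
  have gf: "mul (idx ?S) g f = one_on (idx V)"
  proof (intro ext)
    fix i j
    show "mul (idx ?S) g f i j = one_on (idx V) i j"
      unfolding compl[symmetric] len mul_append by (simp add: f_def g_def mul_def)
  qed
  have fg: "mul (idx V) f g = one_on (idx ?S)"
  proof (intro ext)
    fix i j
    have "mul (idx V) f g i j = (if i < ?a then (if j < ?a then mul (idx V) r u i j else mul (idx V) r u' i (j - ?a))
      else (if j < ?a then mul (idx V) r' u (i - ?a) j else mul (idx V) r' u' (i - ?a) (j - ?a)))"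
      by (simp add: f_def g_def mul_def)
    also have "\<dots> = one_on (idx ?S) i j"
      using h by (auto simp: cross one_on_def len)
    finally show "mul (idx V) f g i j = one_on (idx ?S) i j" .
  qed
  let ?f = "to_mat V ?S f" and ?g = "to_mat ?S V g"
  note S = m_sum_Rep_m[OF A B]
  note fm = to_mat_hom[OF V S f] and gm = to_mat_hom[OF S V g]
  have fc: "?f \<in> carrier_mat (length (fst ?S)) (length (fst V))"
    and gc: "?g \<in> carrier_mat (length (fst V)) (length (fst ?S))"
    by (auto simp: to_mat_def)
  have "?g * ?f = 1\<^sub>m (length (fst V))"
    by (rule entries_inject[OF mult_carrier_mat[OF gc fc]])
      (auto simp: entries_mult[OF gc fc] fm gm gf entries_one)
  moreover have "?f * ?g = 1\<^sub>m (length (fst ?S))"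
    by (rule entries_inject[OF mult_carrier_mat[OF fc gc]])
      (auto simp: entries_mult[OF fc gc] fm gm fg entries_one)
  ultimately show ?thesis
    unfolding m_iso_def using fm gm by blast
qed

lemma m_sum_retract:
  assumes V: "V \<in> Rep_m" and A: "A \<in> Rep_m" and B: "B \<in> Rep_m" and iso: "m_iso V (m_sum A B)"
  shows "\<exists>u r. retract A V u r"
proof -
  let ?a = "length (fst A)" and ?b = "length (fst B)" and ?S = "m_sum A B"
  have len: "length (fst ?S) = ?a + ?b" by (simp add: m_sum_def)
  have parS: "par ?S i = (if i < ?a then par A i else par B (i - ?a))" for i
    by (simp add: m_sum_def nth_append)
  note S = m_sum_Rep_m[OF A B]
  obtain f g where f: "f \<in> m_hom V ?S" and g: "g \<in> m_hom ?S V" and fg: "f * g = 1\<^sub>m (length (fst ?S))"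
    using iso unfolding m_iso_def by blast
  have fe: "entries f \<in> homs V ?S" and ge: "entries g \<in> homs ?S V"
    and fc: "f \<in> carrier_mat (length (fst ?S)) (length (fst V))"
    and gc: "g \<in> carrier_mat (length (fst V)) (length (fst ?S))"
    using f g V S by (auto simp: m_hom_iff)
  have fge: "mul (idx V) (entries f) (entries g) = one_on (idx ?S)"
    using entries_mult[OF fc gc] fg by (simp add: entries_one)
  define u where "u = (\<lambda>s t. if t < ?a then entries g s t else 0)"
  define r where "r = (\<lambda>s t. if s < ?a then entries f s t else 0)"
  have inA: "op_of A s t = 0" if "\<not> (s < ?a \<and> t < ?a)" for s t
    using Rep_mD(2)[OF A, of s t] that by auto
  have "mul (idx A) u (op_of A) s t = mul (idx V) (op_of V) u s t" for s t
  proof (cases "t < ?a")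
    case True
    then have "mul (idx V) (op_of V) u s t = mul (idx ?S) (entries g) (op_of ?S) s t"
      using ge by (simp add: maps_def) (simp add: u_def mul_def)
    also have "\<dots> = mul (idx A) u (op_of A) s t"
      unfolding len mul_append using True by (simp add: mul_def op_of_m_sum[OF A B] u_def)
    finally show ?thesis ..
  qed (simp add: mul_def u_def inA)
  then have u: "u \<in> homs A V"
    using ge by (auto simp: maps_def even_maps_def u_def len parS fun_eq_iff split: if_splits)
  have "mul (idx V) r (op_of V) s t = mul (idx A) (op_of A) r s t" for s t
  proof (cases "s < ?a")
    case True
    then have "mul (idx V) r (op_of V) s t = mul (idx ?S) (op_of ?S) (entries f) s t"
      using fe by (simp add: maps_def fun_eq_iff) (simp add: r_def mul_def)
    also have "\<dots> = mul (idx A) (op_of A) r s t"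
      unfolding len mul_append using True by (simp add: mul_def op_of_m_sum[OF A B] r_def inA)
    finally show ?thesis .
  qed (simp add: mul_def r_def inA)
  then have r: "r \<in> homs V A"
    using fe by (auto simp: maps_def even_maps_def r_def len parS fun_eq_iff split: if_splits)
  have "mul (idx V) r u s t = one_on (idx A) s t" for s t
    using fun_cong[OF fun_cong[OF fge, of s], of t] by (cases "s < ?a"; cases "t < ?a") (auto simp: mul_def r_def u_def one_on_def len)
  then show ?thesis
    unfolding retract_def using u r by blast
qed

text \<open>
  The image of \<open>e = u r\<close> carries the compressed operator \<open>r X u\<close>; as \<open>e\<close> commutes with \<open>X\<close>, both \<open>u\<close> and \<open>r\<close>
  are morphisms.
\<close>

lemma idempotent_retract:
  assumes V: "V \<in> Rep_m" and e: "e \<in> homs V V" "mul (idx V) e e = e"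
  shows "\<exists>N\<in>Rep_m. \<exists>u r. retract N V u r \<and> mul (idx N) u r = e"
proof -
  have ev: "e \<in> even_maps (idx V) (par V) (idx V) (par V)"
    and eX: "mul (idx V) e (op_of V) = mul (idx V) (op_of V) e"
    using e by (auto simp: maps_def)
  obtain ps u r where u: "u \<in> even_maps (idx V) (par V) {..<length ps} ((!) ps)"
    and r: "r \<in> even_maps {..<length ps} ((!) ps) (idx V) (par V)"
    and ur: "mul {..<length ps} u r = e" and ru: "mul (idx V) r u = one_on {..<length ps}"
    using even_idempotent_splits[OF finite_lessThan ev e(2)] by blast
  define Y where "Y = mul (idx V) r (mul (idx V) (op_of V) u)"
  have Y: "Y i j \<noteq> 0 \<Longrightarrow> i < length ps \<and> j < length ps \<and> ps ! i \<noteq> ps ! j" for i j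
  proof -
    assume "Y i j \<noteq> 0"
    then obtain s where s: "r i s * mul (idx V) (op_of V) u s j \<noteq> 0"
      unfolding Y_def mul_def[of _ r] by (meson sum.neutral)
    then obtain t where "op_of V s t * u t j \<noteq> 0"
      unfolding mul_def by (metis (no_types, lifting) mult_zero_right sum.neutral)
    with s have "r i s \<noteq> 0" "op_of V s t \<noteq> 0" "u t j \<noteq> 0" by auto
    then show ?thesis
      using even_mapsD[OF r, of i s] even_mapsD[OF u, of t j] Rep_mD(2)[OF V, of s t] by auto
  qed
  define N where "N = (ps, mat (length ps) (length ps) (\<lambda>(i, j). Y i j))"
  have N: "N \<in> Rep_m" using Y by (auto simp: N_def Rep_m_def)
  have opN: "op_of N = Y"
    unfolding N_def snd_conv using Y by (intro entries_mat) auto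
  have "mul (idx V) (op_of V) u = mul (idx V) (op_of V) (mul (idx V) e u)"
    unfolding ur[symmetric] mul_assoc ru using u by (simp add: even_maps_mul_one)
  also have "\<dots> = mul {..<length ps} u Y"
    unfolding Y_def by (simp only: mul_assoc[symmetric] eX[symmetric] ur)
  finally have 1: "mul (idx V) (op_of V) u = mul {..<length ps} u Y" .
  have "mul (idx V) r (op_of V) = mul (idx V) (mul (idx V) r e) (op_of V)"
    unfolding ur[symmetric] mul_assoc[symmetric] ru using r by (simp add: even_maps_mul_one)
  also have "\<dots> = mul {..<length ps} Y r"
    unfolding Y_def by (simp only: mul_assoc eX ur)
  finally have 2: "mul (idx V) r (op_of V) = mul {..<length ps} Y r" .
  have "retract N V u r"
    unfolding retract_def maps_def opN using u r ru 1 2 by (simp add: N_def)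
  moreover have "mul (idx N) u r = e" using ur by (simp add: N_def)
  ultimately show ?thesis
    using N by blast
qed

text \<open>
  The complement of a retract is the image of the idempotent \<open>1 - u r\<close>.
\<close>

lemma retract_direct_summand:
  assumes V: "V \<in> Rep_m" and N: "N \<in> Rep_m" and r: "retract N V u r"
  shows "direct_summand N V"
proof -
  let ?e = "mul (idx N) u r"
  have ee: "mul (idx V) ?e ?e = ?e"
  proof -
    have "mul (idx V) ?e ?e = mul (idx N) u (mul (idx N) (mul (idx V) r u) r)"
      by (simp add: mul_assoc)
    then show ?thesis
      using r even_maps_mul_one(1)[of r "idx N" "par N" "idx V" "par V"] by (simp add: retract_def maps_def)
  qed
  have e: "?e \<in> homs V V" using r by (auto simp: retract_def intro: maps_mul)
  then have ev: "?e \<in> even_maps (idx V) (par V) (idx V) (par V)" by (simp add: maps_def)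
  define d where "d = (\<lambda>i j. one_on (idx V) i j - ?e i j)"
  have d: "d \<in> homs V V"
    unfolding d_def using e V by (intro maps_diff maps_one) (auto simp: Rep_mD)
  have "mul (idx V) d d = d"
    unfolding d_def mul_diff_left mul_diff_right
    by (simp add: ee even_maps_mul_one[OF ev] even_maps_mul_one[OF even_maps_one])
  from idempotent_retract[OF V d this] obtain B u' r' where
    B: "B \<in> Rep_m" "retract B V u' r'" "mul (idx B) u' r' = d" by blast
  have "m_iso V (m_sum N B)"
    by (rule direct_sum_of_retracts[OF V N B(1) r B(2)]) (simp add: B(3) d_def)
  then show ?thesis
    unfolding direct_summand_def using N B by blast
qed

lemma direct_summand_retract:
  assumes "V \<in> Rep_m" "direct_summand N V"
  shows "\<exists>u r. retract N V u r"
  using assms m_sum_retract unfolding direct_summand_def by blast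

lemma retract_trans:
  assumes "retract N A u r" "retract A V u' r'"
  shows "\<exists>u r. retract N V u r"
proof -
  have "mul (idx V) (mul (idx A) r r') (mul (idx A) u' u) = mul (idx A) r (mul (idx A) (mul (idx V) r' u') u)"
    by (simp add: mul_assoc)
  also have "\<dots> = one_on (idx N)"
    using assms maps_mul_one(1)[of u "idx N" "par N" "op_of N" "idx A" "par A" "op_of A"]
    by (simp add: retract_def)
  finally show ?thesis
    using assms maps_mul unfolding retract_def by blast
qed

lemma indecomposable_idempotent:
  assumes N: "N \<in> Rep_m" and ind: "m_indecomposable N"
    and e: "e \<in> homs N N" "mul (idx N) e e = e"
  shows "e = (\<lambda>i j. 0) \<or> e = one_on (idx N)"
proof -
  obtain A u r where A: "A \<in> Rep_m" "retract A N u r" and ur: "mul (idx A) u r = e"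
    using idempotent_retract[OF N e] by blast
  define d where "d = (\<lambda>i j. one_on (idx N) i j - e i j)"
  have d: "d \<in> homs N N"
    unfolding d_def using e N by (intro maps_diff maps_one) (auto simp: Rep_mD)
  have "mul (idx N) d d = d"
    unfolding d_def mul_diff_left mul_diff_right using e
    by (simp add: maps_mul_one[OF e(1)] even_maps_mul_one[OF even_maps_one])
  from idempotent_retract[OF N d this] obtain B u' r' where
    B: "B \<in> Rep_m" "retract B N u' r'" and ur': "mul (idx B) u' r' = d" by blast
  have "m_iso N (m_sum A B)"
    by (rule direct_sum_of_retracts[OF N A(1) B(1) A(2) B(2)]) (simp add: ur ur' d_def)
  then have "fst A = [] \<or> fst B = []"
    using ind A B unfolding m_indecomposable_def by blast
  then have "e = (\<lambda>i j. 0) \<or> d = (\<lambda>i j. 0)"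
    using ur ur' by (auto simp: mul_def)
  then show ?thesis
    by (auto simp: d_def fun_eq_iff)
qed

text \<open>
  Both summands of a proper decomposition have smaller dimension, so splitting off summands ends.
\<close>

lemma exists_indecomposable_retract:
  assumes "V \<in> Rep_m" "fst V \<noteq> []"
  shows "\<exists>N\<in>Rep_m. m_indecomposable N \<and> (\<exists>u r. retract N V u r)"
  using assms
proof (induction "length (fst V)" arbitrary: V rule: less_induct)
  case less
  show ?case
  proof (cases "m_indecomposable V")
    case True
    have "retract V V (one_on (idx V)) (one_on (idx V))"
      unfolding retract_def using less.prems
      by (simp add: maps_one Rep_mD even_maps_mul_one[OF even_maps_one])
    then show ?thesis using True less.prems by blast
  next
    case False
    then obtain A B where AB: "A \<in> Rep_m" "B \<in> Rep_m" "m_iso V (m_sum A B)" "fst A \<noteq> []" "fst B \<noteq> []"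
      using less.prems unfolding m_indecomposable_def by blast
    obtain f g where fg: "f \<in> m_hom V (m_sum A B)" "g \<in> m_hom (m_sum A B) V"
      "g * f = 1\<^sub>m (length (fst V))" "f * g = 1\<^sub>m (length (fst (m_sum A B)))"
      using AB(3) unfolding m_iso_def by blast
    obtain u r where ur: "retract A V u r"
      using m_sum_retract[OF less.prems(1) AB(1,2,3)] by blast
    let ?S = "m_sum A B"
    have fc: "f \<in> carrier_mat (length (fst ?S)) (length (fst V))"
      and gc: "g \<in> carrier_mat (length (fst V)) (length (fst ?S))"
      using fg by (auto simp: m_hom_def)
    have "mul (idx V) (entries f) (entries g) = one_on (idx ?S)"
      using entries_mult[OF fc gc] fg by (simp add: entries_one)
    then have "card (idx ?S) \<le> card (idx V)"
      by (intro card_le_if_identity_factors[of _ _ "entries f" "entries g"]) auto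
    then have "length (fst A) < length (fst V)"
      using AB(5) by (cases "fst B") (auto simp: m_sum_def)
    from less.hyps[OF this AB(1,4)] show ?thesis
      using retract_trans[OF _ ur] by blast
  qed
qed

section \<open>Matrices on tensor powers commuting with signed permutations\<close>

definition Idx :: "nat \<Rightarrow> nat \<Rightarrow> nat list set" where
  "Idx D n = {I. set I \<subseteq> {..<D} \<and> length I = n}"

definition Prs :: "nat \<Rightarrow> nat \<Rightarrow> (nat \<times> nat) list set" where
  "Prs D n = {z. set z \<subseteq> {..<D} \<times> {..<D} \<and> length z = n}"

lemma finite_Idx [simp]: "finite (Idx D n)"
  unfolding Idx_def by (rule finite_lists_length_eq) simp

lemma card_Idx: "card (Idx D n) = D ^ n"
  unfolding Idx_def by (simp add: card_lists_length_eq)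

lemma finite_Prs [simp]: "finite (Prs D n)"
  unfolding Prs_def by (rule finite_lists_length_eq) simp

lemma Prs_unzip: "z \<in> Prs D n \<Longrightarrow> map fst z \<in> Idx D n \<and> map snd z \<in> Idx D n"
  by (fastforce simp: Prs_def Idx_def)

lemma zip_Prs:
  assumes "I \<in> Idx D n" "J \<in> Idx D n"
  shows "zip I J \<in> Prs D n" "map fst (zip I J) = I" "map snd (zip I J) = J"
proof -
  have "set (zip I J) \<subseteq> {..<D} \<times> {..<D}"
    using assms by (auto simp: Idx_def elim!: in_set_zipE)
  then show "zip I J \<in> Prs D n" "map fst (zip I J) = I" "map snd (zip I J) = J"
    using assms by (auto simp: Prs_def Idx_def)
qed

text \<open>
  The entries lie in a possibly noncommutative ring, as the coaction matrix of a tensor power is to be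
  included. Exchanging neighbouring tensor factors costs a Koszul sign in the row index and another one
  in the column index.
\<close>

definition equivariant :: "(nat \<Rightarrow> bit) \<Rightarrow> nat \<Rightarrow> nat \<Rightarrow> (nat list \<Rightarrow> nat list \<Rightarrow> 'm::ring_1) \<Rightarrow> bool" where
  "equivariant p D n f \<longleftrightarrow> (\<forall>U U' i i' j j' V V'. length U = length U' \<longrightarrow>
     U @ i # i' # V \<in> Idx D n \<longrightarrow> U' @ j # j' # V' \<in> Idx D n \<longrightarrow>
     f (U @ i' # i # V) (U' @ j' # j # V') =
       koszul (p i) (p i') * (koszul (p j) (p j') * f (U @ i # i' # V) (U' @ j # j' # V')))"

abbreviation entry_at :: "('i list \<Rightarrow> 'j list \<Rightarrow> 'm) \<Rightarrow> ('i \<times> 'j) list \<Rightarrow> 'm" where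
  "entry_at f z \<equiv> f (map fst z) (map snd z)"

lemma koszul_simps [simp]: "koszul a b * koszul a b = 1" "koszul a b * (koszul a b * t) = t"
  by (auto simp: koszul_def)

lemma koszul_sym: "koszul a b = koszul b a"
  by (auto simp: koszul_def)

lemma koszul_central: "koszul a b * t = t * koszul a b"
  by (auto simp: koszul_def)

lemma equivariant_at:
  assumes "equivariant p D n f" "u @ a # b # v \<in> Prs D n"
  shows "entry_at f (u @ b # a # v) =
    koszul (p (fst a)) (p (fst b)) * (koszul (p (snd a)) (p (snd b)) * entry_at f (u @ a # b # v))"
  using assms Prs_unzip[OF assms(2)]
  unfolding equivariant_def by auto

lemma equivariantI:
  assumes "\<And>u a b v. u @ a # b # v \<in> Prs D n \<Longrightarrow> entry_at f (u @ b # a # v) =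
    koszul (p (fst a)) (p (fst b)) * (koszul (p (snd a)) (p (snd b)) * entry_at f (u @ a # b # v))"
  shows "equivariant p D n f"
  unfolding equivariant_def
proof (intro allI impI)
  fix U U' i i' j j' V V'
  assume l: "length U = length U'" and U: "U @ i # i' # V \<in> Idx D n" and U': "U' @ j # j' # V' \<in> Idx D n"
  then have lV: "length V = length V'" by (simp add: Idx_def)
  have "zip (U @ i # i' # V) (U' @ j # j' # V') \<in> Prs D n"
    by (rule zip_Prs[OF U U'])
  then have "zip U U' @ (i, j) # (i', j') # zip V V' \<in> Prs D n"
    using l by simp
  from assms[OF this]
  show "f (U @ i' # i # V) (U' @ j' # j # V') =
      koszul (p i) (p i') * (koszul (p j) (p j') * f (U @ i # i' # V) (U' @ j # j' # V'))"
    using l lV by simp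
qed

text \<open>
  Neighbour exchanges generate all rearrangements of a list.
\<close>

lemma mset_eq_by_swaps:
  assumes "P z" "mset z' = mset z"
    and "\<And>u a b v. mset (u @ a # b # v) = mset z \<Longrightarrow> P (u @ a # b # v) \<Longrightarrow> P (u @ b # a # v)"
  shows "P z'"
  using assms
proof (induction z arbitrary: P z')
  case Nil
  then show ?case by simp
next
  case (Cons x z)
  then have "x \<in> set z'" by (metis list.set_intros(1) set_mset_mset)
  then obtain u v where z': "z' = u @ x # v" by (meson split_list)
  then have uv: "mset (u @ v) = mset z" using Cons.prems by simp
  have 1: "P (x # u @ v)"
  proof (rule Cons.IH[where P = "\<lambda>w. P (x # w)", OF Cons.prems(1) uv])
    fix u a b v
    assume "mset (u @ a # b # v) = mset z" "P (x # u @ a # b # v)"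
    then show "P (x # u @ b # a # v)"
      using Cons.prems(3)[of "x # u" a b v] by simp
  qed
  have "P (u @ x # v)" if "mset (u @ x # v) = mset (x # z)" "P (x # u @ v)"
    using that
  proof (induction u arbitrary: v rule: rev_induct)
    case (snoc y u)
    then have "P (u @ x # y # v)" by simp
    then show ?case
      using Cons.prems(3)[of u x y v] snoc.prems by simp
  qed simp
  then show ?case using 1 z' uv by simp
qed

lemma mset_Prs: "z \<in> Prs D n \<Longrightarrow> mset z' = mset z \<Longrightarrow> z' \<in> Prs D n"
  unfolding Prs_def by (metis (no_types, lifting) mem_Collect_eq mset_eq_setD mset_eq_length)

text \<open>
  A pair of index lists is determined up to permutation by the multiset of its zipped pairs, and
  permutations change an entry of an equivariant matrix only by a sign.
\<close>

lemma equivariant_same_orbit: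
  fixes f :: "nat list \<Rightarrow> nat list \<Rightarrow> 'm::ring_1"
  assumes f: "equivariant p D n f" and z: "z \<in> Prs D n" "mset z' = mset z"
  shows "entry_at f z' = entry_at f z \<or> entry_at f z' = - entry_at f z"
proof (rule mset_eq_by_swaps[where P = "\<lambda>z'. entry_at f z' = entry_at f z \<or> entry_at f z' = - entry_at f z", OF _ z(2)])
  fix u a b v
  assume "mset (u @ a # b # v) = mset z" and P: "entry_at f (u @ a # b # v) = entry_at f z \<or> entry_at f (u @ a # b # v) = - entry_at f z"
  then have "u @ a # b # v \<in> Prs D n" using mset_Prs[OF z(1)] by simp
  from equivariant_at[OF f this] P
  show "entry_at f (u @ b # a # v) = entry_at f z \<or> entry_at f (u @ b # a # v) = - entry_at f z"
    by (elim disjE) (auto simp: koszul_def)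
qed simp

lemma sum_Idx_swap:
  assumes "m + 2 \<le> n"
  shows "(\<Sum>J\<in>Idx D n. g J) = (\<Sum>J\<in>Idx D n. g (take m J @ J ! Suc m # J ! m # drop (m + 2) J))"
proof -
  define sw where "sw = (\<lambda>J :: nat list. take m J @ J ! Suc m # J ! m # drop (m + 2) J)"
  have dec: "\<exists>U j j' V. J = U @ j # j' # V \<and> length U = m" if "J \<in> Idx D n" for J
  proof -
    have "m < length J" "Suc m < length J" using that assms by (auto simp: Idx_def)
    then have "J = take m J @ J ! m # J ! Suc m # drop (Suc (Suc m)) J"
      by (metis append_take_drop_id Cons_nth_drop_Suc)
    then show ?thesis using \<open>m < length J\<close> by (metis length_take min.absorb4)
  qed
  have sw: "sw (U @ j # j' # V) = U @ j' # j # V" if "length U = m" for U j j' V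
    using that by (simp add: sw_def nth_append)
  have "sw J \<in> Idx D n" "sw (sw J) = J" if J: "J \<in> Idx D n" for J
  proof -
    obtain U j j' V where "J = U @ j # j' # V" "length U = m" using dec[OF J] by blast
    then show "sw J \<in> Idx D n" "sw (sw J) = J" using J by (auto simp: sw Idx_def)
  qed
  then have "(\<Sum>J\<in>Idx D n. g J) = (\<Sum>J\<in>Idx D n. g (sw J))"
    by (intro sum.reindex_bij_witness[of _ sw sw]) auto
  then show ?thesis by (simp add: sw_def)
qed

lemma equivariant_mul:
  fixes f g :: "nat list \<Rightarrow> nat list \<Rightarrow> 'm::ring_1"
  assumes f: "equivariant p D n f" and g: "equivariant p D n g"
  shows "equivariant p D n (mul (Idx D n) f g)"
  unfolding equivariant_def
proof (intro allI impI)
  fix U U' :: "nat list" and i i' j j' V V'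
  assume l: "length U = length U'" and U: "U @ i # i' # V \<in> Idx D n" and U': "U' @ j # j' # V' \<in> Idx D n"
  let ?m = "length U"
  have n: "?m + 2 \<le> n" using U by (auto simp: Idx_def)
  have "mul (Idx D n) f g (U @ i' # i # V) (U' @ j' # j # V') =
      (\<Sum>J\<in>Idx D n. f (U @ i' # i # V) (take ?m J @ J ! Suc ?m # J ! ?m # drop (?m + 2) J) *
        g (take ?m J @ J ! Suc ?m # J ! ?m # drop (?m + 2) J) (U' @ j' # j # V'))"
    unfolding mul_def by (rule sum_Idx_swap[OF n])
  also have "\<dots> = (\<Sum>J\<in>Idx D n. koszul (p i) (p i') * (koszul (p j) (p j') *
      (f (U @ i # i' # V) J * g J (U' @ j # j' # V'))))"
  proof (intro sum.cong refl)
    fix J assume J: "J \<in> Idx D n"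
    have len: "?m < length J" "Suc ?m < length J" using J n by (auto simp: Idx_def)
    define W k k' W' where "W = take ?m J" and "k = J ! ?m" and "k' = J ! Suc ?m" and "W' = drop (Suc (Suc ?m)) J"
    have Jeq: "J = W @ k # k' # W'" using len unfolding W_def k_def k'_def W'_def
      by (metis append_take_drop_id Cons_nth_drop_Suc)
    have lW: "length W = ?m" using len by (simp add: W_def)
    have "f (U @ i' # i # V) (W @ k' # k # W') * g (W @ k' # k # W') (U' @ j' # j # V') =
        koszul (p i) (p i') * (koszul (p k) (p k') * f (U @ i # i' # V) J) *
        (koszul (p k) (p k') * (koszul (p j) (p j') * g J (U' @ j # j' # V')))"
      using f[unfolded equivariant_def] g[unfolded equivariant_def] lW l U U' J unfolding Jeq by simp
    also have "\<dots> = koszul (p i) (p i') * (koszul (p j) (p j') *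
        (f (U @ i # i' # V) J * g J (U' @ j # j' # V')))"
      by (simp add: koszul_def)
    finally show "f (U @ i' # i # V) (take ?m J @ J ! Suc ?m # J ! ?m # drop (?m + 2) J) *
        g (take ?m J @ J ! Suc ?m # J ! ?m # drop (?m + 2) J) (U' @ j' # j # V') =
        koszul (p i) (p i') * (koszul (p j) (p j') * (f (U @ i # i' # V) J * g J (U' @ j # j' # V')))"
      by (simp add: W_def k_def k'_def W'_def)
  qed
  also have "\<dots> = koszul (p i) (p i') * (koszul (p j) (p j') *
      mul (Idx D n) f g (U @ i # i' # V) (U' @ j # j' # V'))"
    by (simp add: mul_def sum_distrib_left)
  finally show "mul (Idx D n) f g (U @ i' # i # V) (U' @ j' # j # V') =
      koszul (p i) (p i') * (koszul (p j) (p j') * mul (Idx D n) f g (U @ i # i' # V) (U' @ j # j' # V'))" .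
qed

lemma equivariant_transpose: "equivariant p D n f \<Longrightarrow> equivariant p D n (\<lambda>I J. f J I)"
  unfolding equivariant_def
  by (clarsimp, metis (no_types, lifting) koszul_central mult.assoc)

text \<open>
  This covers the identity and the grading operator.
\<close>

lemma equivariant_graded_one:
  "equivariant p D n (\<lambda>I J. c (mset I) * one_on (Idx D n) I J)"
  unfolding equivariant_def one_on_def
  by (auto simp: koszul_def Idx_def add_mset_commute)

text \<open>
  The elementary equivariant matrix supported on one orbit, normalised to entries \<open>\<plusminus>1\<close>. It
  exists unless some permutation fixes an index pair of the orbit with sign \<open>-1\<close>, in which case every
  equivariant matrix vanishes on the orbit.
\<close>

definition is_orbit_sign ::
  "(nat \<Rightarrow> bit) \<Rightarrow> nat \<Rightarrow> nat \<Rightarrow> (nat \<times> nat) multiset \<Rightarrow> (nat list \<Rightarrow> nat list \<Rightarrow> int) \<Rightarrow> bool" where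
  "is_orbit_sign p D n \<omega> b \<longleftrightarrow> equivariant p D n b \<and>
     (\<forall>z\<in>Prs D n. if mset z = \<omega> then entry_at b z \<in> {1, - 1} else entry_at b z = 0)"

definition orbit_sign ::
  "(nat \<Rightarrow> bit) \<Rightarrow> nat \<Rightarrow> nat \<Rightarrow> (nat \<times> nat) multiset \<Rightarrow> nat list \<Rightarrow> nat list \<Rightarrow> int" where
  "orbit_sign p D n \<omega> =
     (if \<exists>b. is_orbit_sign p D n \<omega> b then SOME b. is_orbit_sign p D n \<omega> b else (\<lambda>_ _. 0))"

lemma is_orbit_sign_some:
  assumes "is_orbit_sign p D n \<omega> b"
  shows "is_orbit_sign p D n \<omega> (orbit_sign p D n \<omega>)"
proof -
  have ex: "\<exists>b. is_orbit_sign p D n \<omega> b" using assms by blast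
  show ?thesis
    unfolding orbit_sign_def if_P[OF ex] using ex by (rule someI_ex)
qed

lemma equivariant_of_int:
  "equivariant p D n b \<Longrightarrow> equivariant p D n (\<lambda>I J. of_int (b I J) :: 'm::ring_1)"
  unfolding equivariant_def by (simp add: koszul_def)

lemma orbit_sign_equivariant: "equivariant p D n (orbit_sign p D n \<omega>)"
proof (cases "\<exists>b. is_orbit_sign p D n \<omega> b")
  case True
  then show ?thesis using is_orbit_sign_some is_orbit_sign_def by metis
next
  case False
  then show ?thesis by (simp add: orbit_sign_def equivariant_def)
qed

lemma orbit_sign_values: "z \<in> Prs D n \<Longrightarrow> entry_at (orbit_sign p D n \<omega>) z \<in> {0, 1, - 1}"
  and orbit_sign_other: "z \<in> Prs D n \<Longrightarrow> mset z \<noteq> \<omega> \<Longrightarrow> entry_at (orbit_sign p D n \<omega>) z = 0"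
proof -
  assume z: "z \<in> Prs D n"
  have "entry_at (orbit_sign p D n \<omega>) z \<in> {0, 1, - 1} \<and> (mset z \<noteq> \<omega> \<longrightarrow> entry_at (orbit_sign p D n \<omega>) z = 0)"
  proof (cases "\<exists>b. is_orbit_sign p D n \<omega> b")
    case True
    then have "is_orbit_sign p D n \<omega> (orbit_sign p D n \<omega>)" using is_orbit_sign_some by blast
    then show ?thesis using z unfolding is_orbit_sign_def by (metis insertCI)
  next
    case False
    then show ?thesis by (simp add: orbit_sign_def)
  qed
  then show "entry_at (orbit_sign p D n \<omega>) z \<in> {0, 1, - 1}"
    and "mset z \<noteq> \<omega> \<Longrightarrow> entry_at (orbit_sign p D n \<omega>) z = 0" by blast+
qed

text \<open>
  An equivariant matrix that does not vanish on an orbit takes only two values \<open>\<plusminus>\<beta>\<close> on it; which of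
  the two is the orbit sign.
\<close>

lemma orbit_sign_exists:
  fixes f :: "nat list \<Rightarrow> nat list \<Rightarrow> 'm::ring_1"
  assumes f: "equivariant p D n f" and no2: "\<And>x :: 'm. x = - x \<Longrightarrow> x = 0"
    and z: "z \<in> Prs D n" "entry_at f z \<noteq> 0"
  shows "is_orbit_sign p D n (mset z) (orbit_sign p D n (mset z))"
proof -
  let ?\<beta> = "entry_at f z"
  have \<beta>: "?\<beta> \<noteq> - ?\<beta>" "- ?\<beta> \<noteq> ?\<beta>" using no2 z by metis+
  define b where "b = (\<lambda>I J. if mset (zip I J) = mset z then if f I J = ?\<beta> then 1 else - 1 else (0::int))"
  have at_b: "entry_at b w = (if mset w = mset z then if entry_at f w = ?\<beta> then 1 else - 1 else 0)" for w
    by (simp add: b_def zip_map_fst_snd)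
  have "equivariant p D n b"
  proof (rule equivariantI)
    fix u c d v assume w: "u @ c # d # v \<in> Prs D n"
    show "entry_at b (u @ d # c # v) =
      koszul (p (fst c)) (p (fst d)) * (koszul (p (snd c)) (p (snd d)) * entry_at b (u @ c # d # v))"
    proof (cases "mset (u @ c # d # v) = mset z")
      case True
      have "entry_at f (u @ c # d # v) = ?\<beta> \<or> entry_at f (u @ c # d # v) = - ?\<beta>"
        by (rule equivariant_same_orbit[OF f z(1) True])
      moreover have "mset (u @ d # c # v) = mset z" using True by (simp add: add_mset_commute)
      ultimately show ?thesis
        using equivariant_at[OF f w] True \<beta> unfolding at_b by (elim disjE) (auto simp: koszul_def)
    next
      case False
      then have "mset (u @ d # c # v) \<noteq> mset z" by (simp add: add_mset_commute)
      then show ?thesis using False unfolding at_b by simp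
    qed
  qed
  then have "is_orbit_sign p D n (mset z) b"
    unfolding is_orbit_sign_def by (simp add: at_b)
  then show ?thesis by (rule is_orbit_sign_some)
qed

abbreviation orbits :: "nat \<Rightarrow> nat \<Rightarrow> (nat \<times> nat) multiset set" where
  "orbits D n \<equiv> mset ` Prs D n"

text \<open>
  On each orbit an equivariant matrix is determined by one entry, up to the orbit sign. Hence the
  space of equivariant matrices has at most as many dimensions as there are orbits.
\<close>

lemma orbit_sign_span:
  fixes f :: "nat list \<Rightarrow> nat list \<Rightarrow> 'm::ring_1"
  assumes f: "equivariant p D n f" and no2: "\<And>x :: 'm. x = - x \<Longrightarrow> x = 0"
  shows "\<exists>c. \<forall>I\<in>Idx D n. \<forall>J\<in>Idx D n. f I J = (\<Sum>\<omega>\<in>orbits D n. of_int (orbit_sign p D n \<omega> I J) * c \<omega>)"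
proof -
  define rep :: "(nat \<times> nat) multiset \<Rightarrow> (nat \<times> nat) list" where "rep = (\<lambda>\<omega>. SOME z. mset z = \<omega>)"
  have rep: "mset (rep \<omega>) = \<omega>" for \<omega>
    unfolding rep_def by (rule someI_ex) (rule ex_mset)
  define c where "c = (\<lambda>\<omega>. of_int (entry_at (orbit_sign p D n \<omega>) (rep \<omega>)) * entry_at f (rep \<omega>))"
  have "f I J = (\<Sum>\<omega>\<in>orbits D n. of_int (orbit_sign p D n \<omega> I J) * c \<omega>)" if IJ: "I \<in> Idx D n" "J \<in> Idx D n" for I J
  proof -
    define z where "z = zip I J"
    have z: "z \<in> Prs D n" "map fst z = I" "map snd z = J" using zip_Prs[OF IJ] by (auto simp: z_def)
    let ?b = "orbit_sign p D n (mset z)"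
    let ?r = "rep (mset z)"
    have r: "?r \<in> Prs D n" using mset_Prs[OF z(1)] rep by blast
    have "(\<Sum>\<omega>\<in>orbits D n. of_int (orbit_sign p D n \<omega> I J) * c \<omega>) =
        (\<Sum>\<omega>\<in>orbits D n. if \<omega> = mset z then of_int (entry_at ?b z) * c (mset z) else 0)"
      using orbit_sign_other[OF z(1)] z by (intro sum.cong) auto
    also have "\<dots> = of_int (entry_at ?b z) * c (mset z)" using z by (simp add: sum.delta)
    also have "\<dots> = entry_at f z"
    proof (cases "entry_at f ?r = 0")
      case True
      then show ?thesis
        using equivariant_same_orbit[OF f r, of z] rep by (auto simp: c_def)
    next
      case False
      have os: "is_orbit_sign p D n (mset z) ?b"
        using orbit_sign_exists[OF f no2 r False] by (simp add: rep)
      define g where "g = (\<lambda>I J. f I J - of_int (?b I J) * c (mset z))"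
      have b2: "of_int (entry_at ?b ?r) * (of_int (entry_at ?b ?r) * x) = x" for x :: 'm
        using os r rep unfolding is_orbit_sign_def by fastforce
      have "equivariant p D n g"
        using f os unfolding is_orbit_sign_def equivariant_def g_def
        by (simp add: koszul_def algebra_simps)
      moreover have "entry_at g ?r = 0" by (simp add: g_def c_def b2)
      ultimately have "entry_at g z = 0"
        using equivariant_same_orbit[of p D n g ?r z] r rep by simp
      then show ?thesis by (simp add: g_def)
    qed
    finally show ?thesis using z by simp
  qed
  then show ?thesis by blast
qed

text \<open>
  A multiset of size \<open>n\<close> is determined by its \<open>D\<^sup>2\<close> multiplicities, each at most \<open>n\<close>.
\<close>

lemma card_orbits: "card (orbits D n) \<le> (n + 1) ^ (D * D)"
proof -
  let ?P = "{..<D} \<times> {..<D}"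
  let ?F = "\<lambda>\<omega>. restrict (count \<omega>) ?P"
  have "inj_on ?F (orbits D n)"
  proof (rule inj_onI)
    fix \<omega> \<omega>' assume "\<omega> \<in> orbits D n" "\<omega>' \<in> orbits D n" and eq: "?F \<omega> = ?F \<omega>'"
    then have sub: "set_mset \<omega> \<subseteq> ?P" "set_mset \<omega>' \<subseteq> ?P" by (auto simp: Prs_def)
    show "\<omega> = \<omega>'"
    proof (rule multiset_eqI)
      fix x show "count \<omega> x = count \<omega>' x"
      proof (cases "x \<in> ?P")
        case True
        then show ?thesis using fun_cong[OF eq, of x] by simp
      next
        case False
        then show ?thesis using sub by (metis count_eq_zero_iff in_mono)
      qed
    qed
  qed
  moreover have "?F ` orbits D n \<subseteq> (\<Pi>\<^sub>E x\<in>?P. {..n})"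
  proof
    fix g assume "g \<in> ?F ` orbits D n"
    then obtain z where z: "z \<in> Prs D n" "g = ?F (mset z)" by blast
    have "count (mset z) x \<le> n" for x
      using z count_le_size[of "mset z" x] by (simp only: Prs_def size_mset mem_Collect_eq)
    then show "g \<in> (\<Pi>\<^sub>E x\<in>?P. {..n})" using z by auto
  qed
  ultimately have "card (orbits D n) \<le> card (\<Pi>\<^sub>E x\<in>?P. {..n})"
    by (rule card_inj_on_le) (auto intro: finite_PiE)
  also have "\<dots> = (n + 1) ^ (D * D)"
    by (subst card_PiE) (auto simp: card_cartesian_product)
  finally show ?thesis .
qed

text \<open>
  For \<open>n = (k + 1) s\<close> the Bernoulli inequality makes \<open>(1 + 1/E)\<^sup>n\<close> grow like \<open>s\<^bsup>k + 1\<^esup>\<close>.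
\<close>

lemma exponential_beats_polynomial:
  fixes E k :: nat
  shows "\<exists>n. (n + 1) ^ k * E ^ n < (E + 1) ^ n"
proof (cases "E = 0")
  case True
  then show ?thesis by (intro exI[of _ 1]) simp
next
  case False
  then have E: "real E > 0" by simp
  define h where "h = 1 / real E"
  have h: "h > 0" using E by (simp add: h_def)
  obtain s :: nat where s: "real s > real (k + 2) ^ k / h ^ (k + 1)"
    using reals_Archimedean2 by blast
  have s0: "real s > 0"
    using s h by (smt (verit) divide_nonneg_pos of_nat_0_le_iff zero_le_power zero_less_power)
  let ?n = "(k + 1) * s"
  have "real (?n + 1) ^ k \<le> (real (k + 2) * real s) ^ k"
    using s0 by (intro power_mono) (auto simp: algebra_simps)
  also have "\<dots> < (s * h) ^ (k + 1)"
  proof -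
    have "real (k + 2) ^ k < real s * h ^ (k + 1)"
      using s h by (simp add: divide_less_eq)
    then have "real (k + 2) ^ k * real s ^ k < real s * h ^ (k + 1) * real s ^ k"
      using s0 by (intro mult_strict_right_mono) auto
    then show ?thesis by (simp add: power_mult_distrib mult_ac)
  qed
  also have "\<dots> \<le> ((1 + h) ^ s) ^ (k + 1)"
    using Bernoulli_inequality[of h s] h s0 by (intro power_mono) auto
  also have "\<dots> = (1 + h) ^ ?n"
    by (metis power_mult mult.commute)
  finally have "real (?n + 1) ^ k * real E ^ ?n < (1 + h) ^ ?n * real E ^ ?n"
    using E by (intro mult_strict_right_mono) auto
  also have "\<dots> = (real E + 1) ^ ?n"
    using E by (simp add: h_def field_simps flip: power_mult_distrib)
  finally have "real ((?n + 1) ^ k * E ^ ?n) < real ((E + 1) ^ ?n)" by (simp add: add.commute)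
  then show ?thesis by (metis of_nat_less_iff)
qed

text \<open>
  Gram-Schmidt: the orthogonal projection onto the complement of the column space of \<open>X\<close>. It exists
  over the rational numbers, where sums of squares do not vanish.
\<close>

lemma orthogonal_projection:
  fixes X :: "'i \<Rightarrow> 't \<Rightarrow> rat"
  assumes S: "finite S" and T: "finite T"
  shows "\<exists>e Y. e \<in> square_maps S \<and> (\<forall>i j. e i j = e j i) \<and> mul S e e = e \<and>
    (\<forall>i. \<forall>t\<in>T. mul S e X i t = 0) \<and>
    (\<forall>i\<in>S. \<forall>j\<in>S. one_on S i j - e i j = mul T X Y i j)"
  using T
proof (induction T rule: finite_induct)
  case empty
  have "one_on S \<in> square_maps S \<and> (\<forall>i j. (one_on S i j :: rat) = one_on S j i) \<and>
      mul S (one_on S) (one_on S) = (one_on S :: _ \<Rightarrow> _ \<Rightarrow> rat)"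
    using even_maps_mul_one(1)[OF even_maps_one S] by (intro conjI even_maps_one) (auto simp: one_on_def)
  then show ?case by (intro exI[of _ "one_on S"]) (auto simp: mul_def)
next
  case (insert t T)
  then obtain e Y where e: "e \<in> square_maps S" and sym: "\<And>i j. e i j = e j i" and ee: "mul S e e = e"
    and eX: "\<And>i t. t \<in> T \<Longrightarrow> mul S e X i t = 0"
    and eY: "\<And>i j. i \<in> S \<Longrightarrow> j \<in> S \<Longrightarrow> one_on S i j - e i j = mul T X Y i j"
    by blast
  (* the component of the new column t orthogonal to the earlier ones *)
  define w where "w = (\<lambda>i. mul S e X i t)"
  define c where "c = (\<Sum>i\<in>S. w i * w i)"
  have w0: "w i = 0" if "i \<notin> S" for i
    using e that unfolding w_def mul_def by (auto intro!: sum.neutral dest: even_mapsD)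
  have ew: "(\<Sum>j\<in>S. e i j * w j) = w i" for i
    using fun_cong[OF fun_cong[OF mul_assoc[of S S e e X], of i], of t] by (simp add: ee) (simp add: w_def mul_def)
  have wX: "(\<Sum>j\<in>S. w j * X j t') = (\<Sum>l\<in>S. X l t * mul S e X l t')" for t'
  proof -
    have "(\<Sum>j\<in>S. w j * X j t') = (\<Sum>j\<in>S. \<Sum>l\<in>S. e j l * X l t * X j t')"
      by (simp add: w_def mul_def sum_distrib_right)
    also have "\<dots> = (\<Sum>l\<in>S. \<Sum>j\<in>S. X l t * (e l j * X j t'))"
      by (subst sum.swap) (simp add: sym mult_ac)
    finally show ?thesis by (simp add: mul_def sum_distrib_left)
  qed
  have cw: "c = (\<Sum>j\<in>S. X j t * w j)"
  proof -
    have "c = (\<Sum>i\<in>S. \<Sum>j\<in>S. w i * (e i j * X j t))"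
      by (simp add: c_def w_def[of] mul_def sum_distrib_left)
    also have "\<dots> = (\<Sum>j\<in>S. \<Sum>i\<in>S. X j t * (e j i * w i))"
      by (subst sum.swap) (simp add: sym mult_ac)
    also have "\<dots> = (\<Sum>j\<in>S. X j t * w j)"
      by (simp add: ew flip: sum_distrib_left)
    finally show ?thesis .
  qed
  show ?case
  proof (cases "c = 0")
    case True
    then have "w i = 0" for i
      using w0 S by (cases "i \<in> S") (auto simp: c_def sum_nonneg_eq_0_iff)
    then have "mul S e X i t' = 0" if "t' \<in> insert t T" for i t'
      using eX that by (auto simp: w_def)
    moreover have "one_on S i j - e i j = mul (insert t T) X (\<lambda>s j. if s = t then 0 else Y s j) i j"
      if "i \<in> S" "j \<in> S" for i j
    proof -
      have "mul (insert t T) X (\<lambda>s j. if s = t then 0 else Y s j) i j = mul T X Y i j"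
        using insert.hyps by (auto simp: mul_def intro!: sum.cong)
      then show ?thesis using eY that by simp
    qed
    ultimately show ?thesis using e sym ee by blast
  next
    case False
    define e' where "e' = (\<lambda>i j. e i j - w i * w j / c)"
    define Y' where "Y' = (\<lambda>s j. if s = t then w j / c else Y s j - (\<Sum>l\<in>S. Y s l * X l t) * w j / c)"
    have "e' \<in> square_maps S"
      using e w0 unfolding even_maps_def e'_def by fastforce
    moreover have "e' i j = e' j i" for i j using sym by (simp add: e'_def mult.commute)
    moreover have "mul S e' e' = e'"
    proof (intro ext)
      fix i k
      have we: "(\<Sum>j\<in>S. w j * e j k) = w k"
        using ew[of k] by (simp add: sym mult.commute)
      have "mul S e' e' i k = (\<Sum>j\<in>S. e i j * e j k - (e i j * w j) * (w k / c) - (w i / c) * (w j * e j k)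
          + (w i * w k / (c * c)) * (w j * w j))"
        unfolding mul_def e'_def by (intro sum.cong) (auto simp: field_simps False)
      also have "\<dots> = (\<Sum>j\<in>S. e i j * e j k) - (\<Sum>j\<in>S. e i j * w j) * (w k / c)
          - (w i / c) * (\<Sum>j\<in>S. w j * e j k) + (w i * w k / (c * c)) * c"
        unfolding c_def by (simp only: sum.distrib sum_subtractf sum_distrib_left sum_distrib_right)
      also have "\<dots> = e' i k"
        unfolding ew we using fun_cong[OF fun_cong[OF ee, of i], of k] False
        by (simp add: e'_def mul_def)
      finally show "mul S e' e' i k = e' i k" .
    qed
    moreover have "mul S e' X i t' = 0" if t': "t' \<in> insert t T" for i t'
    proof -
      have "mul S e' X i t' = (\<Sum>j\<in>S. e i j * X j t' - (w i / c) * (w j * X j t'))"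
        unfolding mul_def e'_def by (intro sum.cong) (auto simp: left_diff_distrib)
      also have "\<dots> = mul S e X i t' - (w i / c) * (\<Sum>j\<in>S. w j * X j t')"
        by (simp only: sum_subtractf mul_def flip: sum_distrib_left)
      also have "\<dots> = 0"
      proof (cases "t' = t")
        case True
        have "(\<Sum>j\<in>S. w j * X j t) = c" using cw by (simp add: mult.commute)
        moreover have "mul S e X i t = w i" by (simp add: w_def)
        ultimately show ?thesis using False True by simp
      next
        case False
        then show ?thesis using t' eX by (simp add: wX)
      qed
      finally show ?thesis .
    qed
    moreover have "one_on S i j - e' i j = mul (insert t T) X Y' i j" if ij: "i \<in> S" "j \<in> S" for i j
    proof -
      have XY: "mul S (mul T X Y) X i t = X i t - w i"
      proof -
        have "mul S (mul T X Y) X i t = (\<Sum>l\<in>S. (one_on S i l - e i l) * X l t)"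
          unfolding mul_def[of S] using eY ij by (intro sum.cong) auto
        also have "\<dots> = mul S (one_on S) X i t - w i"
          by (simp add: w_def mul_def left_diff_distrib sum_subtractf)
        finally show ?thesis using ij by (simp add: mul_one_apply[OF S])
      qed
      have "mul (insert t T) X Y' i j = X i t * w j / c + mul T X Y' i j"
        using insert.hyps by (simp add: mul_def Y'_def)
      also have "mul T X Y' i j = (\<Sum>s\<in>T. X i s * Y s j - X i s * mul S Y X s t * (w j / c))"
        unfolding mul_def[of T] using insert.hyps
        by (intro sum.cong) (auto simp: Y'_def mul_def right_diff_distrib)
      also have "\<dots> = mul T X Y i j - mul T X (mul S Y X) i t * (w j / c)"
        by (simp only: sum_subtractf mul_def[of T] flip: sum_distrib_right)
      also have "mul T X (mul S Y X) i t = X i t - w i"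
        using XY by (simp add: mul_assoc)
      also have "X i t * w j / c + (mul T X Y i j - (X i t - w i) * (w j / c)) = mul T X Y i j + w i * w j / c"
        using False by (simp add: field_simps)
      finally show ?thesis using eY[OF ij] by (simp add: e'_def)
    qed
    ultimately show ?thesis by blast
  qed
qed


text \<open>
  For large \<open>n\<close> the orbit signs applied to the basis tensors avoiding one index \<open>m\<close> cannot span the
  tensor power: there are at most \<open>(n + 1)\<^bsup>D\<^sup>2\<^esup> (D - 1)\<^sup>n\<close> of them. The orthogonal projection away from
  their span, which is stable under equivariant matrices and their transposes, is the required \<open>e\<close>.
\<close>

lemma central_projection_exists:
  fixes p :: "nat \<Rightarrow> bit"
  assumes m: "m < D"
  shows "\<exists>n (e :: nat list \<Rightarrow> nat list \<Rightarrow> rat). e \<in> square_maps (Idx D n) \<and> mul (Idx D n) e e = e \<and> e \<noteq> (\<lambda>I J. 0) \<and>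
    (\<forall>b :: nat list \<Rightarrow> nat list \<Rightarrow> rat. equivariant p D n b \<longrightarrow> (\<forall>I\<in>Idx D n. \<forall>J\<in>Idx D n.
       mul (Idx D n) e b I J = mul (Idx D n) b e I J)) \<and>
    (\<forall>I. \<forall>K\<in>Idx D n. m \<notin> set K \<longrightarrow> e I K = 0)"
proof -
  obtain n where n: "(n + 1) ^ (D * D) * (D - 1) ^ n < D ^ n"
    using exponential_beats_polynomial[of "D * D" "D - 1"] m by auto
  let ?S = "Idx D n"
  let ?A = "{K \<in> ?S. m \<notin> set K}"
  let ?T = "orbits D n \<times> ?A"
  have cardA: "card ?A = (D - 1) ^ n"
  proof -
    have "?A = {K. set K \<subseteq> {..<D} - {m} \<and> length K = n}" by (auto simp: Idx_def)
    then show ?thesis using m by (simp add: card_lists_length_eq)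
  qed
  have finT: "finite ?T" by simp
  define X :: "nat list \<Rightarrow> (nat \<times> nat) multiset \<times> nat list \<Rightarrow> rat"
    where "X = (\<lambda>I (\<omega>, K). of_int (orbit_sign p D n \<omega> I K))"
  obtain e Y where proj: "e \<in> square_maps ?S" "\<forall>i j. e i j = e j i" "mul ?S e e = e"
    "\<forall>i. \<forall>t\<in>?T. mul ?S e X i t = 0" "\<forall>i\<in>?S. \<forall>j\<in>?S. one_on ?S i j - e i j = mul ?T X Y i j"
    using orthogonal_projection[OF finite_Idx finT, of D n X] by (elim exE conjE)
  note e = proj(1) and ee = proj(3)
  have sym: "\<And>i j. e i j = e j i" using proj(2) by (elim allE)
  have eX: "\<And>i t. t \<in> ?T \<Longrightarrow> mul ?S e X i t = 0" using proj(4) by (simp only: Ball_def)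
  have eY: "\<And>i j. i \<in> ?S \<Longrightarrow> j \<in> ?S \<Longrightarrow> one_on ?S i j - e i j = mul ?T X Y i j"
    using proj(5) by (simp only: Ball_def)
  have no2: "x = - x \<Longrightarrow> x = 0" for x :: rat by simp
  (* b maps the span of the columns of X to itself: e b (1 - e) = e b X Y = 0 *)
  have absorb: "mul ?S (mul ?S e b) (\<lambda>i j. one_on ?S i j - e i j) i j = 0"
    if b: "equivariant p D n b" and ij: "j \<in> ?S" for b :: "nat list \<Rightarrow> nat list \<Rightarrow> rat" and i j
  proof -
    have "mul ?S e (mul ?S b X) l t = 0" if t: "t \<in> ?T" for l t
    proof -
      obtain \<omega> K where wK: "t = (\<omega>, K)" "K \<in> ?A" using t by blast
      have "equivariant p D n (mul ?S b (\<lambda>I J. of_int (orbit_sign p D n \<omega> I J)))"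
        by (intro equivariant_mul b equivariant_of_int orbit_sign_equivariant)
      from orbit_sign_span[OF this no2] obtain c where
        c: "\<And>I. I \<in> ?S \<Longrightarrow> mul ?S b X I t = (\<Sum>\<omega>\<in>orbits D n. X I (\<omega>, K) * c \<omega>)"
        using wK by (auto simp: X_def mul_def)
      have "mul ?S e (mul ?S b X) l t = (\<Sum>I\<in>?S. \<Sum>\<omega>\<in>orbits D n. e l I * X I (\<omega>, K) * c \<omega>)"
        unfolding mul_def[of _ e] using c by (intro sum.cong) (auto simp: sum_distrib_left mult.assoc)
      also have "\<dots> = (\<Sum>\<omega>\<in>orbits D n. mul ?S e X l (\<omega>, K) * c \<omega>)"
        by (subst sum.swap) (simp add: mul_def sum_distrib_right)
      also have "\<dots> = 0" using eX wK by (intro sum.neutral) auto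
      finally show ?thesis .
    qed
    then have "mul ?T (mul ?S e (mul ?S b X)) Y i j = 0"
      unfolding mul_def[of ?T] by (intro sum.neutral) auto
    moreover have "mul ?S (mul ?S e b) (\<lambda>i j. one_on ?S i j - e i j) i j = mul ?S (mul ?S e b) (mul ?T X Y) i j"
      unfolding mul_def[of _ "mul ?S e b"] using eY ij by (intro sum.cong) auto
    ultimately show ?thesis by (simp add: mul_assoc)
  qed
  have ebe: "mul ?S e (mul ?S b e) i j = mul ?S e b i j"
    if b: "equivariant p D n b" and ij: "j \<in> ?S" for b i j
  proof -
    have "mul ?S (mul ?S e b) (one_on ?S) i j = mul ?S e b i j"
      using ij by (simp add: mul_one_apply)
    then show ?thesis
      using absorb[OF that, of i] ij by (simp add: mul_diff_right mul_assoc)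
  qed
  (* e b = e b e for b and for its transpose; as e is symmetric the latter reads b e = e b e *)
  have comm: "mul ?S e b I J = mul ?S b e I J"
    if b: "equivariant p D n b" and IJ: "I \<in> ?S" "J \<in> ?S" for b I J
  proof -
    let ?bt = "\<lambda>I J. b J I"
    have tr: "mul ?S e ?bt J I = mul ?S b e I J" "mul ?S e (mul ?S ?bt e) J I = mul ?S e (mul ?S b e) I J"
    proof -
      show "mul ?S e ?bt J I = mul ?S b e I J"
        using sym by (simp add: mul_def mult.commute)
      have "mul ?S e (mul ?S ?bt e) J I = (\<Sum>k\<in>?S. \<Sum>l\<in>?S. e I l * (b l k * e k J))"
        unfolding mul_def sum_distrib_left using sym by (intro sum.cong) (auto simp: mult_ac)
      also have "\<dots> = mul ?S e (mul ?S b e) I J"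
        unfolding mul_def sum_distrib_left by (rule sum.swap)
      finally show "mul ?S e (mul ?S ?bt e) J I = mul ?S e (mul ?S b e) I J" .
    qed
    then show ?thesis
      using ebe[OF b IJ(2), of I] ebe[OF equivariant_transpose[OF b] IJ(1), of J] by simp
  qed
  have "e I K = 0" if K: "K \<in> ?A" for I K
  proof -
    have "equivariant p D n (one_on ?S :: _ \<Rightarrow> _ \<Rightarrow> rat)"
      using equivariant_graded_one[of p D n "\<lambda>_. 1"] by simp
    from orbit_sign_span[OF this no2] K obtain c where
      c: "\<And>I. I \<in> ?S \<Longrightarrow> one_on ?S I K = (\<Sum>\<omega>\<in>orbits D n. X I (\<omega>, K) * c \<omega>)"
      by (auto simp: X_def)
    have "e I K = mul ?S e (one_on ?S) I K"
      using even_maps_mul_one(2)[OF e] by simp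
    also have "\<dots> = (\<Sum>J\<in>?S. \<Sum>\<omega>\<in>orbits D n. e I J * X J (\<omega>, K) * c \<omega>)"
      unfolding mul_def using c by (intro sum.cong) (auto simp: sum_distrib_left mult.assoc)
    also have "\<dots> = (\<Sum>\<omega>\<in>orbits D n. mul ?S e X I (\<omega>, K) * c \<omega>)"
      by (subst sum.swap) (simp add: mul_def sum_distrib_right)
    also have "\<dots> = 0" using eX K by (intro sum.neutral) auto
    finally show ?thesis .
  qed
  moreover have "e \<noteq> (\<lambda>I J. 0)"
  proof
    assume "e = (\<lambda>I J. 0)"
    then have "card ?S \<le> card ?T"
      using eY by (intro card_le_if_identity_factors[of ?S ?T X Y]) (auto simp flip: eY)
    also have "\<dots> \<le> (n + 1) ^ (D * D) * (D - 1) ^ n"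
      unfolding card_cartesian_product cardA using card_orbits by (intro mult_right_mono) auto
    finally show False using n by (simp add: card_Idx)
  qed
  ultimately show ?thesis using e ee comm by blast
qed

text \<open>
  Over a field \<open>k\<close> of characteristic \<open>0\<close>, commutation with the integral spanning set extends to
  equivariant matrices with entries in any \<open>k\<close>-algebra.
\<close>

lemma commutes_with_equivariant:
  fixes e :: "nat list \<Rightarrow> nat list \<Rightarrow> rat"
    and s :: "'k::field_char_0 \<Rightarrow> 'm::ring_1 \<Rightarrow> 'm"
  assumes s: "vector_space s"
    and e: "\<And>b :: nat list \<Rightarrow> nat list \<Rightarrow> rat. equivariant p D n b \<Longrightarrow> \<forall>I\<in>Idx D n. \<forall>J\<in>Idx D n.
       mul (Idx D n) e b I J = mul (Idx D n) b e I J"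
    and f: "equivariant p D n f" and IJ: "I \<in> Idx D n" "J \<in> Idx D n"
  shows "(\<Sum>K\<in>Idx D n. s (of_rat (e I K)) (f K J)) = (\<Sum>K\<in>Idx D n. s (of_rat (e K J)) (f I K))"
proof -
  interpret vector_space s by (rule s)
  let ?S = "Idx D n" and ?b = "orbit_sign p D n"
  have no2: "x = 0" if "x = - x" for x :: 'm
  proof -
    have "x + x = 0" using that by (metis add.right_inverse)
    then have "s (1 + 1) x = 0" by (simp only: scale_left_distrib scale_one)
    then show ?thesis by (simp only: scale_eq_0_iff) simp
  qed
  obtain c where c: "\<And>I J. I \<in> ?S \<Longrightarrow> J \<in> ?S \<Longrightarrow> f I J = (\<Sum>\<omega>\<in>orbits D n. of_int (?b \<omega> I J) * c \<omega>)"
    using orbit_sign_span[OF f no2] by blast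
  have int: "of_int (?b \<omega> I J) * x = s (of_rat (of_int (?b \<omega> I J))) x" if "I \<in> ?S" "J \<in> ?S" for \<omega> I J x
    using orbit_sign_values[of "zip I J" D n p \<omega>] zip_Prs[OF that] by auto
  have "(\<Sum>K\<in>?S. s (of_rat (e I K)) (f K J)) =
      (\<Sum>K\<in>?S. \<Sum>\<omega>\<in>orbits D n. s (of_rat (e I K * of_int (?b \<omega> K J))) (c \<omega>))"
    using IJ by (intro sum.cong refl) (simp add: c int scale_sum_right of_rat_mult)
  also have "\<dots> = (\<Sum>\<omega>\<in>orbits D n. s (of_rat (mul ?S e (\<lambda>I J. of_int (?b \<omega> I J)) I J)) (c \<omega>))"
    by (subst sum.swap) (simp add: mul_def of_rat_sum scale_sum_left)
  also have "\<dots> = (\<Sum>\<omega>\<in>orbits D n. s (of_rat (mul ?S (\<lambda>I J. of_int (?b \<omega> I J)) e I J)) (c \<omega>))"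
    using e[OF equivariant_of_int[OF orbit_sign_equivariant]] IJ by simp
  also have "\<dots> = (\<Sum>K\<in>?S. \<Sum>\<omega>\<in>orbits D n. s (of_rat (of_int (?b \<omega> I K) * e K J)) (c \<omega>))"
    by (subst sum.swap) (simp add: mul_def of_rat_sum scale_sum_left)
  also have "\<dots> = (\<Sum>K\<in>?S. s (of_rat (e K J)) (f I K))"
    using IJ by (intro sum.cong refl) (simp add: c int scale_sum_right of_rat_mult mult.commute)
  finally show ?thesis .
qed

section \<open>Calculus in the tensor square of the coordinate ring\<close>

context algebraic_supergroup
begin

interpretation vs: Vector_Spaces.vector_space "scal G"
  by (rule vector_space)

abbreviation teq (infix "\<approx>" 50) where
  "t \<approx> u \<equiv> tensor2_eq (scal G) t u"

abbreviation null2 where "null2 \<equiv> tensor2_null (scal G)"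

lemma null_minus: "u \<in> null2 \<Longrightarrow> - u \<in> null2"
  using tensor2_null.intros(2)[OF tensor2_null.intros(1)] by fastforce

lemma null_add: "u \<in> null2 \<Longrightarrow> v \<in> null2 \<Longrightarrow> u + v \<in> null2"
  using tensor2_null.intros(2)[OF _ null_minus] by fastforce

lemma null_sum: "(\<And>i. i \<in> A \<Longrightarrow> f i \<in> null2) \<Longrightarrow> sum f A \<in> null2"
  by (induction A rule: infinite_finite_induct) (auto intro: null_add tensor2_null.intros(1))

lemma null_cmul: "u \<in> null2 \<Longrightarrow> frag_cmul c u \<in> null2"
proof -
  have pos: "frag_cmul (int n) u \<in> null2" if "u \<in> null2" for n
    using that by (induction n) (auto simp: frag_cmul_distrib intro: null_add tensor2_null.intros(1))
  assume "u \<in> null2"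
  then show ?thesis
    using pos null_minus[OF pos] by (cases c rule: int_cases2) auto
qed

lemma frag_cmul_diff: "frag_cmul k (t - u) = frag_cmul k t - frag_cmul k u"
  by (rule poly_mapping_eqI) (simp add: lookup_minus right_diff_distrib)

lemma teq_refl [simp]: "t \<approx> t"
  by (simp add: tensor2_eq_def tensor2_null.intros)

lemma teq_sym: "t \<approx> u \<Longrightarrow> u \<approx> t"
  using null_minus by (fastforce simp: tensor2_eq_def)

lemma teq_trans [trans]: "t \<approx> u \<Longrightarrow> u \<approx> v \<Longrightarrow> t \<approx> v"
  using null_add by (fastforce simp: tensor2_eq_def)

lemma teq_add: "t \<approx> u \<Longrightarrow> t' \<approx> u' \<Longrightarrow> t + t' \<approx> u + u'"
  using null_add by (fastforce simp: tensor2_eq_def add_diff_add)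

lemma teq_minus: "t \<approx> u \<Longrightarrow> - t \<approx> - u"
  using null_minus by (fastforce simp: tensor2_eq_def)

lemma teq_diff: "t \<approx> u \<Longrightarrow> t' \<approx> u' \<Longrightarrow> t - t' \<approx> u - u'"
  using teq_add[OF _ teq_minus] by fastforce

lemma teq_sum: "(\<And>i. i \<in> A \<Longrightarrow> f i \<approx> g i) \<Longrightarrow> sum f A \<approx> sum g A"
  using null_sum[of A "\<lambda>i. f i - g i"] by (simp add: tensor2_eq_def sum_subtractf)

lemma teq_0_iff: "t \<approx> 0 \<longleftrightarrow> t \<in> null2"
  by (simp add: tensor2_eq_def)

lemma simple_add_left: "frag_of (a + a', b) \<approx> frag_of (a, b) + frag_of (a', b)"
  using tensor2_null.intros(3) by (simp add: tensor2_eq_def diff_diff_eq)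

lemma simple_add_right: "frag_of (a, b + b') \<approx> frag_of (a, b) + frag_of (a, b')"
  using tensor2_null.intros(4) by (simp add: tensor2_eq_def diff_diff_eq)

lemma simple_scal: "frag_of (scal G c a, b) \<approx> frag_of (a, scal G c b)"
  using tensor2_null.intros(5) by (simp add: tensor2_eq_def)

lemma simple_zero_left: "frag_of (0, b) \<approx> 0"
  using null_minus[OF tensor2_null.intros(3)[of 0 0 b "scal G"]] by (simp add: teq_0_iff)

lemma simple_zero_right: "frag_of (a, 0) \<approx> 0"
  using null_minus[OF tensor2_null.intros(4)[of a 0 0 "scal G"]] by (simp add: teq_0_iff)

lemma simple_minus_left: "frag_of (- a, b) \<approx> - frag_of (a, b)"
proof -
  have "frag_of (a, b) + frag_of (- a, b) \<approx> 0"
    using teq_trans[OF teq_sym[OF simple_add_left] , of a "- a" b 0] simple_zero_left by simp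
  from teq_diff[OF this teq_refl[of "frag_of (a, b)"]] show ?thesis by simp
qed

lemma simple_sum_left: "frag_of (\<Sum>i\<in>A. f i, b) \<approx> (\<Sum>i\<in>A. frag_of (f i, b))"
proof (induction A rule: infinite_finite_induct)
  case (insert x A)
  then show ?case
    using teq_trans[OF simple_add_left teq_add[OF teq_refl insert.IH]] by simp
qed (use simple_zero_left in auto)

lemma simple_sum_right: "frag_of (b, \<Sum>i\<in>A. f i) \<approx> (\<Sum>i\<in>A. frag_of (b, f i))"
proof (induction A rule: infinite_finite_induct)
  case (insert x A)
  then show ?case
    using teq_trans[OF simple_add_right teq_add[OF teq_refl insert.IH]] by simp
qed (use simple_zero_right in auto)

lemma simple_bilinear:
  "frag_of (\<Sum>i\<in>A. scal G (\<alpha> i) (x i), \<Sum>j\<in>B. scal G (\<beta> j) (y j)) \<approx>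
   (\<Sum>i\<in>A. \<Sum>j\<in>B. frag_of (scal G (\<alpha> i * \<beta> j) (x i), y j))"
proof -
  have "frag_of (\<Sum>i\<in>A. scal G (\<alpha> i) (x i), \<Sum>j\<in>B. scal G (\<beta> j) (y j)) \<approx>
      (\<Sum>i\<in>A. frag_of (scal G (\<alpha> i) (x i), \<Sum>j\<in>B. scal G (\<beta> j) (y j)))"
    by (rule simple_sum_left)
  also have "\<dots> \<approx> (\<Sum>i\<in>A. \<Sum>j\<in>B. frag_of (scal G (\<alpha> i) (x i), scal G (\<beta> j) (y j)))"
    by (intro teq_sum simple_sum_right)
  also have "\<dots> \<approx> (\<Sum>i\<in>A. \<Sum>j\<in>B. frag_of (scal G (\<alpha> i * \<beta> j) (x i), y j))"
    by (intro teq_sum teq_trans[OF teq_sym[OF simple_scal]]) (simp add: mult.commute)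
  finally show ?thesis .
qed

lemma simple_scal_sum: "(\<Sum>c\<in>A. frag_of (scal G (\<gamma> c) x, y)) \<approx> frag_of (scal G (\<Sum>c\<in>A. \<gamma> c) x, y)"
  unfolding vs.scale_sum_left by (rule teq_sym[OF simple_sum_left])

text \<open>A map on pairs extends to the tensor square as soon as it respects the defining relations.\<close>

lemma frag_extend_null:
  assumes "\<And>a a' b. h (a + a', b) - h (a, b) - h (a', b) \<in> null2"
    "\<And>a b b'. h (a, b + b') - h (a, b) - h (a, b') \<in> null2"
    "\<And>c a b. h (scal G c a, b) - h (a, scal G c b) \<in> null2"
  shows "t \<in> null2 \<Longrightarrow> frag_extend h t \<in> null2"
  by (induction t rule: tensor2_null.induct) (auto simp: frag_extend_diff assms intro: tensor2_null.intros)

lemma frag_extend_teq: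
  assumes "\<And>a a' b. h (a + a', b) \<approx> h (a, b) + h (a', b)"
    "\<And>a b b'. h (a, b + b') \<approx> h (a, b) + h (a, b')"
    "\<And>c a b. h (scal G c a, b) \<approx> h (a, scal G c b)"
    and "t \<approx> u"
  shows "frag_extend h t \<approx> frag_extend h u"
  using frag_extend_null[of h "t - u"] assms
  by (simp add: tensor2_eq_def frag_extend_diff diff_diff_eq)

lemma frag_extend_cong_teq:
  assumes "\<And>i. f i \<approx> g i"
  shows "frag_extend f t \<approx> frag_extend g t"
proof -
  have "(\<Sum>i\<in>Poly_Mapping.keys t. frag_cmul (Poly_Mapping.lookup t i) (f i - g i)) \<in> null2"
    using assms by (intro null_sum null_cmul) (simp add: tensor2_eq_def)
  then show ?thesis
    by (simp add: tensor2_eq_def frag_extend_def sum_subtractf frag_cmul_diff)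
qed

lemma frag_extend_plus_fun: "frag_extend (\<lambda>i. f i + g i) t = frag_extend f t + frag_extend g t"
  by (simp add: frag_extend_def frag_cmul_distrib2 sum.distrib)

lemma homog_closed:
  "0 \<in> homog G q" "a \<in> homog G q \<Longrightarrow> b \<in> homog G q \<Longrightarrow> a + b \<in> homog G q"
  "a \<in> homog G q \<Longrightarrow> b \<in> homog G q \<Longrightarrow> a - b \<in> homog G q"
  "a \<in> homog G q \<Longrightarrow> - a \<in> homog G q" "a \<in> homog G q \<Longrightarrow> scal G c a \<in> homog G q"
  "(\<And>i. i \<in> A \<Longrightarrow> f i \<in> homog G q) \<Longrightarrow> sum f A \<in> homog G q"
  using homog_subspace[of q]
  by (auto intro: vs.subspace_0 vs.subspace_add vs.subspace_diff vs.subspace_neg vs.subspace_scale vs.subspace_sum)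

lemma component_eqI:
  assumes "b \<in> homog G q" "a - b \<in> homog G (q + 1)"
  shows "component G q a = b"
  unfolding component_def
proof (rule the_equality)
  show "b \<in> homog G q \<and> a - b \<in> homog G (q + 1)" using assms by simp
next
  fix b' assume b': "b' \<in> homog G q \<and> a - b' \<in> homog G (q + 1)"
  have un: "\<And>b b'. b \<in> homog G 0 \<Longrightarrow> a - b \<in> homog G 1 \<Longrightarrow> b' \<in> homog G 0 \<Longrightarrow> a - b' \<in> homog G 1 \<Longrightarrow> b = b'"
    using homog_decomp[of a] by blast
  show "b' = b"
  proof (cases q)
    case zero
    then show ?thesis using un[of b b'] assms b' by simp
  next
    case one
    then have "a - b = a - b'" using un[of "a - b" "a - b'"] assms b' by simp
    then show ?thesis by simp
  qed
qed

lemma component_props: "component G q a \<in> homog G q" "a - component G q a \<in> homog G (q + 1)"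
proof -
  obtain b where b: "b \<in> homog G 0" "a - b \<in> homog G 1" using homog_decomp by blast
  have "component G q a = (if q = 0 then b else a - b)"
    using b by (cases q) (auto intro: component_eqI)
  then show "component G q a \<in> homog G q" "a - component G q a \<in> homog G (q + 1)"
    using b by (cases q; auto)+
qed

lemma component_add: "component G q (a + b) = component G q a + component G q b"
proof (rule component_eqI)
  have "a + b - (component G q a + component G q b) = (a - component G q a) + (b - component G q b)" by simp
  then show "a + b - (component G q a + component G q b) \<in> homog G (q + 1)"
    using homog_closed(2)[OF component_props(2) component_props(2)] by (simp only:)
qed (intro homog_closed component_props)

lemma component_scal: "component G q (scal G c a) = scal G c (component G q a)"
proof (rule component_eqI)
  show "scal G c a - scal G c (component G q a) \<in> homog G (q + 1)"
    unfolding vs.scale_right_diff_distrib[symmetric] by (intro homog_closed component_props)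
qed (intro homog_closed component_props)

lemma component_homog: "a \<in> homog G q \<Longrightarrow> component G r a = (if r = q then a else 0)"
  by (rule component_eqI; cases q; cases r) (auto intro: homog_closed)

text \<open>
  The product of two simple tensors. Written with homogeneous components it is additive and balanced in
  both factors, so multiplication of representatives descends to the tensor square.
\<close>

definition mult_pairs where
  "mult_pairs = (\<lambda>(a, b) (c, d). \<Sum>q\<in>{0, 1}. \<Sum>r\<in>{0, 1}.
     frag_cmul (koszul q r) (frag_of (a * component G r c, component G q b * d)))"

lemma tensor_mult_eq: "tensor_mult G t u = frag_extend (\<lambda>x. frag_extend (mult_pairs x) u) t"
  unfolding tensor_mult_def mult_pairs_def by (intro arg_cong2[where f = frag_extend]) (auto simp: fun_eq_iff)

lemma teq_cmul: "t \<approx> u \<Longrightarrow> frag_cmul k t \<approx> frag_cmul k u"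
  using null_cmul[of "t - u" k] by (simp add: tensor2_eq_def frag_cmul_diff)

lemma mult_pairs_teq:
  assumes "\<And>q r. frag_of (a * component G r c, component G q b * d) \<approx> h q r"
  shows "mult_pairs (a, b) (c, d) \<approx> (\<Sum>q\<in>{0, 1}. \<Sum>r\<in>{0, 1}. frag_cmul (koszul q r) (h q r))"
  unfolding mult_pairs_def prod.case by (intro teq_sum teq_cmul assms)

lemma mult_pairs_relations:
  "mult_pairs (a + a', b) (c, d) \<approx> mult_pairs (a, b) (c, d) + mult_pairs (a', b) (c, d)"
  "mult_pairs (a, b + b') (c, d) \<approx> mult_pairs (a, b) (c, d) + mult_pairs (a, b') (c, d)"
  "mult_pairs (scal G k a, b) (c, d) \<approx> mult_pairs (a, scal G k b) (c, d)"
  "mult_pairs (a, b) (c + c', d) \<approx> mult_pairs (a, b) (c, d) + mult_pairs (a, b) (c', d)"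
  "mult_pairs (a, b) (c, d + d') \<approx> mult_pairs (a, b) (c, d) + mult_pairs (a, b) (c, d')"
  "mult_pairs (a, b) (scal G k c, d) \<approx> mult_pairs (a, b) (c, scal G k d)"
proof -
  let ?h = "\<lambda>a b c d q r. frag_of (a * component G r c, component G q b * d)"
  have split: "(\<Sum>q\<in>{0, 1}. \<Sum>r\<in>{0, 1}. frag_cmul (koszul q r) (?h a b c d q r + ?h a' b' c' d' q r)) =
      mult_pairs (a, b) (c, d) + mult_pairs (a', b') (c', d')" for a b c d a' b' c' d'
    by (simp add: mult_pairs_def frag_cmul_distrib2 sum.distrib)
  have same: "(\<Sum>q\<in>{0, 1}. \<Sum>r\<in>{0, 1}. frag_cmul (koszul q r) (?h a b c d q r)) =
      mult_pairs (a, b) (c, d)" for a b c d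
    by (simp add: mult_pairs_def)
  show "mult_pairs (a + a', b) (c, d) \<approx> mult_pairs (a, b) (c, d) + mult_pairs (a', b) (c, d)"
    unfolding split[symmetric]
    by (intro mult_pairs_teq) (simp add: distrib_right simple_add_left)
  show "mult_pairs (a, b + b') (c, d) \<approx> mult_pairs (a, b) (c, d) + mult_pairs (a, b') (c, d)"
    unfolding split[symmetric]
    by (intro mult_pairs_teq) (simp add: component_add distrib_right simple_add_right)
  show "mult_pairs (a, b) (c + c', d) \<approx> mult_pairs (a, b) (c, d) + mult_pairs (a, b) (c', d)"
    unfolding split[symmetric]
    by (intro mult_pairs_teq) (simp add: component_add distrib_left simple_add_left)
  show "mult_pairs (a, b) (c, d + d') \<approx> mult_pairs (a, b) (c, d) + mult_pairs (a, b) (c, d')"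
    unfolding split[symmetric]
    by (intro mult_pairs_teq) (simp add: distrib_left simple_add_right)
  show "mult_pairs (scal G k a, b) (c, d) \<approx> mult_pairs (a, scal G k b) (c, d)"
    using mult_pairs_teq[of "scal G k a" c b d "?h a (scal G k b) c d"]
    unfolding same by (simp add: component_scal simple_scal flip: scal_mult_left)
  show "mult_pairs (a, b) (scal G k c, d) \<approx> mult_pairs (a, b) (c, scal G k d)"
    using mult_pairs_teq[of a "scal G k c" b d "?h a b c (scal G k d)"]
    unfolding same by (simp add: component_scal simple_scal flip: scal_mult_right)
qed

lemma tensor_mult_teq:
  assumes "t \<approx> t'" "u \<approx> u'"
  shows "tensor_mult G t u \<approx> tensor_mult G t' u'"
proof -
  have "frag_extend (mult_pairs x) u \<approx> frag_extend (mult_pairs x) u'" for x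
    by (cases x) (intro frag_extend_teq[OF _ _ _ assms(2)], simp_all only: mult_pairs_relations)
  then have "tensor_mult G t u \<approx> tensor_mult G t u'"
    unfolding tensor_mult_eq by (rule frag_extend_cong_teq)
  also have "\<dots> \<approx> tensor_mult G t' u'"
    unfolding tensor_mult_eq
  proof (rule frag_extend_teq[OF _ _ _ assms(1)])
    show "frag_extend (mult_pairs (a + a', b)) u' \<approx>
        frag_extend (mult_pairs (a, b)) u' + frag_extend (mult_pairs (a', b)) u'" for a a' b
      unfolding frag_extend_plus_fun[symmetric]
      by (rule frag_extend_cong_teq) (auto simp: mult_pairs_relations split: prod.split)
    show "frag_extend (mult_pairs (a, b + b')) u' \<approx>
        frag_extend (mult_pairs (a, b)) u' + frag_extend (mult_pairs (a, b')) u'" for a b b'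
      unfolding frag_extend_plus_fun[symmetric]
      by (rule frag_extend_cong_teq) (auto simp: mult_pairs_relations split: prod.split)
    show "frag_extend (mult_pairs (scal G k a, b)) u' \<approx> frag_extend (mult_pairs (a, scal G k b)) u'" for a b k
      by (rule frag_extend_cong_teq) (auto simp: mult_pairs_relations split: prod.split)
  qed
  finally show ?thesis .
qed

lemma tensor_mult_sums:
  assumes "finite A" "finite B"
  shows "tensor_mult G (\<Sum>i\<in>A. frag_of (f i)) (\<Sum>j\<in>B. frag_of (g j)) = (\<Sum>i\<in>A. \<Sum>j\<in>B. mult_pairs (f i) (g j))"
  using assms by (simp add: tensor_mult_eq frag_extend_sum o_def)

lemma mult_pairs_homog:
  assumes "b \<in> homog G q" "c \<in> homog G r"
  shows "mult_pairs (a, b) (c, d) \<approx> frag_of (koszul q r * (a * c), b * d)"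
proof -
  have "mult_pairs (a, b) (c, d) \<approx>
      (\<Sum>q'\<in>{0, 1}. \<Sum>r'\<in>{0, 1}. frag_cmul (koszul q' r') (if q' = q \<and> r' = r then frag_of (a * c, b * d) else 0))"
    using assms by (intro mult_pairs_teq) (auto simp: component_homog simple_zero_left simple_zero_right)
  also have "\<dots> = frag_cmul (koszul q r) (frag_of (a * c, b * d))"
    by (cases q; cases r) simp_all
  also have "\<dots> \<approx> frag_of (koszul q r * (a * c), b * d)"
    using teq_sym[OF simple_minus_left] by (simp add: koszul_def)
  finally show ?thesis .
qed

lemma comult_zero: "comult G 0 \<approx> 0"
  using comult_add[of 0 0] null_minus by (fastforce simp: tensor2_eq_def)

lemma comult_sum: "comult G (sum f A) \<approx> (\<Sum>i\<in>A. comult G (f i))"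
proof (induction A rule: infinite_finite_induct)
  case (insert x A)
  then show ?case
    using teq_trans[OF comult_add teq_add[OF teq_refl insert.IH]] by simp
qed (use comult_zero in auto)

lemma comult_scal_simple:
  assumes "finite A" "comult G a \<approx> (\<Sum>i\<in>A. frag_of (x i, y i))"
  shows "comult G (scal G c a) \<approx> (\<Sum>i\<in>A. frag_of (scal G c (x i), y i))"
proof -
  let ?h = "\<lambda>(a1, a2). frag_of (scal G c a1, a2)"
  note comult_scal
  also have "frag_extend ?h (comult G a) \<approx> frag_extend ?h (\<Sum>i\<in>A. frag_of (x i, y i))"
  proof (rule frag_extend_teq[OF _ _ _ assms(2)])
    show "?h (scal G k a, b) \<approx> ?h (a, scal G k b)" for k a b
      using simple_scal[of k "scal G c a" b] by (simp add: mult.commute)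
  qed (simp_all add: vs.scale_right_distrib simple_add_left simple_add_right)
  also have "\<dots> = (\<Sum>i\<in>A. frag_of (scal G c (x i), y i))"
    using assms(1) by (simp add: frag_extend_sum o_def)
  finally show ?thesis .
qed

lemma koszul_scal: "koszul a b * t = scal G (koszul a b) t"
  by (simp add: koszul_def)

lemma comult_sign_simple:
  assumes "finite A" "comult G a \<approx> (\<Sum>i\<in>A. frag_of (x i, y i))"
  shows "comult G (koszul q r * a) \<approx> (\<Sum>i\<in>A. frag_of (koszul q r * x i, y i))"
  unfolding koszul_scal by (rule comult_scal_simple[OF assms])

lemma counit_simps:
  "counit G (a + b) = counit G a + counit G b" "counit G (scal G c a) = c * counit G a"
  "counit G 0 = 0" "counit G (sum f A) = (\<Sum>i\<in>A. counit G (f i))" "counit G (koszul q r * a) = koszul q r * counit G a"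
proof -
  interpret l: Vector_Spaces.linear "scal G" "(*)" "counit G" by (rule counit_linear)
  show "counit G (a + b) = counit G a + counit G b" by (rule l.add)
  show s: "counit G (scal G c a) = c * counit G a" for c a by (rule l.scale)
  show "counit G 0 = 0" by (rule l.zero)
  show "counit G (sum f A) = (\<Sum>i\<in>A. counit G (f i))" by (rule l.sum)
  show "counit G (koszul q r * a) = koszul q r * counit G a" unfolding koszul_scal s ..
qed

end

section \<open>Tensor powers of a representation and their direct summands\<close>

fun tpar :: "(nat \<Rightarrow> bit) \<Rightarrow> nat list \<Rightarrow> bit" where
  "tpar p [] = 0"
| "tpar p (i # I) = p i + tpar p I"

text \<open>
  The coaction matrix of a tensor power. Moving \<open>c\<^sub>i\<^sub>j\<close> past the basis tensor \<open>e\<^sub>I\<close> in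
  \<open>e\<^sub>j \<otimes> e\<^sub>J \<mapsto> \<Sum> (e\<^sub>i \<otimes> c\<^sub>i\<^sub>j) (e\<^sub>I \<otimes> C\<^sub>I\<^sub>J)\<close> produces the sign.
\<close>

fun tcoef :: "(nat \<Rightarrow> nat \<Rightarrow> 'a::ring_1) \<Rightarrow> (nat \<Rightarrow> bit) \<Rightarrow> nat list \<Rightarrow> nat list \<Rightarrow> 'a" where
  "tcoef c p [] [] = 1"
| "tcoef c p (i # I) (j # J) = koszul (p i + p j) (tpar p I) * (c i j * tcoef c p I J)"
| "tcoef c p _ _ = 0"

lemma sum_Idx_Suc: "(\<Sum>J\<in>Idx D (Suc n). g J) = (\<Sum>j<D. \<Sum>J\<in>Idx D n. g (j # J))"
proof -
  have "Idx D (Suc n) = (\<lambda>(j, J). j # J) ` ({..<D} \<times> Idx D n)"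
  proof (intro equalityI subsetI)
    fix J assume "J \<in> Idx D (Suc n)"
    then obtain j J' where "J = j # J'" by (cases J) (auto simp: Idx_def)
    then show "J \<in> (\<lambda>(j, J). j # J) ` ({..<D} \<times> Idx D n)"
      using \<open>J \<in> Idx D (Suc n)\<close> by (auto simp: Idx_def)
  qed (auto simp: Idx_def)
  moreover have "inj_on (\<lambda>(j, J). j # J) ({..<D} \<times> Idx D n)" by (auto simp: inj_on_def)
  ultimately have "(\<Sum>J\<in>Idx D (Suc n). g J) = (\<Sum>(j, J)\<in>{..<D} \<times> Idx D n. g (j # J))"
    by (simp add: sum.reindex case_prod_unfold)
  then show ?thesis by (simp add: sum.cartesian_product)
qed

lemma Idx_0: "Idx D 0 = {[]}"
  by (auto simp: Idx_def)

lemma Idx_Cons: "i # I \<in> Idx D n \<longleftrightarrow> i < D \<and> (\<exists>m. n = Suc m \<and> I \<in> Idx D m)"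
  by (auto simp: Idx_def)

locale super_rep = algebraic_supergroup G for G :: "('k::field_char_0, 'a::ring_1) supergroup" (structure) +
  fixes ps :: "bit list" and C :: "'a mat"
  assumes rep: "(ps, C) \<in> Rep G"
begin

interpretation vs: Vector_Spaces.vector_space "scal G"
  by (rule vector_space)

definition D where "D = length ps"
definition p where "p = (!) ps"
definition c where "c = (\<lambda>i j. C $$ (i, j))"

lemma coefs:
  assumes "i < D" "j < D"
  shows "c i j \<in> homog G (p i + p j)" "comult G (c i j) \<approx> (\<Sum>l<D. frag_of (c i l, c l j))"
    "counit G (c i j) = (if i = j then 1 else 0)"
  using rep assms by (auto simp: Rep_def D_def p_def c_def)

lemma tcoef_homog: "I \<in> Idx D n \<Longrightarrow> J \<in> Idx D n \<Longrightarrow> tcoef c p I J \<in> homog G (tpar p I + tpar p J)"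
proof (induction n arbitrary: I J)
  case 0
  then show ?case using homog_one by (simp add: Idx_0)
next
  case (Suc n)
  obtain i I' j J' where eq: "I = i # I'" "J = j # J'" "i < D" "j < D" "I' \<in> Idx D n" "J' \<in> Idx D n"
    using Suc.prems by (cases I; cases J) (auto simp: Idx_Cons Idx_def)
  have "c i j * tcoef c p I' J' \<in> homog G ((p i + p j) + (tpar p I' + tpar p J'))"
    using Suc.IH eq coefs by (intro homog_mult) auto
  then show ?case
    unfolding eq tcoef.simps koszul_scal by (intro homog_closed) (simp only: tpar.simps add_ac)
qed

lemma counit_tcoef: "I \<in> Idx D n \<Longrightarrow> J \<in> Idx D n \<Longrightarrow> counit G (tcoef c p I J) = (if I = J then 1 else 0)"
proof (induction n arbitrary: I J)
  case 0
  then show ?case using counit_one by (simp add: Idx_0)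
next
  case (Suc n)
  obtain i I' j J' where eq: "I = i # I'" "J = j # J'" "i < D" "j < D" "I' \<in> Idx D n" "J' \<in> Idx D n"
    using Suc.prems by (cases I; cases J) (auto simp: Idx_Cons Idx_def)
  then show ?case
    using Suc.IH[OF eq(5,6)] coefs(3)[OF eq(3,4)]
    by (auto simp: counit_simps counit_mult koszul_def counit_one)
qed

text \<open>
  The cocycle identity of the Koszul signs that makes the coaction matrix of \<open>V \<otimes> V\<^sup>\<otimes>\<^sup>n\<close>
  comultiplicative: exchanging the inner tensor factors of \<open>(c\<^sub>i\<^sub>l \<otimes> c\<^sub>l\<^sub>j) (C\<^sub>I\<^sub>K \<otimes> C\<^sub>K\<^sub>J)\<close> costs the same sign as
  passing from products of coefficients to the coefficients of the tensor product.
\<close>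

lemma koszul_tensor_power:
  "koszul (a + b) s * koszul (l + b) (s + t) = (koszul (l + b) t * koszul (a + l) s :: 'r::ring_1)"
  by (cases a; cases b; cases s; cases l; cases t) (simp_all add: koszul_def)

lemma comult_tcoef:
  "I \<in> Idx D n \<Longrightarrow> J \<in> Idx D n \<Longrightarrow>
   comult G (tcoef c p I J) \<approx> (\<Sum>K\<in>Idx D n. frag_of (tcoef c p I K, tcoef c p K J))"
proof (induction n arbitrary: I J)
  case 0
  then show ?case using comult_one by (simp add: Idx_0)
next
  case (Suc n)
  obtain i I' j J' where eq: "I = i # I'" "J = j # J'" "i < D" "j < D" "I' \<in> Idx D n" "J' \<in> Idx D n"
    using Suc.prems by (cases I; cases J) (auto simp: Idx_Cons Idx_def)
  let ?T = "tcoef c p" and ?S = "Idx D n"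
  have "comult G (c i j * ?T I' J') \<approx> tensor_mult G (comult G (c i j)) (comult G (?T I' J'))"
    by (rule comult_mult)
  also have "\<dots> \<approx> tensor_mult G (\<Sum>l<D. frag_of (c i l, c l j)) (\<Sum>K\<in>?S. frag_of (?T I' K, ?T K J'))"
    using Suc.IH eq coefs by (intro tensor_mult_teq) auto
  also have "\<dots> = (\<Sum>l<D. \<Sum>K\<in>?S. mult_pairs (c i l, c l j) (?T I' K, ?T K J'))"
    by (simp add: tensor_mult_sums)
  also have "\<dots> \<approx> (\<Sum>l<D. \<Sum>K\<in>?S.
      frag_of (koszul (p l + p j) (tpar p I' + tpar p K) * (c i l * ?T I' K), c l j * ?T K J'))"
    using eq by (intro teq_sum mult_pairs_homog coefs tcoef_homog[of _ n]) auto
  finally have "comult G (c i j * ?T I' J') \<approx> (\<Sum>(l, K)\<in>{..<D} \<times> ?S.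
      frag_of (koszul (p l + p j) (tpar p I' + tpar p K) * (c i l * ?T I' K), c l j * ?T K J'))"
    by (simp add: sum.cartesian_product)
  then have "comult G (?T I J) \<approx> (\<Sum>(l, K)\<in>{..<D} \<times> ?S. frag_of (koszul (p i + p j) (tpar p I') *
      (koszul (p l + p j) (tpar p I' + tpar p K) * (c i l * ?T I' K)), c l j * ?T K J'))"
    unfolding eq tcoef.simps case_prod_unfold by (intro comult_sign_simple) auto
  also have "\<dots> \<approx> (\<Sum>(l, K)\<in>{..<D} \<times> ?S. frag_of (?T I (l # K), ?T (l # K) J))"
  proof (intro teq_sum, clarify)
    fix l K
    have "koszul (p i + p j) (tpar p I') * (koszul (p l + p j) (tpar p I' + tpar p K) * (c i l * ?T I' K)) =
        koszul (p l + p j) (tpar p K) * ?T I (l # K)"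
      unfolding mult.assoc[symmetric] koszul_tensor_power by (simp add: eq mult.assoc)
    then have "frag_of (koszul (p i + p j) (tpar p I') *
        (koszul (p l + p j) (tpar p I' + tpar p K) * (c i l * ?T I' K)), c l j * ?T K J') =
        frag_of (scal G (koszul (p l + p j) (tpar p K)) (?T I (l # K)), c l j * ?T K J')"
      by (simp only: koszul_scal)
    also have "\<dots> \<approx> frag_of (?T I (l # K), scal G (koszul (p l + p j) (tpar p K)) (c l j * ?T K J'))"
      by (rule simple_scal)
    finally show "frag_of (koszul (p i + p j) (tpar p I') *
        (koszul (p l + p j) (tpar p I' + tpar p K) * (c i l * ?T I' K)), c l j * ?T K J') \<approx>
        frag_of (?T I (l # K), ?T (l # K) J)"
      by (simp only: eq tcoef.simps koszul_scal)
  qed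
  also have "\<dots> = (\<Sum>K\<in>Idx D (Suc n). frag_of (?T I K, ?T K J))"
    by (simp add: sum_Idx_Suc sum.cartesian_product)
  finally show ?case .
qed

lemma tpar_append: "tpar p (I @ J) = tpar p I + tpar p J"
  by (induction I) (simp_all only: append_Nil append_Cons tpar.simps add.assoc add_0)

text \<open>Supercommutativity makes the coaction on a tensor power commute with signed permutations.\<close>

lemma equivariant_tcoef: "equivariant p D n (tcoef c p)"
  unfolding equivariant_def
proof (intro allI impI)
  fix U U' i i' j j' V V'
  assume "length U = length U'" and U: "U @ i # i' # V \<in> Idx D n" and U': "U' @ j # j' # V' \<in> Idx D n"
  then show "tcoef c p (U @ i' # i # V) (U' @ j' # j # V') =
      koszul (p i) (p i') * (koszul (p j) (p j') * tcoef c p (U @ i # i' # V) (U' @ j # j' # V'))"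
  proof (induction U U' arbitrary: n rule: list_induct2)
    case Nil
    then have lt: "i < D" "i' < D" "j < D" "j' < D" by (auto simp: Idx_def)
    have "c i' j' * (c i j * tcoef c p V V') = koszul (p i + p j) (p i' + p j') * (c i j * (c i' j' * tcoef c p V V'))"
      using supercommute[OF coefs(1)[OF lt(2,4)] coefs(1)[OF lt(1,3)]]
      by (simp only: mult.assoc[symmetric]) (simp only: koszul_sym[of "p i' + p j'"])
    moreover have "koszul (p i' + p j') (p i + v) * (koszul (p i + p j) v * (koszul (p i + p j) (p i' + p j') * t)) =
        koszul (p i) (p i') * (koszul (p j) (p j') * (koszul (p i + p j) (p i' + v) * (koszul (p i' + p j') v * t)))"
      for v and t :: 'a
      by (cases "p i"; cases "p i'"; cases "p j"; cases "p j'"; cases v) (simp_all add: koszul_def)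
    ultimately show ?case
      by (simp add: koszul_def)
  next
    case (Cons x xs y ys)
    then obtain m where "n = Suc m" "xs @ i # i' # V \<in> Idx D m" "ys @ j # j' # V' \<in> Idx D m"
      by (auto simp: Idx_Cons)
    note IH = Cons.IH[OF this(2,3)]
    have "tpar p (xs @ i' # i # V) = tpar p (xs @ i # i' # V)"
      by (simp only: tpar_append tpar.simps add_ac)
    moreover have "koszul a b * (t * (koszul a1 b1 * (koszul a2 b2 * s))) =
        koszul a1 b1 * (koszul a2 b2 * (koszul a b * (t * s)))" for a b a1 b1 a2 b2 and t s :: 'a
      by (simp add: koszul_def)
    ultimately show ?case
      by (simp only: append_Cons tcoef.simps IH)
  qed
qed

definition tensor_op :: "('a \<Rightarrow> 'k) \<Rightarrow> nat \<Rightarrow> nat list \<Rightarrow> nat list \<Rightarrow> 'k" where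
  "tensor_op x n = (\<lambda>I J. if I \<in> Idx D n \<and> J \<in> Idx D n then sg (tpar p I) * x (tcoef c p I J) else 0)"

text \<open>
  The image of an even idempotent \<open>u r\<close> commuting with the coaction on a tensor power is a
  representation, with coaction matrix \<open>r C\<^sup>(\<^sup>n\<^sup>) u\<close>.
\<close>

definition image_coef :: "nat \<Rightarrow> (nat list \<Rightarrow> nat \<Rightarrow> 'k) \<Rightarrow> (nat \<Rightarrow> nat list \<Rightarrow> 'k) \<Rightarrow> nat \<Rightarrow> nat \<Rightarrow> 'a" where
  "image_coef n u r = (\<lambda>a b. \<Sum>I\<in>Idx D n. \<Sum>J\<in>Idx D n. scal G (r a I * u J b) (tcoef c p I J))"

lemma image_rep:
  fixes u :: "nat list \<Rightarrow> nat \<Rightarrow> 'k" and r :: "nat \<Rightarrow> nat list \<Rightarrow> 'k"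
  assumes u: "u \<in> even_maps (Idx D n) (tpar p) {..<length qs} ((!) qs)"
    and r: "r \<in> even_maps {..<length qs} ((!) qs) (Idx D n) (tpar p)"
    and ru: "mul (Idx D n) r u = one_on {..<length qs}"
    and comm: "\<And>I J. I \<in> Idx D n \<Longrightarrow> J \<in> Idx D n \<Longrightarrow>
      (\<Sum>K\<in>Idx D n. scal G (mul {..<length qs} u r I K) (tcoef c p K J)) =
      (\<Sum>K\<in>Idx D n. scal G (mul {..<length qs} u r K J) (tcoef c p I K))"
  shows "(qs, mat (length qs) (length qs) (\<lambda>(a, b). image_coef n u r a b)) \<in> Rep G"
proof -
  let ?d = "length qs" and ?S = "Idx D n" and ?T = "tcoef c p" and ?e = "mul {..<length qs} u r"
  define L where "L = (\<lambda>a K. \<Sum>I\<in>?S. scal G (r a I) (?T I K))"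
  define R where "R = (\<lambda>K b. \<Sum>J\<in>?S. scal G (u J b) (?T K J))"
  have imL: "image_coef n u r a b = (\<Sum>K\<in>?S. scal G (u K b) (L a K))" for a b
    unfolding image_coef_def L_def vs.scale_sum_right by (subst sum.swap) (simp add: mult.commute)
  have imR: "image_coef n u r a b = (\<Sum>K\<in>?S. scal G (r a K) (R K b))" for a b
    unfolding image_coef_def R_def vs.scale_sum_right by simp
  have Le: "(\<Sum>K\<in>?S. scal G (?e K J) (L a K)) = L a J" if J: "J \<in> ?S" and a: "a < ?d" for a J
  proof -
    have "(\<Sum>K\<in>?S. scal G (?e K J) (L a K)) = (\<Sum>I\<in>?S. scal G (r a I) (\<Sum>K\<in>?S. scal G (?e K J) (?T I K)))"
      unfolding L_def vs.scale_sum_right by (subst sum.swap) (simp add: mult.commute)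
    also have "\<dots> = (\<Sum>I\<in>?S. scal G (r a I) (\<Sum>K\<in>?S. scal G (?e I K) (?T K J)))"
      using comm J by simp
    also have "\<dots> = (\<Sum>K\<in>?S. scal G (mul ?S r ?e a K) (?T K J))"
      unfolding vs.scale_sum_right mul_def[of ?S] vs.scale_sum_left by (subst sum.swap) simp
    also have "mul ?S r ?e = r"
      unfolding mul_assoc[symmetric] ru using r by (simp add: even_maps_mul_one)
    finally show ?thesis by (simp add: L_def)
  qed
  have main: "comult G (image_coef n u r a b) \<approx> (\<Sum>l<?d. frag_of (image_coef n u r a l, image_coef n u r l b))"
    if ab: "a < ?d" "b < ?d" for a b
  proof -
    have "comult G (image_coef n u r a b) \<approx> (\<Sum>I\<in>?S. comult G (\<Sum>J\<in>?S. scal G (r a I * u J b) (?T I J)))"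
      unfolding image_coef_def by (rule comult_sum)
    also have "\<dots> \<approx> (\<Sum>I\<in>?S. \<Sum>J\<in>?S. comult G (scal G (r a I * u J b) (?T I J)))"
      by (intro teq_sum comult_sum)
    also have "\<dots> \<approx> (\<Sum>I\<in>?S. \<Sum>J\<in>?S. \<Sum>K\<in>?S. frag_of (scal G (r a I * u J b) (?T I K), ?T K J))"
      by (intro teq_sum comult_scal_simple comult_tcoef) auto
    also have "\<dots> = (\<Sum>K\<in>?S. \<Sum>I\<in>?S. \<Sum>J\<in>?S. frag_of (scal G (r a I * u J b) (?T I K), ?T K J))"
      by (subst (2) sum.swap, subst sum.swap, rule refl)
    also have "\<dots> \<approx> (\<Sum>K\<in>?S. frag_of (L a K, R K b))"
      unfolding L_def R_def by (intro teq_sum teq_sym[OF simple_bilinear])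
    finally have 1: "comult G (image_coef n u r a b) \<approx> (\<Sum>K\<in>?S. frag_of (L a K, R K b))" .
    have "(\<Sum>l<?d. frag_of (image_coef n u r a l, image_coef n u r l b)) \<approx>
        (\<Sum>l<?d. \<Sum>K\<in>?S. \<Sum>J\<in>?S. frag_of (scal G (u K l * r l J) (L a K), R J b))"
      unfolding imL[of a] imR[of _ b] by (intro teq_sum simple_bilinear)
    also have "\<dots> = (\<Sum>K\<in>?S. \<Sum>l<?d. \<Sum>J\<in>?S. frag_of (scal G (u K l * r l J) (L a K), R J b))"
      by (rule sum.swap)
    also have "\<dots> = (\<Sum>K\<in>?S. \<Sum>J\<in>?S. \<Sum>l<?d. frag_of (scal G (u K l * r l J) (L a K), R J b))"
      by (subst (2) sum.swap, rule refl)
    also have "\<dots> \<approx> (\<Sum>K\<in>?S. \<Sum>J\<in>?S. frag_of (scal G (?e K J) (L a K), R J b))"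
      unfolding mul_def by (intro teq_sum simple_scal_sum)
    also have "\<dots> = (\<Sum>J\<in>?S. \<Sum>K\<in>?S. frag_of (scal G (?e K J) (L a K), R J b))"
      by (rule sum.swap)
    also have "\<dots> \<approx> (\<Sum>J\<in>?S. frag_of (\<Sum>K\<in>?S. scal G (?e K J) (L a K), R J b))"
      by (intro teq_sum teq_sym[OF simple_sum_left])
    also have "\<dots> = (\<Sum>K\<in>?S. frag_of (L a K, R K b))"
      using Le ab by simp
    finally show ?thesis using 1 teq_sym teq_trans by blast
  qed
  have "image_coef n u r a b \<in> homog G (qs ! a + qs ! b)" for a b
    unfolding image_coef_def
  proof (intro homog_closed(6))
    fix I J assume IJ: "I \<in> ?S" "J \<in> ?S"
    show "scal G (r a I * u J b) (?T I J) \<in> homog G (qs ! a + qs ! b)"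
    proof (cases "r a I = 0 \<or> u J b = 0")
      case True
      then show ?thesis by (auto intro: homog_closed)
    next
      case False
      then have "tpar p I = qs ! a" "tpar p J = qs ! b"
        using even_mapsD[OF r, of a I] even_mapsD[OF u, of J b] by auto
      then show ?thesis using tcoef_homog[OF IJ] by (auto intro: homog_closed)
    qed
  qed
  moreover have "counit G (image_coef n u r a b) = (if a = b then 1 else 0)" if ab: "a < ?d" "b < ?d" for a b
  proof -
    have "counit G (image_coef n u r a b) = (\<Sum>I\<in>?S. \<Sum>J\<in>?S. r a I * u J b * counit G (?T I J))"
      unfolding image_coef_def counit_simps ..
    also have "\<dots> = (\<Sum>I\<in>?S. \<Sum>J\<in>?S. if J = I then r a I * u I b else 0)"
      by (intro sum.cong refl) (auto simp: counit_tcoef)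
    also have "\<dots> = mul ?S r u a b" by (simp add: mul_def)
    finally show ?thesis using ab by (simp add: ru one_on_def)
  qed
  ultimately show ?thesis
    using main by (simp add: Rep_def)
qed

lemma restrict_image:
  fixes u :: "nat list \<Rightarrow> nat \<Rightarrow> 'k" and r :: "nat \<Rightarrow> nat list \<Rightarrow> 'k"
  assumes x: "x \<in> lie_part G 1"
    and u: "u \<in> even_maps (Idx D n) (tpar p) {..<length qs} ((!) qs)"
    and r: "r \<in> even_maps {..<length qs} ((!) qs) (Idx D n) (tpar p)"
  shows "op_of (restrict_m x (qs, mat (length qs) (length qs) (\<lambda>(a, b). image_coef n u r a b))) =
    mul (Idx D n) r (mul (Idx D n) (tensor_op x n) u)"
proof (intro ext)
  fix a b
  interpret l: Vector_Spaces.linear "scal G" "(*)" x using x by (simp add: lie_part_def)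
  let ?S = "Idx D n"
  show "op_of (restrict_m x (qs, mat (length qs) (length qs) (\<lambda>(a, b). image_coef n u r a b))) a b =
      mul ?S r (mul ?S (tensor_op x n) u) a b"
  proof (cases "a < length qs \<and> b < length qs")
    case False
    then have "mul ?S r (mul ?S (tensor_op x n) u) a b = 0"
      using even_maps_zero[OF r, of a] even_maps_zero[OF u, of _ b] by (auto simp: mul_def)
    then show ?thesis using False by (auto simp: restrict_m_def entries_def)
  next
    case True
    have "op_of (restrict_m x (qs, mat (length qs) (length qs) (\<lambda>(a, b). image_coef n u r a b))) a b =
        sg (qs ! a) * x (image_coef n u r a b)"
      using True by (simp add: restrict_m_def entries_def koszul_sg)
    also have "\<dots> = (\<Sum>I\<in>?S. \<Sum>J\<in>?S. sg (qs ! a) * (r a I * u J b * x (tcoef c p I J)))"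
      by (simp add: image_coef_def l.sum l.scale sum_distrib_left)
    also have "\<dots> = (\<Sum>I\<in>?S. \<Sum>J\<in>?S. r a I * (tensor_op x n I J * u J b))"
    proof (intro sum.cong refl)
      fix I J assume "I \<in> ?S" "J \<in> ?S"
      then show "sg (qs ! a) * (r a I * u J b * x (tcoef c p I J)) = r a I * (tensor_op x n I J * u J b)"
        using even_mapsD[OF r, of a I] by (cases "r a I = 0") (auto simp: tensor_op_def)
    qed
    also have "\<dots> = mul ?S r (mul ?S (tensor_op x n) u) a b"
      by (simp add: mul_def sum_distrib_left)
    finally show ?thesis .
  qed
qed

end

section \<open>Negligible endomorphisms form a tensor ideal\<close>

definition tens :: "('i \<Rightarrow> 'j \<Rightarrow> 'k::mult_zero) \<Rightarrow> ('i list \<Rightarrow> 'j list \<Rightarrow> 'k) \<Rightarrow> 'i list \<Rightarrow> 'j list \<Rightarrow> 'k" where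
  "tens g f = (\<lambda>I J. case I of [] \<Rightarrow> 0 | i # I' \<Rightarrow> (case J of [] \<Rightarrow> 0 | j # J' \<Rightarrow> g i j * f I' J'))"

primrec tpow :: "('i \<Rightarrow> 'i \<Rightarrow> 'k::semiring_1) \<Rightarrow> nat \<Rightarrow> 'i list \<Rightarrow> 'i list \<Rightarrow> 'k" where
  "tpow f 0 = one_on {[]}"
| "tpow f (Suc n) = tens f (tpow f n)"

text \<open>The odd operator on the \<open>n\<close>-th tensor power, given by the super Leibniz rule.\<close>

primrec leibniz :: "(nat \<Rightarrow> nat \<Rightarrow> 'k::comm_ring_1) \<Rightarrow> (nat \<Rightarrow> bit) \<Rightarrow> nat \<Rightarrow> nat \<Rightarrow> nat list \<Rightarrow> nat list \<Rightarrow> 'k" where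
  "leibniz X p D 0 = (\<lambda>I J. 0)"
| "leibniz X p D (Suc n) = (\<lambda>I J. tens X (one_on (Idx D n)) I J +
     tens (\<lambda>i j. sg (p i) * one_on {..<D} i j) (leibniz X p D n) I J)"

lemma tens_Cons [simp]: "tens g f (i # I) (j # J) = g i j * f I J"
  and tens_Nil [simp]: "tens g f [] J = 0" "tens g f I [] = 0"
  by (auto simp: tens_def split: list.split)

lemma tens_nonzero:
  assumes "tens g f I J \<noteq> (0 :: 'k::mult_zero)"
  obtains i I' j J' where "I = i # I'" "J = j # J'" "g i j \<noteq> 0" "f I' J' \<noteq> 0"
  using assms that by (cases I; cases J) (auto, metis mult_zero_left mult_zero_right)

lemma even_maps_tens:
  fixes g :: "nat \<Rightarrow> nat \<Rightarrow> 'k::mult_zero"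
  assumes "g \<in> even_maps {..<D} p {..<D} p" "f \<in> even_maps (Idx D n) (tpar p) (Idx D n) (tpar p)"
  shows "tens g f \<in> even_maps (Idx D (Suc n)) (tpar p) (Idx D (Suc n)) (tpar p)"
  unfolding even_maps_def
proof (intro CollectI allI impI)
  fix I J assume "tens g f I J \<noteq> 0"
  then obtain i I' j J' where "I = i # I'" "J = j # J'" "g i j \<noteq> 0" "f I' J' \<noteq> 0"
    by (rule tens_nonzero)
  then show "I \<in> Idx D (Suc n) \<and> J \<in> Idx D (Suc n) \<and> tpar p I = tpar p J"
    using even_mapsD[OF assms(1), of i j] even_mapsD[OF assms(2), of I' J']
    by (simp only: Idx_Cons tpar.simps) auto
qed

lemma even_maps_tpow:
  fixes f :: "nat \<Rightarrow> nat \<Rightarrow> 'k::semiring_1"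
  assumes "f \<in> even_maps {..<D} p {..<D} p"
  shows "tpow f n \<in> even_maps (Idx D n) (tpar p) (Idx D n) (tpar p)"
proof (induction n)
  case 0
  show ?case by (simp add: Idx_0 even_maps_one)
qed (simp add: even_maps_tens assms)

lemma mul_tens:
  fixes g :: "nat \<Rightarrow> nat \<Rightarrow> 'k::comm_semiring_1"
  shows "mul (Idx D (Suc n)) (tens g f) (tens g' f') = tens (mul {..<D} g g') (mul (Idx D n) f f')"
proof (intro ext)
  fix I J
  show "mul (Idx D (Suc n)) (tens g f) (tens g' f') I J = tens (mul {..<D} g g') (mul (Idx D n) f f') I J"
  proof (cases I; cases J)
    fix i I' j J' assume "I = i # I'" "J = j # J'"
    then show ?thesis
      by (simp add: mul_def sum_Idx_Suc sum_product mult_ac)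
  qed (auto simp: mul_def)
qed

lemma tpow_mul:
  fixes f :: "nat \<Rightarrow> nat \<Rightarrow> 'k::comm_semiring_1"
  shows "tpow (mul {..<D} f g) n = mul (Idx D n) (tpow f n) (tpow g n)"
proof (induction n)
  case 0
  show ?case by (intro ext) (simp add: Idx_0 mul_def one_on_def)
qed (simp add: mul_tens)

lemma tens_one: "tens (one_on {..<D}) (one_on (Idx D n)) = (one_on (Idx D (Suc n)) :: _ \<Rightarrow> _ \<Rightarrow> 'k::semiring_1)"
proof (intro ext)
  fix I J :: "nat list"
  show "tens (one_on {..<D}) (one_on (Idx D n)) I J = (one_on (Idx D (Suc n)) I J :: 'k)"
    by (cases I; cases J) (auto simp: one_on_def Idx_Cons, auto simp: Idx_def)
qed

lemma tpow_zero:
  fixes f :: "nat \<Rightarrow> nat \<Rightarrow> 'k::semiring_1"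
  assumes "\<And>j. f m j = 0" "m \<in> set I"
  shows "tpow f n I J = 0"
  using assms(2)
proof (induction n arbitrary: I J)
  case (Suc n)
  then show ?case
    using assms(1) by (cases I; cases J) auto
qed (auto simp: one_on_def)

lemma equivariant_tpow:
  fixes f :: "nat \<Rightarrow> nat \<Rightarrow> 'k::comm_ring_1"
  assumes "f \<in> even_maps {..<D} p {..<D} p"
  shows "equivariant p D n (tpow f n)"
  unfolding equivariant_def
proof (intro allI impI)
  fix U U' i i' j j' V V'
  assume "length U = length U'" and U: "U @ i # i' # V \<in> Idx D n" and U': "U' @ j # j' # V' \<in> Idx D n"
  then show "tpow f n (U @ i' # i # V) (U' @ j' # j # V') =
      koszul (p i) (p i') * (koszul (p j) (p j') * tpow f n (U @ i # i' # V) (U' @ j # j' # V'))"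
  proof (induction U U' arbitrary: n rule: list_induct2)
    case Nil
    then obtain m where m: "n = Suc (Suc m)" by (auto simp: Idx_Cons)
    show ?case
    proof (cases "f i j = 0 \<or> f i' j' = 0")
      case True
      then show ?thesis by (auto simp: m)
    next
      case False
      then have "p i = p j" "p i' = p j'" using assms by (auto dest: even_mapsD)
      then show ?thesis by (simp add: m mult_ac)
    qed
  next
    case (Cons x xs y ys)
    then obtain m where "n = Suc m" "xs @ i # i' # V \<in> Idx D m" "ys @ j # j' # V' \<in> Idx D m"
      by (auto simp: Idx_Cons)
    with Cons.IH[OF this(2,3)] show ?case by (simp add: mult_ac)
  qed
qed

lemma negl_mul:
  fixes f :: "'i \<Rightarrow> 'i \<Rightarrow> 'k::ring_1"
  assumes "negl S p X f" "g \<in> endos S p X"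
  shows "negl S p X (mul S f g)"
  using assms maps_mul[OF assms(2)] maps_mul[of _ S p X S p X f] unfolding negl_def
  by (metis mul_assoc maps_mul)

lemma negl_add:
  fixes f :: "'i \<Rightarrow> 'i \<Rightarrow> 'k::comm_ring_1"
  assumes "negl S p X f" "negl S p X g"
  shows "negl S p X (\<lambda>i j. f i j + g i j)"
proof -
  have z: "(\<lambda>i j. 0 - g i j) \<in> endos S p X"
    using assms by (intro maps_diff) (auto simp: negl_def maps_def even_maps_def)
  have "(\<lambda>i j. f i j - (0 - g i j)) \<in> endos S p X"
    using assms by (intro maps_diff z) (auto simp: negl_def)
  moreover have "str S p (mul S (\<lambda>i j. f i j + g i j) h) = str S p (mul S f h) + str S p (mul S g h)" for h
    by (simp add: str_def mul_def distrib_left distrib_right sum.distrib)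
  ultimately show ?thesis using assms by (simp add: negl_def)
qed

context
  fixes X :: "nat \<Rightarrow> nat \<Rightarrow> 'k::comm_ring_1" and p :: "nat \<Rightarrow> bit" and D :: nat
  assumes X: "\<And>i j. X i j \<noteq> 0 \<Longrightarrow> i < D \<and> j < D \<and> p i \<noteq> p j"
begin

private abbreviation (input) "S \<equiv> Idx D"
private abbreviation (input) "L \<equiv> leibniz X p D"
private abbreviation (input) "ends n \<equiv> endos (S n) (tpar p) (L n)"
private abbreviation (input) "ngl n \<equiv> negl (S n) (tpar p) (L n)"

lemma leibniz_odd:
  "L n I J \<noteq> 0 \<Longrightarrow> I \<in> S n \<and> J \<in> S n \<and> tpar p I \<noteq> tpar p J"
proof (induction n arbitrary: I J)
  case (Suc n)
  obtain i I' j J' where eq: "I = i # I'" "J = j # J'"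
    using Suc.prems by (cases I; cases J) auto
  then consider "X i j \<noteq> 0" "I' = J'" "I' \<in> S n" | "i = j" "i < D" "L n I' J' \<noteq> 0"
    using Suc.prems by (cases "L n I' J' = 0"; cases "X i j = 0")
      (auto simp: one_on_def split: if_splits)
  then show ?case
  proof cases
    case 1
    then show ?thesis using X[of i j] by (simp only: eq Idx_Cons tpar.simps add_right_cancel) auto
  next
    case 2
    then show ?thesis using Suc.IH[of I' J'] by (simp only: eq Idx_Cons tpar.simps add_left_cancel) auto
  qed
qed simp

text \<open>
  One entry of the commutation relation with \<open>X \<otimes> 1 + \<Gamma> \<otimes> X\<^sub>n\<close>, where the grading operator \<open>\<Gamma>\<close> accounts
  for the sign of moving the odd operator past the first tensor factor.
\<close>

lemma leibniz_commute:
  fixes h :: "nat list \<Rightarrow> nat list \<Rightarrow> 'k"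
  assumes comm: "mul (S (Suc n)) h (L (Suc n)) = mul (S (Suc n)) (L (Suc n)) h"
    and lt: "i < D" "k < D" "I \<in> S n" "K \<in> S n"
  shows "(\<Sum>j<D. X i j * h (j # I) (k # K)) + sg (p i) * (\<Sum>J\<in>S n. L n I J * h (i # J) (k # K)) =
    (\<Sum>j<D. h (i # I) (j # K) * X j k) + sg (p k) * (\<Sum>J\<in>S n. h (i # I) (k # J) * L n J K)"
proof -
  have "mul (S (Suc n)) (L (Suc n)) h (i # I) (k # K) =
      (\<Sum>j<D. \<Sum>J\<in>S n. (if J = I then X i j * h (j # I) (k # K) else 0)) +
      (\<Sum>j<D. \<Sum>J\<in>S n. (if j = i then sg (p i) * (L n I J * h (i # J) (k # K)) else 0))"
    unfolding mul_def sum_Idx_Suc sum.distrib[symmetric] using lt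
    by (intro sum.cong refl) (auto simp: one_on_def algebra_simps)
  also have "\<dots> = (\<Sum>j<D. X i j * h (j # I) (k # K)) +
      (\<Sum>J\<in>S n. \<Sum>j<D. (if j = i then sg (p i) * (L n I J * h (i # J) (k # K)) else 0))"
    using lt by (subst (3) sum.swap) simp
  finally have 1: "mul (S (Suc n)) (L (Suc n)) h (i # I) (k # K) =
      (\<Sum>j<D. X i j * h (j # I) (k # K)) + sg (p i) * (\<Sum>J\<in>S n. L n I J * h (i # J) (k # K))"
    using lt by (simp add: sum_distrib_left)
  have "mul (S (Suc n)) h (L (Suc n)) (i # I) (k # K) =
      (\<Sum>j<D. \<Sum>J\<in>S n. (if J = K then h (i # I) (j # K) * X j k else 0)) +
      (\<Sum>j<D. \<Sum>J\<in>S n. (if j = k then sg (p k) * (h (i # I) (k # J) * L n J K) else 0))"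
    unfolding mul_def sum_Idx_Suc sum.distrib[symmetric] using lt
    by (intro sum.cong refl) (auto simp: one_on_def algebra_simps)
  also have "\<dots> = (\<Sum>j<D. h (i # I) (j # K) * X j k) +
      (\<Sum>J\<in>S n. \<Sum>j<D. (if j = k then sg (p k) * (h (i # I) (k # J) * L n J K) else 0))"
    using lt by (subst (3) sum.swap) simp
  finally have 2: "mul (S (Suc n)) h (L (Suc n)) (i # I) (k # K) =
      (\<Sum>j<D. h (i # I) (j # K) * X j k) + sg (p k) * (\<Sum>J\<in>S n. h (i # I) (k # J) * L n J K)"
    using lt by (simp add: sum_distrib_left)
  show ?thesis using comm 1 2 by (simp add: fun_eq_iff)
qed

lemma leibniz_commuteI:
  fixes g :: "nat \<Rightarrow> nat \<Rightarrow> 'k"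
  assumes g: "g \<in> endos {..<D} p X"
  shows "tens g (one_on (S n)) \<in> ends (Suc n)"
proof -
  have gev: "g \<in> even_maps {..<D} p {..<D} p" and gX: "mul {..<D} g X = mul {..<D} X g"
    using g by (auto simp: maps_def)
  let ?sg = "\<lambda>i j. sg (p i) * one_on {..<D} i j :: 'k"
  have L: "L n \<in> square_maps (S n)"
    using leibniz_odd by (auto simp: even_maps_def)
  have gs: "mul {..<D} g ?sg = mul {..<D} ?sg g"
    by (rule even_commutes_with_grading[OF finite_lessThan gev])
  have plus: "mul S f (\<lambda>i j. a i j + b i j) = (\<lambda>i j. mul S f a i j + mul S f b i j)"
    "mul S (\<lambda>i j. a i j + b i j) f = (\<lambda>i j. mul S a f i j + mul S b f i j)"
    for S and f a b :: "nat list \<Rightarrow> nat list \<Rightarrow> 'k"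
    by (simp_all add: mul_def distrib_left distrib_right sum.distrib)
  have "mul (S (Suc n)) (tens g (one_on (S n))) (L (Suc n)) =
      mul (S (Suc n)) (L (Suc n)) (tens g (one_on (S n)))"
    unfolding leibniz.simps plus mul_tens
    by (simp add: gX gs even_maps_mul_one[OF L] even_maps_mul_one[OF even_maps_one])
  then show ?thesis
    using even_maps_tens[OF gev even_maps_one] by (simp add: maps_def)
qed

text \<open>
  Supertraces over one tensor factor turn endomorphisms of the tensor product into endomorphisms of
  the other factor, so tensoring a negligible endomorphism with an identity keeps it negligible.
\<close>

lemma negl_tens_one:
  fixes f :: "nat \<Rightarrow> nat \<Rightarrow> 'k"
  assumes f: "negl {..<D} p X f"
  shows "ngl (Suc n) (tens f (one_on (S n)))"
  unfolding negl_def
proof (intro conjI ballI)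
  show "tens f (one_on (S n)) \<in> ends (Suc n)"
    using f by (intro leibniz_commuteI) (simp_all add: negl_def)
  fix h assume h: "h \<in> ends (Suc n)"
  then have hev: "h \<in> even_maps (S (Suc n)) (tpar p) (S (Suc n)) (tpar p)"
    and comm: "mul (S (Suc n)) h (L (Suc n)) = mul (S (Suc n)) (L (Suc n)) h"
    by (auto simp: maps_def)
  (* the supertrace of h over the second tensor factor *)
  define k where "k = (\<lambda>i j. \<Sum>I\<in>S n. sg (tpar p I) * h (i # I) (j # I))"
  have kev: "k \<in> even_maps {..<D} p {..<D} p"
    unfolding even_maps_def
  proof (intro CollectI allI impI)
    fix i j assume "k i j \<noteq> 0"
    then obtain I where "h (i # I) (j # I) \<noteq> 0"
      unfolding k_def by (metis (no_types, lifting) mult_zero_right sum.neutral)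
    from even_mapsD[OF hev this] show "i \<in> {..<D} \<and> j \<in> {..<D} \<and> p i = p j"
      by (simp only: Idx_Cons tpar.simps add_right_cancel) auto
  qed
  have "mul {..<D} k X i l = mul {..<D} X k i l" for i l
  proof (cases "i < D \<and> l < D")
    case False
    then have "X i j = 0 \<or> k j l = 0" "k i j = 0 \<or> X j l = 0" for j
      using X[of i j] X[of j l] even_mapsD[OF kev, of i j] even_mapsD[OF kev, of j l] by blast+
    then have "X i j * k j l = 0" "k i j * X j l = 0" for j by (metis mult_zero_left mult_zero_right)+
    then show ?thesis by (simp add: mul_def)
  next
    case True
    have "(\<Sum>I\<in>S n. sg (tpar p I) * ((\<Sum>j<D. X i j * h (j # I) (l # I)) + sg (p i) * (\<Sum>J\<in>S n. L n I J * h (i # J) (l # I)))) =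
      (\<Sum>I\<in>S n. sg (tpar p I) * ((\<Sum>j<D. h (i # I) (j # I) * X j l) + sg (p l) * (\<Sum>J\<in>S n. h (i # I) (l # J) * L n J I)))"
      using leibniz_commute[OF comm] True by (intro sum.cong refl) simp
    moreover have "(\<Sum>I\<in>S n. sg (tpar p I) * (sg (p i) * (\<Sum>J\<in>S n. L n I J * h (i # J) (l # I)))) =
      (\<Sum>I\<in>S n. sg (tpar p I) * (sg (p l) * (\<Sum>J\<in>S n. h (i # I) (l # J) * L n J I)))"
    proof -
      have "(\<Sum>I\<in>S n. sg (tpar p I) * (sg (p l) * (\<Sum>J\<in>S n. h (i # I) (l # J) * L n J I))) =
          (\<Sum>J\<in>S n. \<Sum>I\<in>S n. sg (tpar p I) * (sg (p l) * (h (i # I) (l # J) * L n J I)))"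
        unfolding sum_distrib_left by (rule sum.swap)
      also have "\<dots> = (\<Sum>I\<in>S n. \<Sum>J\<in>S n. sg (tpar p I) * (sg (p i) * (L n I J * h (i # J) (l # I))))"
      proof (intro sum.cong refl)
        fix I J
        show "sg (tpar p J) * (sg (p l) * (h (i # J) (l # I) * L n I J)) =
            sg (tpar p I) * (sg (p i) * (L n I J * h (i # J) (l # I)))"
        proof (cases "L n I J = 0 \<or> h (i # J) (l # I) = 0")
          case False
          then have a: "tpar p I \<noteq> tpar p J" using leibniz_odd[of n I J] by simp
          have b: "p i + tpar p J = p l + tpar p I"
            using even_mapsD[OF hev, of "i # J" "l # I"] False by (simp only: tpar.simps) blast
          have "sg (tpar p J) * sg (p l) = (sg (tpar p I) * sg (p i) :: 'k)"
            using a b by (cases "tpar p I"; cases "tpar p J"; cases "p i"; cases "p l") simp_all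
          then have "sg (tpar p J) * sg (p l) * (h (i # J) (l # I) * L n I J) =
              sg (tpar p I) * sg (p i) * (h (i # J) (l # I) * L n I J)" by simp
          then show ?thesis by (simp only: mult_ac)
        qed auto
      qed
      finally show ?thesis by (simp add: sum_distrib_left)
    qed
    ultimately have "(\<Sum>I\<in>S n. sg (tpar p I) * (\<Sum>j<D. X i j * h (j # I) (l # I))) =
        (\<Sum>I\<in>S n. sg (tpar p I) * (\<Sum>j<D. h (i # I) (j # I) * X j l))"
      by (simp add: distrib_left sum.distrib)
    moreover have "(\<Sum>I\<in>S n. sg (tpar p I) * (\<Sum>j<D. X i j * h (j # I) (l # I))) = mul {..<D} X k i l"
      unfolding mul_def k_def sum_distrib_left by (subst sum.swap) (simp add: mult_ac)
    moreover have "(\<Sum>I\<in>S n. sg (tpar p I) * (\<Sum>j<D. h (i # I) (j # I) * X j l)) = mul {..<D} k X i l"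
      unfolding mul_def k_def sum_distrib_left sum_distrib_right by (subst sum.swap) (simp add: mult_ac)
    ultimately show ?thesis by simp
  qed
  then have k: "k \<in> endos {..<D} p X"
    using kev by (simp add: maps_def fun_eq_iff)
  have "str (S (Suc n)) (tpar p) (mul (S (Suc n)) (tens f (one_on (S n))) h) =
      (\<Sum>i<D. \<Sum>I\<in>S n. \<Sum>j<D. \<Sum>J\<in>S n. if J = I then sg (p i) * (sg (tpar p I) * (f i j * h (j # I) (i # I))) else 0)"
    unfolding str_def mul_def sum_Idx_Suc sum_distrib_left
    by (intro sum.cong refl) (auto simp: one_on_def tpar.simps sg_add mult.assoc simp del: add_bit_eq_xor)
  also have "\<dots> = (\<Sum>i<D. \<Sum>j<D. \<Sum>I\<in>S n. sg (p i) * (sg (tpar p I) * (f i j * h (j # I) (i # I))))"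
    by (intro sum.cong refl, subst sum.swap) simp
  also have "\<dots> = str {..<D} p (mul {..<D} f k)"
    by (simp add: str_def mul_def k_def sum_distrib_left mult_ac)
  finally show "str (S (Suc n)) (tpar p) (mul (S (Suc n)) (tens f (one_on (S n))) h) = 0"
    using f k by (simp add: negl_def)
qed

lemma negl_one_tens:
  fixes f :: "nat list \<Rightarrow> nat list \<Rightarrow> 'k"
  assumes f: "ngl n f"
  shows "ngl (Suc n) (tens (one_on {..<D}) f)"
  unfolding negl_def
proof (intro conjI ballI)
  have fev: "f \<in> even_maps (S n) (tpar p) (S n) (tpar p)" and fL: "mul (S n) f (L n) = mul (S n) (L n) f"
    using f by (auto simp: negl_def maps_def)
  let ?sg = "\<lambda>i j. sg (p i) * one_on {..<D} i j :: 'k"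
  have sgm: "?sg \<in> square_maps {..<D}" and Xm: "X \<in> square_maps {..<D}"
    using X by (auto simp: even_maps_def one_on_def)
  have plus: "mul S f (\<lambda>i j. a i j + b i j) = (\<lambda>i j. mul S f a i j + mul S f b i j)"
    "mul S (\<lambda>i j. a i j + b i j) f = (\<lambda>i j. mul S a f i j + mul S b f i j)"
    for S and f a b :: "nat list \<Rightarrow> nat list \<Rightarrow> 'k"
    by (simp_all add: mul_def distrib_left distrib_right sum.distrib)
  have "mul (S (Suc n)) (tens (one_on {..<D}) f) (L (Suc n)) =
      mul (S (Suc n)) (L (Suc n)) (tens (one_on {..<D}) f)"
    unfolding leibniz.simps plus mul_tens
    by (simp add: fL even_maps_mul_one[OF fev] even_maps_mul_one[OF sgm] even_maps_mul_one[OF Xm])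
  then show "tens (one_on {..<D}) f \<in> ends (Suc n)"
    using even_maps_tens[OF even_maps_one fev] by (simp add: maps_def)
  fix h assume h: "h \<in> ends (Suc n)"
  then have hev: "h \<in> even_maps (S (Suc n)) (tpar p) (S (Suc n)) (tpar p)"
    and comm: "mul (S (Suc n)) h (L (Suc n)) = mul (S (Suc n)) (L (Suc n)) h"
    by (auto simp: maps_def)
  (* the supertrace of h over the first tensor factor *)
  define k where "k = (\<lambda>I J. \<Sum>i<D. sg (p i) * h (i # I) (i # J))"
  have kev: "k \<in> even_maps (S n) (tpar p) (S n) (tpar p)"
    unfolding even_maps_def
  proof (intro CollectI allI impI)
    fix I J assume "k I J \<noteq> 0"
    then obtain i where "h (i # I) (i # J) \<noteq> 0"
      unfolding k_def by (metis (no_types, lifting) mult_zero_right sum.neutral)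
    from even_mapsD[OF hev this] show "I \<in> S n \<and> J \<in> S n \<and> tpar p I = tpar p J"
      by (simp only: Idx_Cons tpar.simps add_left_cancel) auto
  qed
  have "mul (S n) k (L n) I K = mul (S n) (L n) k I K" for I K
  proof (cases "I \<in> S n \<and> K \<in> S n")
    case False
    then have "L n I J = 0 \<or> k J K = 0" "k I J = 0 \<or> L n J K = 0" for J
      using leibniz_odd[of n I J] leibniz_odd[of n J K]
        even_mapsD[OF kev, of I J] even_mapsD[OF kev, of J K] by blast+
    then have "L n I J * k J K = 0" "k I J * L n J K = 0" for J by (metis mult_zero_left mult_zero_right)+
    then show ?thesis by (simp add: mul_def)
  next
    case True
    have "(\<Sum>i<D. (\<Sum>j<D. X i j * h (j # I) (i # K)) + sg (p i) * (\<Sum>J\<in>S n. L n I J * h (i # J) (i # K))) =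
      (\<Sum>i<D. (\<Sum>j<D. h (i # I) (j # K) * X j i) + sg (p i) * (\<Sum>J\<in>S n. h (i # I) (i # J) * L n J K))"
      using leibniz_commute[OF comm] True by (intro sum.cong refl) simp
    moreover have "(\<Sum>i<D. \<Sum>j<D. X i j * h (j # I) (i # K)) = (\<Sum>i<D. \<Sum>j<D. h (i # I) (j # K) * X j i)"
      by (subst sum.swap) (simp add: mult.commute)
    ultimately have "(\<Sum>i<D. sg (p i) * (\<Sum>J\<in>S n. L n I J * h (i # J) (i # K))) =
        (\<Sum>i<D. sg (p i) * (\<Sum>J\<in>S n. h (i # I) (i # J) * L n J K))"
      by (simp add: sum.distrib)
    moreover have "(\<Sum>i<D. sg (p i) * (\<Sum>J\<in>S n. L n I J * h (i # J) (i # K))) = mul (S n) (L n) k I K"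
      unfolding mul_def k_def sum_distrib_left by (subst sum.swap) (simp add: mult_ac)
    moreover have "(\<Sum>i<D. sg (p i) * (\<Sum>J\<in>S n. h (i # I) (i # J) * L n J K)) = mul (S n) k (L n) I K"
      unfolding mul_def k_def sum_distrib_left sum_distrib_right by (subst sum.swap) (simp add: mult_ac)
    ultimately show ?thesis by simp
  qed
  then have k: "k \<in> ends n"
    using kev by (simp add: maps_def fun_eq_iff)
  have "str (S (Suc n)) (tpar p) (mul (S (Suc n)) (tens (one_on {..<D}) f) h) =
      (\<Sum>i<D. \<Sum>I\<in>S n. \<Sum>j<D. \<Sum>J\<in>S n. if j = i then sg (p i) * (sg (tpar p I) * (f I J * h (i # J) (i # I))) else 0)"
    unfolding str_def mul_def sum_Idx_Suc sum_distrib_left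
    by (intro sum.cong refl) (auto simp: one_on_def tpar.simps sg_add mult.assoc simp del: add_bit_eq_xor)
  also have "\<dots> = (\<Sum>i<D. \<Sum>I\<in>S n. \<Sum>J\<in>S n. \<Sum>j<D. if j = i then sg (p i) * (sg (tpar p I) * (f I J * h (i # J) (i # I))) else 0)"
    by (intro sum.cong refl, rule sum.swap)
  also have "\<dots> = (\<Sum>i<D. \<Sum>I\<in>S n. \<Sum>J\<in>S n. sg (p i) * (sg (tpar p I) * (f I J * h (i # J) (i # I))))"
    by (intro sum.cong refl) simp
  also have "\<dots> = (\<Sum>I\<in>S n. \<Sum>J\<in>S n. \<Sum>i<D. sg (p i) * (sg (tpar p I) * (f I J * h (i # J) (i # I))))"
    by (subst sum.swap, intro sum.cong refl, rule sum.swap)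
  also have "\<dots> = str (S n) (tpar p) (mul (S n) f k)"
    by (simp add: str_def mul_def k_def sum_distrib_left mult_ac)
  finally show "str (S (Suc n)) (tpar p) (mul (S (Suc n)) (tens (one_on {..<D}) f) h) = 0"
    using f k by (simp add: negl_def)
qed

text \<open>
  The difference telescopes into tensor products of \<open>\<pi>\<close>, \<open>\<nu>\<close> and identities having one factor \<open>\<nu>\<close>.
\<close>

lemma negl_one_minus_tpow:
  fixes \<nu> :: "nat \<Rightarrow> nat \<Rightarrow> 'k"
  assumes \<nu>: "negl {..<D} p X \<nu>"
  defines "\<pi> \<equiv> \<lambda>i j. one_on {..<D} i j - \<nu> i j"
  shows "ngl n (\<lambda>I J. one_on (S n) I J - tpow \<pi> n I J)"
proof (induction n)
  case 0
  show ?case by (simp add: Idx_0 negl_def maps_def even_maps_def str_def)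
next
  case (Suc n)
  have Xm: "X \<in> square_maps {..<D}" using X by (auto simp: even_maps_def)
  have \<pi>: "\<pi> \<in> endos {..<D} p X"
    unfolding \<pi>_def using \<nu> by (intro maps_diff maps_one Xm) (auto simp: negl_def)
  then have \<pi>ev: "\<pi> \<in> even_maps {..<D} p {..<D} p" by (simp add: maps_def)
  let ?d = "\<lambda>I J. one_on (S n) I J - tpow \<pi> n I J"
  have dev: "?d \<in> even_maps (S n) (tpar p) (S n) (tpar p)"
    by (intro even_maps_diff even_maps_one even_maps_tpow \<pi>ev)
  have "one_on (S (Suc n)) I J - tpow \<pi> (Suc n) I J = tens \<nu> (one_on (S n)) I J +
      mul (S (Suc n)) (tens (one_on {..<D}) ?d) (tens \<pi> (one_on (S n))) I J" for I J
    unfolding tens_one[symmetric] mul_tens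
    by (cases I; cases J) (simp_all add: even_maps_mul_one[OF dev] even_maps_mul_one[OF \<pi>ev],
      simp add: \<pi>_def algebra_simps)
  moreover have "ngl (Suc n) (\<lambda>I J. tens \<nu> (one_on (S n)) I J +
      mul (S (Suc n)) (tens (one_on {..<D}) ?d) (tens \<pi> (one_on (S n))) I J)"
    by (intro negl_add negl_tens_one negl_mul negl_one_tens leibniz_commuteI \<nu> \<pi> Suc.IH)
  ultimately show ?case by simp
qed

end

section \<open>A representation whose support misses \<open>x\<close>\<close>

lemma tpar_mset: "tpar p I = (\<Sum>i\<in>#mset I. p i)"
  by (induction I) (simp_all only: tpar.simps mset.simps image_mset_add_mset image_mset_empty
    sum_mset.empty sum_mset.add_mset)

lemma restrict_Rep_m:
  assumes "x \<in> lie_part G 1" "M \<in> Rep G"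
  shows "restrict_m x M \<in> Rep_m"
proof -
  have "x (snd M $$ (i, j)) = 0" if "i < length (fst M)" "j < length (fst M)" "fst M ! i = fst M ! j" for i j
  proof -
    have "snd M $$ (i, j) \<in> homog G (fst M ! i + fst M ! j)"
      using assms(2) that unfolding Rep_def case_prod_unfold mem_Collect_eq by blast
    then have "snd M $$ (i, j) \<in> homog G (1 + 1)"
      unfolding that(3) by simp
    then show ?thesis using assms(1) unfolding lie_part_def by blast
  qed
  then show ?thesis by (auto simp: Rep_m_def restrict_m_def)
qed

text \<open>
  An endomorphism \<open>g\<close> of the image of an idempotent \<open>e = u r\<close> has the supertrace of \<open>u g r = e u g r\<close>, which
  vanishes if \<open>e\<close> is negligible.
\<close>

lemma str_on_negligible_image:
  fixes X :: "'i \<Rightarrow> 'i \<Rightarrow> 'k::comm_ring_1" and Y :: "'j \<Rightarrow> 'j \<Rightarrow> 'k"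
  assumes fin: "finite T" and u: "u \<in> even_maps S p T q" and r: "r \<in> even_maps T q S p"
    and ru: "mul S r u = one_on T" and Y: "Y = mul S r (mul S X u)"
    and e: "negl S p X (mul T u r)" and g: "g \<in> endos T q Y"
  shows "str T q g = 0"
proof -
  let ?e = "mul T u r"
  have eX: "mul S ?e X = mul S X ?e" using e by (simp add: negl_def maps_def)
  have gev: "g \<in> even_maps T q T q" using g by (simp add: maps_def)
  have "mul T u Y = mul S (mul S ?e X) u" unfolding Y by (simp add: mul_assoc)
  also have "\<dots> = mul S X (mul T u (mul S r u))" unfolding eX by (simp add: mul_assoc)
  finally have um: "u \<in> maps T q Y S p X"
    using u fin by (simp add: ru maps_def even_maps_mul_one[OF u])
  have "mul T Y r = mul S r (mul S X ?e)" unfolding Y by (simp add: mul_assoc)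
  also have "\<dots> = mul T (mul S r u) (mul S r X)" unfolding eX[symmetric] by (simp add: mul_assoc)
  also have "\<dots> = mul S r X" using fin unfolding ru mul_assoc[symmetric] by (simp add: even_maps_mul_one[OF r])
  finally have rm: "r \<in> maps S p X T q Y" using r by (simp add: maps_def)
  define H where "H = mul T u (mul T g r)"
  have H: "H \<in> endos S p X"
    unfolding H_def by (rule maps_mul[OF maps_mul[OF rm g] um])
  have "mul S ?e H = mul T u (mul T (mul S r u) (mul T g r))"
    unfolding H_def by (simp add: mul_assoc)
  also have "mul T (mul S r u) (mul T g r) = mul T g r"
    unfolding ru using fin by (simp add: even_maps_mul_one[OF even_maps_mul[OF gev r]])
  finally have eH: "mul S ?e H = H" by (simp add: H_def)
  have "str T q g = str T q (mul S (mul T g r) u)"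
    using fin unfolding mul_assoc ru by (simp add: even_maps_mul_one[OF gev])
  also have "\<dots> = str S p H"
    unfolding H_def using even_maps_mul[OF gev r] u by (intro str_mul_commute)
  also have "\<dots> = str S p (mul S ?e H)" unfolding eH ..
  also have "\<dots> = 0" using e H by (simp add: negl_def)
  finally show ?thesis .
qed

context super_rep
begin

interpretation vs: Vector_Spaces.vector_space "scal G"
  by (rule vector_space)

definition X1 :: "('a \<Rightarrow> 'k) \<Rightarrow> nat \<Rightarrow> nat \<Rightarrow> 'k" where
  "X1 x = op_of (restrict_m x (ps, C))"

lemma X1_eq: "X1 x i j = (if i < D \<and> j < D then sg (p i) * x (c i j) else 0)"
  by (simp add: X1_def restrict_m_def entries_def D_def p_def c_def koszul_sg)

text \<open>
  Since \<open>x\<close> is a point derivation, only the summands \<open>x(c\<^sub>i\<^sub>j) \<epsilon>(C\<^sub>I\<^sub>J)\<close> and \<open>\<epsilon>(c\<^sub>i\<^sub>j) x(C\<^sub>I\<^sub>J)\<close> survive. In the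
  second one the parity of \<open>e\<^sub>i\<close> in the sign with which \<open>x\<close> acts becomes the grading operator of the first
  factor.
\<close>

lemma tensor_op_leibniz:
  assumes x: "x \<in> lie_part G 1"
  shows "tensor_op x n = leibniz (X1 x) p D n"
proof (induction n)
  case 0
  have "x (1 * 1) = x 1 * counit G 1 + counit G 1 * x 1"
    using x unfolding lie_part_def by blast
  then have "x 1 = 0" by (simp add: counit_one)
  then show ?case by (intro ext) (simp add: tensor_op_def Idx_0)
next
  case (Suc n)
  interpret l: Vector_Spaces.linear "scal G" "(*)" x using x by (simp add: lie_part_def)
  show ?case
  proof (intro ext)
    fix I J
    show "tensor_op x (Suc n) I J = leibniz (X1 x) p D (Suc n) I J"
    proof (cases I; cases J)
      fix i I' j J' assume eq: "I = i # I'" "J = j # J'"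
      have L: "leibniz (X1 x) p D n I' J' = tensor_op x n I' J'" using Suc.IH by simp
      show ?thesis
      proof (cases "I \<in> Idx D (Suc n) \<and> J \<in> Idx D (Suc n)")
        case False
        then have out: "\<not> (i < D \<and> j < D \<and> I' \<in> Idx D n \<and> J' \<in> Idx D n)"
          by (auto simp: eq Idx_Cons)
        then have 1: "X1 x i j * one_on (Idx D n) I' J' = 0"
          by (auto simp: one_on_def X1_eq)
        have 2: "one_on {..<D} i j * tensor_op x n I' J' = 0"
          using out by (auto simp: one_on_def tensor_op_def)
        have 3: "tensor_op x (Suc n) (i # I') (j # J') = 0"
          using False unfolding tensor_op_def eq by (simp only: if_False)
        show ?thesis
          by (simp only: leibniz.simps eq tens_Cons L mult.assoc 1 2 3 mult_zero_right add_0_right)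
      next
        case True
        then have lt: "i < D" "j < D" "I' \<in> Idx D n" "J' \<in> Idx D n" by (auto simp: eq Idx_Cons)
        have "x (c i j * tcoef c p I' J') = x (c i j) * counit G (tcoef c p I' J') + counit G (c i j) * x (tcoef c p I' J')"
          using x unfolding lie_part_def by blast
        then have prod: "x (c i j * tcoef c p I' J') = x (c i j) * one_on (Idx D n) I' J' + one_on {..<D} i j * x (tcoef c p I' J')"
          using lt coefs(3)[of i j] counit_tcoef[OF lt(3,4)] by (simp add: one_on_def)
        have X0: "x (c i j) = 0" if "p i = p j"
        proof -
          have "c i j \<in> homog G (1 + 1)"
            using coefs(1)[OF lt(1,2)] unfolding that by simp
          then show ?thesis using x unfolding lie_part_def by blast
        qed
        have "tensor_op x (Suc n) I J = sg (p i + tpar p I') * (koszul (p i + p j) (tpar p I') *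
            (x (c i j) * one_on (Idx D n) I' J' + one_on {..<D} i j * x (tcoef c p I' J')))"
          using True unfolding tensor_op_def eq tcoef.simps tpar.simps koszul_scal
          by (simp only: if_True l.scale prod simp_thms)
        also have "\<dots> = sg (p i) * x (c i j) * one_on (Idx D n) I' J' +
            sg (p i) * one_on {..<D} i j * (sg (tpar p I') * x (tcoef c p I' J'))"
        proof -
          have 1: "sg (p i + tpar p I') * (koszul (p i + p j) (tpar p I') * x (c i j)) = sg (p i) * x (c i j)"
          proof (cases "p i = p j")
            case True
            then show ?thesis using X0 by simp
          next
            case False
            then have odd: "p i + p j = 1" by (cases "p i"; cases "p j") simp_all
            show ?thesis unfolding sg_add odd koszul_sg by (simp only: mult.assoc sg_simps)
          qed
          have 2: "koszul (p i + p j) (tpar p I') * one_on {..<D} i j = (one_on {..<D} i j :: 'k)"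
            by (auto simp: one_on_def koszul_def)
          have "sg (p i + tpar p I') * (koszul (p i + p j) (tpar p I') *
              (x (c i j) * one_on (Idx D n) I' J' + one_on {..<D} i j * x (tcoef c p I' J'))) =
            (sg (p i + tpar p I') * (koszul (p i + p j) (tpar p I') * x (c i j))) * one_on (Idx D n) I' J' +
            sg (p i + tpar p I') * ((koszul (p i + p j) (tpar p I') * one_on {..<D} i j) * x (tcoef c p I' J'))"
            by (simp only: distrib_left mult.assoc)
          also have "\<dots> = (sg (p i) * x (c i j)) * one_on (Idx D n) I' J' +
              sg (p i + tpar p I') * (one_on {..<D} i j * x (tcoef c p I' J'))"
            unfolding 1 2 ..
          finally show ?thesis by (simp only: sg_add mult_ac)
        qed
        also have "\<dots> = leibniz (X1 x) p D (Suc n) I J"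
          unfolding leibniz.simps eq tens_Cons L using lt by (simp add: X1_eq tensor_op_def)
        finally show ?thesis .
      qed
    qed (auto simp: tensor_op_def Idx_def)
  qed
qed

lemma tensor_op_commutes:
  fixes e :: "nat list \<Rightarrow> nat list \<Rightarrow> 'k"
  assumes x: "x \<in> lie_part G 1"
    and e: "e \<in> even_maps (Idx D n) (tpar p) (Idx D n) (tpar p)"
    and comm: "\<And>I J. I \<in> Idx D n \<Longrightarrow> J \<in> Idx D n \<Longrightarrow>
      (\<Sum>K\<in>Idx D n. scal G (e I K) (tcoef c p K J)) = (\<Sum>K\<in>Idx D n. scal G (e K J) (tcoef c p I K))"
  shows "mul (Idx D n) e (tensor_op x n) = mul (Idx D n) (tensor_op x n) e"
proof (intro ext)
  fix I J
  interpret l: Vector_Spaces.linear "scal G" "(*)" x using x by (simp add: lie_part_def)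
  let ?S = "Idx D n"
  show "mul ?S e (tensor_op x n) I J = mul ?S (tensor_op x n) e I J"
  proof (cases "I \<in> ?S \<and> J \<in> ?S")
    case False
    then have z: "e I K * tensor_op x n K J = 0" "tensor_op x n I K * e K J = 0" for K
      using even_mapsD[OF e, of I K] even_mapsD[OF e, of K J] by (auto simp: tensor_op_def)
    show ?thesis by (simp only: mul_def z sum.neutral_const)
  next
    case True
    have "mul ?S e (tensor_op x n) I J = (\<Sum>K\<in>?S. sg (tpar p I) * (e I K * x (tcoef c p K J)))"
      unfolding mul_def
    proof (intro sum.cong refl)
      fix K assume "K \<in> ?S"
      then show "e I K * tensor_op x n K J = sg (tpar p I) * (e I K * x (tcoef c p K J))"
        using even_mapsD[OF e, of I K] True by (cases "e I K = 0") (auto simp: tensor_op_def)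
    qed
    also have "\<dots> = sg (tpar p I) * x (\<Sum>K\<in>?S. scal G (e I K) (tcoef c p K J))"
      by (simp add: l.sum l.scale sum_distrib_left)
    also have "\<dots> = sg (tpar p I) * x (\<Sum>K\<in>?S. scal G (e K J) (tcoef c p I K))"
      using comm True by simp
    also have "\<dots> = (\<Sum>K\<in>?S. sg (tpar p I) * (e K J * x (tcoef c p I K)))"
      by (simp add: l.sum l.scale sum_distrib_left)
    also have "\<dots> = mul ?S (tensor_op x n) e I J"
      unfolding mul_def
    proof (intro sum.cong refl)
      fix K assume "K \<in> ?S"
      then show "sg (tpar p I) * (e K J * x (tcoef c p I K)) = tensor_op x n I K * e K J"
        using True by (simp only: tensor_op_def simp_thms if_True mult_ac)
    qed
    finally show ?thesis .
  qed
qed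

text \<open>
  Eliminating the coordinate \<open>m\<close> gives \<open>\<pi> = A h\<close>, where the image of \<open>h\<close> avoids the basis vector \<open>e\<^sub>m\<close>. A
  projection that kills all basis tensors avoiding \<open>e\<^sub>m\<close> kills \<open>h\<^sup>\<otimes>\<^sup>n\<close>; as it commutes with the
  equivariant matrix \<open>A\<^sup>\<otimes>\<^sup>n\<close>, it kills \<open>\<pi>\<^sup>\<otimes>\<^sup>n\<close> too.
\<close>

lemma idempotent_killing_tensor_power:
  fixes \<pi> :: "nat \<Rightarrow> nat \<Rightarrow> 'k"
  assumes \<pi>: "\<pi> \<in> even_maps {..<D} p {..<D} p"
    and v: "\<forall>j. v j \<noteq> 0 \<longrightarrow> j \<in> {..<D} \<and> p j = a" "v m \<noteq> 0" "\<And>i. (\<Sum>j<D. \<pi> i j * v j) = 0"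
  shows "\<exists>n. \<exists>e\<in>even_maps (Idx D n) (tpar p) (Idx D n) (tpar p). mul (Idx D n) e e = e \<and>
    e \<noteq> (\<lambda>I J. 0) \<and> mul (Idx D n) e (tpow \<pi> n) = (\<lambda>I J. 0) \<and>
    (\<forall>I\<in>Idx D n. \<forall>J\<in>Idx D n. (\<Sum>K\<in>Idx D n. scal G (e I K) (tcoef c p K J)) =
      (\<Sum>K\<in>Idx D n. scal G (e K J) (tcoef c p I K)))"
proof -
  have m: "m < D" using v by blast
  obtain A h where A: "A \<in> even_maps {..<D} p ({..<D} - {m}) p" and h: "h \<in> even_maps ({..<D} - {m}) p {..<D} p"
    and Ah: "mul ({..<D} - {m}) A h = \<pi>"
    using factor_through_smaller[OF finite_lessThan \<pi> v(1)[rule_format] v(2,3)] by blast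
  have Aev: "A \<in> even_maps {..<D} p {..<D} p" using A by (auto simp: even_maps_def)
  have hm: "h m j = 0" for j using even_mapsD[OF h, of m j] by blast
  have \<pi>eq: "\<pi> = mul {..<D} A h"
    unfolding Ah[symmetric] mul_def using m hm by (intro ext) (simp add: sum.remove)
  obtain n and e0 :: "nat list \<Rightarrow> nat list \<Rightarrow> rat" where
    e0: "e0 \<in> square_maps (Idx D n)" "mul (Idx D n) e0 e0 = e0" "e0 \<noteq> (\<lambda>I J. 0)"
    and e0_comm: "\<And>b :: nat list \<Rightarrow> nat list \<Rightarrow> rat. equivariant p D n b \<Longrightarrow>
      \<forall>I\<in>Idx D n. \<forall>J\<in>Idx D n. mul (Idx D n) e0 b I J = mul (Idx D n) b e0 I J"
    and e0_kills: "\<forall>I. \<forall>K\<in>Idx D n. m \<notin> set K \<longrightarrow> e0 I K = 0"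
    using central_projection_exists[OF m, of p] by (elim exE conjE) (rule that, assumption+, blast, assumption)
  let ?S = "Idx D n"
  define e where "e = (\<lambda>I J. of_rat (e0 I J) :: 'k)"
  have esq: "e \<in> square_maps ?S" using e0(1) by (auto simp: e_def even_maps_def)
  have ee: "mul ?S e e = e"
  proof (intro ext)
    fix I J
    have "mul ?S e e I J = of_rat (mul ?S e0 e0 I J)" by (simp add: e_def mul_def of_rat_sum of_rat_mult)
    then show "mul ?S e e I J = e I J" using e0(2) by (simp add: e_def)
  qed
  have vsk: "Vector_Spaces.vector_space ((*) :: 'k \<Rightarrow> 'k \<Rightarrow> 'k)"
    by unfold_locales (auto simp: algebra_simps)
  have e_comm: "mul ?S e f = mul ?S f e" if f: "equivariant p D n f" and fsq: "f \<in> square_maps ?S" for f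
  proof (intro ext)
    fix I J
    show "mul ?S e f I J = mul ?S f e I J"
    proof (cases "I \<in> ?S \<and> J \<in> ?S")
      case True
      then show ?thesis
        using commutes_with_equivariant[OF vsk e0_comm f, of I J] by (simp add: mul_def e_def mult.commute)
    next
      case False
      then have z: "e I K * f K J = 0" "f I K * e K J = 0" for K
        using even_mapsD[OF esq] even_mapsD[OF fsq] by (metis mult_eq_0_iff)+
      show ?thesis by (simp only: mul_def z sum.neutral_const)
    qed
  qed
  have eev: "e \<in> even_maps ?S (tpar p) ?S (tpar p)"
  proof (rule even_if_commutes_with_grading[OF finite_Idx esq])
    have "equivariant p D n (\<lambda>I J. sg (tpar p I) * one_on ?S I J :: 'k)"
      unfolding tpar_mset by (rule equivariant_graded_one)
    then show "mul ?S e (\<lambda>I J. sg (tpar p I) * one_on ?S I J) = mul ?S (\<lambda>I J. sg (tpar p I) * one_on ?S I J) e"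
      by (rule e_comm[OF _ grading_square])
  qed
  have "mul ?S e (tpow h n) = (\<lambda>I J. 0)"
  proof (intro ext)
    fix I J
    have z: "e I K * tpow h n K J = 0" if "K \<in> ?S" for K
      using e0_kills that tpow_zero[of h m K n J] hm by (cases "m \<in> set K") (auto simp: e_def)
    show "mul ?S e (tpow h n) I J = 0" unfolding mul_def by (rule sum.neutral) (use z in blast)
  qed
  moreover have "mul ?S e (tpow A n) = mul ?S (tpow A n) e"
    by (rule e_comm[OF equivariant_tpow[OF Aev] even_maps_square[OF even_maps_tpow[OF Aev]]])
  ultimately have e\<pi>: "mul ?S e (tpow \<pi> n) = (\<lambda>I J. 0)"
    unfolding \<pi>eq tpow_mul by (simp add: mul_assoc flip: mul_assoc[of ?S ?S e])
  have coact: "(\<Sum>K\<in>?S. scal G (e I K) (tcoef c p K J)) = (\<Sum>K\<in>?S. scal G (e K J) (tcoef c p I K))"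
    if "I \<in> ?S" "J \<in> ?S" for I J
    unfolding e_def using commutes_with_equivariant[OF vector_space e0_comm equivariant_tcoef that] .
  have "e \<noteq> (\<lambda>I J. 0)" using e0(3) by (simp add: e_def fun_eq_iff)
  then show ?thesis using eev ee e\<pi> coact by (intro exI[of _ n] bexI[of _ e] conjI ballI)
qed

text \<open>
  For \<open>\<pi> = 1 - \<nu>\<close> an idempotent \<open>e\<close> with \<open>e \<pi>\<^sup>\<otimes>\<^sup>n = 0\<close> satisfies \<open>e = e (1 - \<pi>\<^sup>\<otimes>\<^sup>n)\<close>, hence is negligible on the
  restriction to \<open>x\<close>, and its image is the required representation.
\<close>

lemma negligible_projection_gives_zero_restriction:
  assumes x: "x \<in> lie_part G 1"
    and \<nu>: "negl {..<D} p (X1 x) \<nu>" "mul {..<D} \<nu> \<nu> = \<nu>" "\<nu> \<noteq> (\<lambda>i j. 0)"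
  shows "\<exists>M\<in>Rep G. fst M \<noteq> [] \<and> ss_zero_object (restrict_m x M)"
proof -
  have odd: "X1 x i j \<noteq> 0 \<Longrightarrow> i < D \<and> j < D \<and> p i \<noteq> p j" for i j
    using Rep_mD(2)[OF restrict_Rep_m[OF x rep], of i j] by (simp add: X1_def restrict_m_def D_def p_def)
  define \<pi> where "\<pi> = (\<lambda>i j. one_on {..<D} i j - \<nu> i j)"
  have \<nu>ev: "\<nu> \<in> even_maps {..<D} p {..<D} p" using \<nu> by (simp add: negl_def maps_def)
  have \<pi>ev: "\<pi> \<in> even_maps {..<D} p {..<D} p"
    unfolding \<pi>_def by (intro even_maps_diff even_maps_one \<nu>ev)
  have "mul {..<D} \<pi> \<nu> = (\<lambda>i j. 0)"
    unfolding \<pi>_def mul_diff_left using \<nu> by (simp add: even_maps_mul_one[OF \<nu>ev])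
  then have ker: "(\<Sum>j<D. \<pi> i j * \<nu> j l) = 0" for i l by (simp add: mul_def fun_eq_iff)
  obtain m j0 where mj: "\<nu> m j0 \<noteq> 0" using \<nu>(3) by (auto simp: fun_eq_iff)
  have hom: "\<forall>j. \<nu> j j0 \<noteq> 0 \<longrightarrow> j \<in> {..<D} \<and> p j = p j0"
    using even_mapsD[OF \<nu>ev] by blast
  obtain n e where eev: "e \<in> even_maps (Idx D n) (tpar p) (Idx D n) (tpar p)" and ee: "mul (Idx D n) e e = e"
    and e0: "e \<noteq> (\<lambda>I J. 0)" and e\<pi>: "mul (Idx D n) e (tpow \<pi> n) = (\<lambda>I J. 0)"
    and coact0: "\<forall>I\<in>Idx D n. \<forall>J\<in>Idx D n. (\<Sum>K\<in>Idx D n. scal G (e I K) (tcoef c p K J)) =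
      (\<Sum>K\<in>Idx D n. scal G (e K J) (tcoef c p I K))"
    using idempotent_killing_tensor_power[OF \<pi>ev hom mj ker] by (elim exE bexE conjE) simp_all
  note coact = coact0[rule_format]
  let ?S = "Idx D n" and ?X = "tensor_op x n"
  have e_maps: "e \<in> endos ?S (tpar p) ?X"
    using eev tensor_op_commutes[OF x eev coact] by (simp add: maps_def)
  have e_negl: "negl ?S (tpar p) ?X e"
    unfolding negl_def
  proof (intro conjI ballI e_maps)
    fix h assume h: "h \<in> endos ?S (tpar p) ?X"
    let ?d = "\<lambda>I J. one_on ?S I J - tpow \<pi> n I J"
    have d: "negl ?S (tpar p) ?X ?d"
      unfolding tensor_op_leibniz[OF x] \<pi>_def by (rule negl_one_minus_tpow[OF odd \<nu>(1)])
    have "mul ?S e ?d = e"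
      unfolding mul_diff_right e\<pi> by (simp add: even_maps_mul_one[OF eev])
    then have "str ?S (tpar p) (mul ?S e h) = str ?S (tpar p) (mul ?S e (mul ?S ?d h))"
      by (simp flip: mul_assoc)
    also have "\<dots> = str ?S (tpar p) (mul ?S (mul ?S ?d h) e)"
      using d h eev by (intro str_mul_commute even_maps_mul) (auto simp: negl_def maps_def)
    also have "\<dots> = 0"
      using d maps_mul[OF e_maps h] by (simp add: negl_def mul_assoc)
    finally show "str ?S (tpar p) (mul ?S e h) = 0" .
  qed
  obtain qs u r where u: "u \<in> even_maps ?S (tpar p) {..<length qs} ((!) qs)"
    and r: "r \<in> even_maps {..<length qs} ((!) qs) ?S (tpar p)"
    and ur: "mul {..<length qs} u r = e" and ru: "mul ?S r u = one_on {..<length qs}"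
    using even_idempotent_splits[OF finite_Idx eev ee] by blast
  let ?M = "(qs, mat (length qs) (length qs) (\<lambda>(a, b). image_coef n u r a b))"
  have M: "?M \<in> Rep G"
    by (rule image_rep[OF u r ru]) (simp add: ur coact)
  have "qs \<noteq> []"
  proof
    assume "qs = []"
    then have "e = (\<lambda>I J. 0)" using ur by (simp add: mul_def)
    then show False using e0 by simp
  qed
  moreover have "fst (restrict_m x ?M) = qs" by (simp add: restrict_m_def)
  then have "ss_zero_object (restrict_m x ?M)"
    unfolding ss_zero_object_iff[OF restrict_Rep_m[OF x M]]
    using str_on_negligible_image[OF _ u r ru restrict_image[OF x u r]] e_negl ur by simp
  ultimately show ?thesis using M by (metis fst_conv)
qed

end

section \<open>The intersection of all supports\<close>

text \<open>
  Its support shows that an element of all supports is an odd element of the Lie superalgebra.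
\<close>

lemma trivial_rep:
  assumes "algebraic_supergroup G"
  shows "([0], mat 1 1 (\<lambda>_. 1)) \<in> Rep G"
proof -
  interpret algebraic_supergroup G by (rule assms)
  show ?thesis
    using homog_one comult_one counit_one by (simp add: Rep_def)
qed

lemma negligible_projection_zero:
  fixes G :: "('k::field_char_0, 'a::ring_1) supergroup"
  assumes G: "algebraic_supergroup G" and x: "x \<in> lie_part G 1"
    and supp: "\<And>M. M \<in> Rep G \<Longrightarrow> fst M \<noteq> [] \<Longrightarrow> x \<in> supp G M"
    and M: "M \<in> Rep G"
    and \<nu>: "negl (idx (restrict_m x M)) (par (restrict_m x M)) (op_of (restrict_m x M)) \<nu>"
      "mul (idx (restrict_m x M)) \<nu> \<nu> = \<nu>"
  shows "\<nu> = (\<lambda>i j. 0)"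
proof (rule ccontr)
  assume "\<nu> \<noteq> (\<lambda>i j. 0)"
  obtain ps C where MC: "M = (ps, C)" by (cases M)
  interpret super_rep G ps C
    using G M by (simp add: super_rep_def super_rep_axioms_def MC)
  have "fst (restrict_m x M) = ps" by (simp add: restrict_m_def MC)
  then have "\<exists>M\<in>Rep G. fst M \<noteq> [] \<and> ss_zero_object (restrict_m x M)"
    using \<nu> \<open>\<nu> \<noteq> (\<lambda>i j. 0)\<close> by (intro negligible_projection_gives_zero_restriction[OF x, of \<nu>])
      (simp_all add: D_def p_def X1_def MC)
  then show False using supp by (auto simp: supp_def)
qed

text \<open>
  An odd operator invertible on the image of a commuting projection \<open>\<nu>\<close> makes \<open>\<nu>\<close> negligible: moving
  it around the supertrace changes the sign.
\<close>

lemma invertible_part_negligible: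
  fixes X :: "'i \<Rightarrow> 'i \<Rightarrow> 'k::field_char_0"
  assumes fin: "finite S" and X: "\<And>i j. X i j \<noteq> 0 \<Longrightarrow> i \<in> S \<and> j \<in> S \<and> p i \<noteq> p j"
  shows "\<exists>\<nu> k. negl S p X \<nu> \<and> mul S \<nu> \<nu> = \<nu> \<and> mul S (fpow S (mul S X X) k) \<nu> = fpow S (mul S X X) k"
proof -
  let ?Y = "mul S X X"
  have Xsq: "X \<in> square_maps S" using X by (auto simp: even_maps_def)
  have Ysq: "?Y \<in> square_maps S" by (rule even_maps_mul[OF Xsq Xsq])
  from fitting[OF fin Ysq] obtain \<nu> w k where
    \<nu>: "\<nu> \<in> square_maps S" "w \<in> square_maps S" "mul S \<nu> \<nu> = \<nu>" "mul S ?Y w = \<nu>" "mul S w ?Y = \<nu>"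
      "mul S (fpow S ?Y k) \<nu> = fpow S ?Y k"
    and comm: "\<And>g. g \<in> square_maps S \<Longrightarrow> mul S ?Y g = mul S g ?Y \<Longrightarrow> mul S \<nu> g = mul S g \<nu> \<and> mul S w g = mul S g w"
    by blast
  let ?\<Gamma> = "\<lambda>i j. sg (p i) * one_on S i j :: 'k"
  have \<Gamma>sq: "?\<Gamma> \<in> square_maps S" by (rule grading_square)
  have X\<Gamma>: "mul S X ?\<Gamma> i k = - mul S ?\<Gamma> X i k" for i k
    using X[of i k] sg_neq[where 'a = 'k, of "p i" "p k"]
    by (cases "X i k = 0") (auto simp: mul_diag_left[OF fin] mul_diag_right[OF fin] mult.commute)
  have "mul S ?Y ?\<Gamma> = mul S ?\<Gamma> ?Y"
  proof -
    have eq: "mul S X ?\<Gamma> = (\<lambda>i k. - mul S ?\<Gamma> X i k)" using X\<Gamma> by (intro ext)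
    have neg: "mul S a (\<lambda>i k. - b i k) = (\<lambda>i k. - mul S a b i k)" "mul S (\<lambda>i k. - b i k) a = (\<lambda>i k. - mul S b a i k)"
      for a b :: "'i \<Rightarrow> 'i \<Rightarrow> 'k" by (simp_all add: mul_def sum_negf)
    have "mul S ?Y ?\<Gamma> = (\<lambda>i k. - mul S (mul S X ?\<Gamma>) X i k)"
      by (simp only: mul_assoc) (simp only: eq neg)
    also have "\<dots> = mul S ?\<Gamma> ?Y" unfolding eq neg by (simp add: mul_assoc)
    finally show ?thesis .
  qed
  then have ev: "\<nu> \<in> even_maps S p S p" "w \<in> even_maps S p S p"
    using comm[OF \<Gamma>sq] \<nu> by (auto intro!: even_if_commutes_with_grading[OF fin])
  have cX: "mul S \<nu> X = mul S X \<nu>" "mul S w X = mul S X w"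
    using comm[OF Xsq] by (auto simp: mul_assoc)
  have "str S p (mul S \<nu> h) = 0" if h: "h \<in> endos S p X" for h
  proof -
    have hX: "mul S h X = mul S X h" using h by (simp add: maps_def)
    have "str S p (mul S \<nu> h) = str S p (mul S X (mul S (mul S X w) h))"
      by (simp add: mul_assoc flip: \<nu>(4))
    also have "\<dots> = - str S p (mul S (mul S (mul S X w) h) X)"
      by (rule str_odd_commute) (use X in blast)
    also have "mul S (mul S (mul S X w) h) X = mul S (mul S X (mul S w X)) h"
      by (simp add: mul_assoc hX)
    also have "\<dots> = mul S \<nu> h"
      unfolding cX(2) by (simp add: mul_assoc flip: \<nu>(4))
    finally show ?thesis by simp
  qed
  then have "negl S p X \<nu>"
    using ev cX by (simp add: negl_def maps_def)
  then show ?thesis using \<nu> by blast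
qed

lemma str_one_sdim: "end_str V (one_on (idx V)) = of_int (sdim (fst V))"
proof -
  have "end_str V (one_on (idx V)) = (\<Sum>i<length (fst V). sg (fst V ! i))"
    by (simp add: str_def one_on_def)
  also have "\<dots> = sum_list (map sg (fst V))"
    by (simp add: sum_list_sum_nth atLeast0LessThan)
  also have "\<dots> = of_int (sdim (fst V))"
  proof -
    have "sum_list (map sg ps) = (of_int (sdim ps) :: 'a)" for ps
    proof (induction ps)
      case (Cons a ps)
      then show ?case by (cases a) (auto simp: sdim_def)
    qed (simp add: sdim_def)
    then show ?thesis .
  qed
  finally show ?thesis .
qed

text \<open>
  Over an algebraically closed field an endomorphism of an indecomposable object is a scalar plus a
  nilpotent one, so its supertrace is a multiple of the superdimension.
\<close>

lemma indecomposable_str: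
  fixes N :: "'k::{alg_closed_field, field_char_0} m_module"
  assumes N: "N \<in> Rep_m" "m_indecomposable N" and h: "h \<in> homs N N"
  shows "\<exists>a. end_str N h = a * of_int (sdim (fst N))"
proof -
  let ?n = "length (fst N)" and ?S = "idx N"
  have n: "?n > 0" using N by (simp add: m_indecomposable_def)
  let ?h = "to_mat N N h"
  have hc: "?h \<in> carrier_mat ?n ?n" and he: "entries ?h = h"
    using to_mat_hom[OF N(1) N(1) h] by (auto simp: m_hom_iff[OF N(1) N(1)])
  have "degree (char_poly ?h) = ?n" using degree_monic_char_poly[OF hc] by simp
  then obtain a where "poly (char_poly ?h) a = 0"
    using n alg_closed_imp_poly_has_root[of "char_poly ?h"] by auto
  (* an eigenvalue; h - a is then not invertible, and its Fitting projection must vanish *)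
  then have "eigenvalue ?h a" using eigenvalue_root_char_poly[OF hc] by simp
  then obtain v where v: "v \<in> carrier_vec ?n" "v \<noteq> 0\<^sub>v ?n" "?h *\<^sub>v v = a \<cdot>\<^sub>v v"
    using hc by (auto simp: eigenvalue_def eigenvector_def)
  define y where "y = (\<lambda>i j. h i j - a * one_on ?S i j)"
  have one: "one_on ?S \<in> homs N N" using N by (simp add: maps_one Rep_mD)
  have aone: "(\<lambda>i j. a * one_on ?S i j) \<in> homs N N"
  proof -
    have "(\<lambda>i j. a * one_on ?S i j) \<in> even_maps ?S (par N) ?S (par N)"
      by (auto simp: even_maps_def one_on_def)
    moreover
    have "mul S (\<lambda>i j. a * f i j) g = (\<lambda>i j. a * mul S f g i j)" "mul S g (\<lambda>i j. a * f i j) = (\<lambda>i j. a * mul S g f i j)"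
      for S and f g :: "nat \<Rightarrow> nat \<Rightarrow> 'k" by (simp_all add: mul_def sum_distrib_left mult_ac)
    ultimately show ?thesis using one by (simp add: maps_def)
  qed
  have y: "y \<in> homs N N" unfolding y_def by (intro maps_diff h aone)
  have yv: "(\<Sum>j<?n. y i j * (v $ j)) = 0" if i: "i < ?n" for i
  proof -
    have "(\<Sum>j<?n. h i j * (v $ j)) = (?h *\<^sub>v v) $ i"
      using i v(1) by (auto simp: to_mat_def scalar_prod_def atLeast0LessThan intro!: sum.cong)
    also have "\<dots> = a * v $ i" using v i by simp
    also have "\<dots> = (\<Sum>j<?n. a * one_on ?S i j * (v $ j))"
      using i by (simp add: one_on_def if_distrib if_distribR cong: if_cong)
    finally show ?thesis by (simp add: y_def left_diff_distrib sum_subtractf)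
  qed
  have ysq: "y \<in> square_maps ?S" using y by (auto simp: maps_def intro: even_maps_square)
  from fitting[OF finite_lessThan ysq] obtain \<nu> w k where
    \<nu>: "\<nu> \<in> square_maps ?S" "mul ?S \<nu> \<nu> = \<nu>" "mul ?S w y = \<nu>" "mul ?S (fpow ?S y k) \<nu> = fpow ?S y k"
    and comm: "\<And>g. g \<in> square_maps ?S \<Longrightarrow> mul ?S y g = mul ?S g y \<Longrightarrow> mul ?S \<nu> g = mul ?S g \<nu>"
    by blast
  let ?\<Gamma> = "\<lambda>i j. sg (par N i) * one_on ?S i j :: 'k"
  have "mul ?S y ?\<Gamma> = mul ?S ?\<Gamma> y"
    using y by (intro even_commutes_with_grading) (auto simp: maps_def)
  from comm[OF grading_square this] have "\<nu> \<in> even_maps ?S (par N) ?S (par N)"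
    by (rule even_if_commutes_with_grading[OF finite_lessThan \<nu>(1)])
  moreover have "mul ?S \<nu> (op_of N) = mul ?S (op_of N) \<nu>"
    using comm[OF Rep_mD(3)[OF N(1)]] y by (simp add: maps_def)
  ultimately have "\<nu> \<in> homs N N" by (simp add: maps_def)
  from indecomposable_idempotent[OF N this \<nu>(2)] have "\<nu> = (\<lambda>i j. 0)"
  proof
    assume id: "\<nu> = one_on ?S"
    have "v $ i = 0" if i: "i < ?n" for i
    proof -
      have "v $ i = (\<Sum>j<?n. if j = i then v $ i else 0)" using i by simp
      also have "\<dots> = (\<Sum>j<?n. mul ?S w y i j * (v $ j))"
        unfolding \<nu>(3) id using i by (intro sum.cong) (auto simp: one_on_def)
      also have "\<dots> = (\<Sum>l<?n. w i l * (\<Sum>j<?n. y l j * (v $ j)))"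
        unfolding mul_def sum_distrib_left sum_distrib_right by (subst sum.swap) (simp add: mult.assoc)
      also have "\<dots> = 0" using yv by simp
      finally show ?thesis .
    qed
    then have "v = 0\<^sub>v ?n" using v(1) by (intro eq_vecI) auto
    then show ?thesis using v(2) by simp
  qed
  then have "fpow ?S y k = (\<lambda>i j. 0)" using \<nu>(4) by simp
  then have "end_str N y = 0"
    using y by (intro str_nilpotent) (auto simp: maps_def)
  moreover have "end_str N y = end_str N h - a * end_str N (one_on ?S)"
    unfolding str_def y_def by (simp add: right_diff_distrib sum_subtractf sum_distrib_left mult_ac)
  ultimately show ?thesis
    by (intro exI[of _ a]) (simp add: str_one_sdim)
qed


lemma fpow_square:
  assumes "finite S" "f \<in> square_maps S"
  shows "fpow S (mul S f f) k = fpow S f (2 * k)"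
proof (induction k)
  case (Suc k)
  then show ?case by (simp add: mul_assoc)
qed simp

text \<open>
  The Fitting projection onto the invertible part is negligible, hence zero, which makes the operator
  nilpotent. The projection onto an indecomposable summand of superdimension \<open>0\<close> would be negligible
  and non-zero.
\<close>

lemma neat_if_in_all_supports:
  fixes G :: "('k::{alg_closed_field, field_char_0}, 'a::ring_1) supergroup"
  assumes G: "algebraic_supergroup G" and x: "x \<in> lie_part G 1"
    and supp: "\<And>M. M \<in> Rep G \<Longrightarrow> fst M \<noteq> [] \<Longrightarrow> x \<in> supp G M"
    and M: "M \<in> Rep G"
  shows "acts_neatly (restrict_m x M)"
proof -
  let ?V = "restrict_m x M"
  have V: "?V \<in> Rep_m" by (rule restrict_Rep_m[OF x M])
  have zero: "\<nu> = (\<lambda>i j. 0)"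
    if "negl (idx ?V) (par ?V) (op_of ?V) \<nu>" "mul (idx ?V) \<nu> \<nu> = \<nu>" for \<nu>
    using negligible_projection_zero[OF G x _ M that] supp by blast
  obtain \<nu> k where \<nu>: "negl (idx ?V) (par ?V) (op_of ?V) \<nu>" "mul (idx ?V) \<nu> \<nu> = \<nu>"
      "mul (idx ?V) (fpow (idx ?V) (mul (idx ?V) (op_of ?V) (op_of ?V)) k) \<nu> =
        fpow (idx ?V) (mul (idx ?V) (op_of ?V) (op_of ?V)) k"
    using invertible_part_negligible[of "idx ?V" "op_of ?V" "par ?V", OF finite_lessThan Rep_mD(2)[OF V]] by blast
  have "fpow (idx ?V) (op_of ?V) (2 * k) = (\<lambda>i j. 0)"
    using \<nu>(3) unfolding zero[OF \<nu>(1,2)] fpow_square[OF finite_lessThan Rep_mD(3)[OF V]] by simp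
  then have "entries (snd ?V ^\<^sub>m (2 * k)) = entries (0\<^sub>m (length (fst ?V)) (length (fst ?V)))"
    by (simp add: entries_pow[OF Rep_mD(1)[OF V]] entries_zero)
  then have "snd ?V ^\<^sub>m (2 * k) = 0\<^sub>m (length (fst ?V)) (length (fst ?V))"
    using Rep_mD(1)[OF V] by (intro entries_inject) auto
  then have nil: "acts_nilpotently ?V" unfolding acts_nilpotently_def by blast
  have "sdim (fst N) \<noteq> 0" if N: "direct_summand N ?V" "m_indecomposable N" for N
  proof
    assume sd: "sdim (fst N) = 0"
    have NR: "N \<in> Rep_m" using N(1) by (simp add: direct_summand_def)
    obtain u r where ur: "retract N ?V u r" using direct_summand_retract[OF V N(1)] by blast
    then have u: "u \<in> homs N ?V" and r: "r \<in> homs ?V N" and ru: "mul (idx ?V) r u = one_on (idx N)"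
      by (auto simp: retract_def)
    let ?e = "mul (idx N) u r"
    have "?e \<in> homs ?V ?V" by (rule maps_mul[OF r u])
    moreover have "end_str ?V (mul (idx ?V) ?e h) = 0" if h: "h \<in> homs ?V ?V" for h
    proof -
      have rh: "mul (idx ?V) r h \<in> homs ?V N" by (rule maps_mul[OF h r])
      have "end_str ?V (mul (idx ?V) ?e h) = end_str ?V (mul (idx N) u (mul (idx ?V) r h))"
        by (simp add: mul_assoc)
      also have "\<dots> = end_str N (mul (idx ?V) (mul (idx ?V) r h) u)"
        using u rh by (intro str_mul_commute) (auto simp: maps_def)
      also have "\<dots> = 0"
        using indecomposable_str[OF NR N(2) maps_mul[OF u rh]] sd by auto
      finally show ?thesis .
    qed
    ultimately have "negl (idx ?V) (par ?V) (op_of ?V) ?e" by (simp add: negl_def)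
    moreover have "mul (idx ?V) ?e ?e = ?e"
    proof -
      have "mul (idx ?V) ?e ?e = mul (idx N) u (mul (idx N) (mul (idx ?V) r u) r)"
        by (simp add: mul_assoc)
      then show ?thesis unfolding ru by (simp add: maps_mul_one[OF r])
    qed
    ultimately have e0: "?e = (\<lambda>i j. 0)" by (intro zero)
    have "u = mul (idx ?V) ?e u"
      using maps_mul_one(2)[OF u] by (simp add: mul_assoc ru)
    then have "one_on (idx N) = (\<lambda>i j. 0 :: 'k)"
      using ru unfolding e0 by simp
    then have "one_on (idx N) 0 0 = (0 :: 'k)" by simp
    then show False
      using N(2) by (simp add: one_on_def m_indecomposable_def)
  qed
  then show ?thesis using nil by (simp add: acts_neatly_def)
qed

text \<open>
  The projection onto an indecomposable summand has as supertrace the superdimension of that summand.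
\<close>

lemma in_support_if_neat:
  fixes G :: "('k::field_char_0, 'a::ring_1) supergroup"
  assumes x: "x \<in> lie_part G 1" and M: "M \<in> Rep G" "fst M \<noteq> []" and neat: "acts_neatly (restrict_m x M)"
  shows "x \<in> supp G M"
proof -
  let ?V = "restrict_m x M"
  have V: "?V \<in> Rep_m" by (rule restrict_Rep_m[OF x M(1)])
  have "fst ?V \<noteq> []" using M by (simp add: restrict_m_def)
  then obtain N u r where N: "N \<in> Rep_m" "m_indecomposable N" "retract N ?V u r"
    using exists_indecomposable_retract[OF V] by blast
  then have u: "u \<in> homs N ?V" and r: "r \<in> homs ?V N" and ru: "mul (idx ?V) r u = one_on (idx N)"
    by (auto simp: retract_def)
  have "sdim (fst N) \<noteq> 0"
    using neat N(2) retract_direct_summand[OF V N(1,3)] unfolding acts_neatly_def by blast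
  moreover have "end_str ?V (mul (idx N) u r) = of_int (sdim (fst N))"
    using str_mul_commute[of u "idx ?V" "par ?V" "idx N" "par N" r] u r
    by (simp add: maps_def ru str_one_sdim)
  ultimately have "\<not> ss_zero_object ?V"
    unfolding ss_zero_object_iff[OF V] using maps_mul[OF r u] by fastforce
  then show ?thesis using x by (simp add: supp_def)
qed

theorem proposition6p5p5:
  fixes G :: "('k::{alg_closed_field, field_char_0}, 'a::ring_1) supergroup"
  assumes "algebraic_supergroup G"
  shows "(\<Inter>M\<in>{M \<in> Rep G. fst M \<noteq> []}. supp G M) = lie_neat G"
proof (intro equalityI subsetI)
  fix x assume "x \<in> (\<Inter>M\<in>{M \<in> Rep G. fst M \<noteq> []}. supp G M)"
  then have supp: "\<And>M. M \<in> Rep G \<Longrightarrow> fst M \<noteq> [] \<Longrightarrow> x \<in> supp G M" by blast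
  have x: "x \<in> lie_part G 1"
    using supp[OF trivial_rep[OF assms]] by (simp add: supp_def)
  then show "x \<in> lie_neat G"
    using neat_if_in_all_supports[OF assms x supp]
    by (simp add: lie_neat_def lie_nilpotent_def acts_neatly_def)
next
  fix x assume "x \<in> lie_neat G"
  then have "x \<in> lie_part G 1" "\<forall>M\<in>Rep G. acts_neatly (restrict_m x M)"
    by (auto simp: lie_neat_def lie_nilpotent_def)
  then show "x \<in> (\<Inter>M\<in>{M \<in> Rep G. fst M \<noteq> []}. supp G M)"
    using in_support_if_neat by blast
qed

end
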